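(* Fix $\lambda>0$ and an integer $d\ge0$. Let $\mathcal{G}_n$ be an Erdős–Rényi random graph on $n$ vertices with edge probability $p=\lambda/n$, let $M_i$ be the degree of vertex $v_i$, and let $W_d:=\sum_{i=1}^n\mathbf{1}\{M_i\ne d\}$, with $\mu_d:=\mathbb{E}W_d$ and $\sigma^2:=\mathrm{Var}(W_d)$. Then, as $n\to\infty$, \[ d_{\mathrm{TV}}\big(\mathcal{L}(W_d),\mathrm{TP}(\mu_d,\sigma^2)\big)=O(1/\sigma),\qquad d_{\mathrm{loc}}\big(\mathcal{L}(W_d),\mathrm{TP}(\mu_d,\sigma^2)\big)=O\big((\log\sigma)^{5/2}/\sigma^2\big). \]
   Context: The Erdős–Rényi graph $\mathcal{G}_n$ on vertex set $\{v_1,\dots,v_n\}$ has independent edge indicators $E_{ij}=E_{ji}\sim\mathrm{Be}(p)$ for $i\ne j$ and $E_{ii}=0$. $\mathrm{TP}(\mu,\sigma^2)$ is the law of $Z$ with $Z-s\sim\mathrm{Po}(\sigma^2+\gamma)$, $s=\lfloor\mu-\sigma^2\rfloor$, $\gamma=\mu-\sigma^2-s$. $d_{\mathrm{TV}}$ is total variation distance and $d_{\mathrm{loc}}(\mathcal{L}(X),\mathcal{L}(Y))=\sup_{a\in\mathbb{Z}}|\mathbb{P}(X=a)-\mathbb{P}(Y=a)|$. (Here $\sigma^2$ is of strict order $n$.) *)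

theory Defs
  imports "HOL-Probability.Probability" "HOL-Library.Landau_Symbols"
begin

definition Po :: "real \<Rightarrow> nat pmf" where
  "Po r = (if r \<le> 0 then return_pmf 0 else poisson_pmf r)"

definition TP :: "real \<Rightarrow> real \<Rightarrow> int pmf" where
  "TP mu s2 = (let s = \<lfloor>mu - s2\<rfloor>; g = mu - s2 - real_of_int s
               in map_pmf (\<lambda>k. s + int k) (Po (s2 + g)))"

definition dTV :: "'a pmf \<Rightarrow> 'a pmf \<Rightarrow> real" where
  "dTV P Q = (SUP A. \<bar>measure_pmf.prob P A - measure_pmf.prob Q A\<bar>)"

definition dloc :: "int pmf \<Rightarrow> int pmf \<Rightarrow> real" where
  "dloc P Q = (SUP a. \<bar>pmf P a - pmf Q a\<bar>)"

(* Erdos-Renyi graph G(n,p) on vertices {0..<n}: independent Be(p) indicators for unordered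
   pairs, encoded as pairs (i,j) with i < j < n *)
definition ER :: "nat \<Rightarrow> real \<Rightarrow> (nat \<times> nat \<Rightarrow> bool) pmf" where
  "ER n p = Pi_pmf {(i, j). i < j \<and> j < n} False (\<lambda>_. bernoulli_pmf p)"

definition adj :: "(nat \<times> nat \<Rightarrow> bool) \<Rightarrow> nat \<Rightarrow> nat \<Rightarrow> bool" where
  "adj E i j = (i \<noteq> j \<and> E (min i j, max i j))"

definition degree :: "nat \<Rightarrow> (nat \<times> nat \<Rightarrow> bool) \<Rightarrow> nat \<Rightarrow> nat" where
  "degree n E i = card {j. j < n \<and> adj E i j}"

definition W :: "nat \<Rightarrow> nat \<Rightarrow> (nat \<times> nat \<Rightarrow> bool) \<Rightarrow> nat" where
  "W n d E = card {i. i < n \<and> degree n E i \<noteq> d}"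

definition lawW :: "real \<Rightarrow> nat \<Rightarrow> nat \<Rightarrow> int pmf" where
  "lawW lam d n = map_pmf (\<lambda>E. int (W n d E)) (ER n (lam / real n))"

definition muW :: "real \<Rightarrow> nat \<Rightarrow> nat \<Rightarrow> real" where
  "muW lam d n = measure_pmf.expectation (lawW lam d n) real_of_int"

definition varW :: "real \<Rightarrow> nat \<Rightarrow> nat \<Rightarrow> real" where
  "varW lam d n = measure_pmf.variance (lawW lam d n) real_of_int"

end

theory Submission
  imports Defs
begin

text \<open>
  The proof compares characteristic functions, using a differential inequality in the spirit of
  Stein's method.

  \<^emph>\<open>Smoothing.\<close> Choose about \<open>\<epsilon>n\<close> disjoint pairs of vertices \<open>u\<close>, \<open>v\<close> and let \<open>V\<close> be the set of
  remaining vertices. Moving one neighbour in \<open>V\<close> from \<open>u\<close> to \<open>v\<close> or back is a measure-preserving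
  involution that changes the degrees of \<open>u\<close> and \<open>v\<close> only; with probability bounded below it turns
  the degrees \<open>(d+1, d+1)\<close> into \<open>(d, d+2)\<close>, which changes the count \<open>W\<close> by one. Averaging over these
  independent moves gives \<open>\<bar>E (g e\<^sup>i\<^sup>t\<^sup>W)\<bar> \<le> sup \<bar>g\<bar> exp (C \<bar>F\<bar> - c n t\<^sup>2)\<close> for \<open>\<bar>t\<bar> \<le> \<pi>\<close> whenever \<open>g\<close> depends
  only on the edges that meet a vertex set \<open>F\<close>.

  \<^emph>\<open>Differential inequality.\<close> Removing a vertex and Taylor expanding the effect of its edges on \<open>W\<close>,
  with smoothing applied to the remainders, yields
  \<open>\<phi>' t = - \<sigma>\<^sup>2 t \<phi> t + O (n t\<^sup>2 exp (- c n t\<^sup>2))\<close> for the centred characteristic function. The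
  translated Poisson law satisfies the same relation up to \<open>O ((\<bar>t\<bar> + n t\<^sup>2) exp (- c n t\<^sup>2))\<close>, so the
  difference of the two characteristic functions is \<open>O ((t\<^sup>2 + n \<bar>t\<bar>\<^sup>3) exp (- c n t\<^sup>2))\<close>.

  \<^emph>\<open>Inversion.\<close> Fourier inversion bounds the local distance by \<open>O (1/n)\<close>. Bessel's inequality for
  the difference and for its derivative, with Cauchy-Schwarz for the weight \<open>1 + (a - \<mu>)\<^sup>2 / n\<close>, bounds
  the total variation distance by \<open>O (1/\<surd>n)\<close>.
\<close>

text \<open>The swap of one pair must not interfere with the others, so it has to keep the degrees
  of all other vertices, and it is controlled only when both neighbourhoods lie in \<open>V\<close>:
  an edge from a chosen vertex to another chosen vertex or to \<open>F\<close> spoils its pair. At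
  edge probability \<open>lam / n\<close>, the number of such edges among the chosen vertices is of
  order \<open>\<epsilon>^2 * n\<close>, against about \<open>\<epsilon> * n\<close> pairs, so a
  small \<open>\<epsilon>\<close> wins. The amplitude \<open>g\<close>, at the price
  \<open>exp (C * card F)\<close>, is what makes Taylor remainders usable: once the neighbourhood
  \<open>M\<close> of a vertex is revealed, the remainder is a function of the degrees in
  \<open>M\<close>, and \<open>card M\<close> has bounded exponential moments. No variance is
  computed. The coefficient in the differential inequality first appears as
  \<open>n * kappa\<close>; letting \<open>t\<close> tend to 0 with \<open>n\<close> fixed shows
  that it is the variance, and smoothing at \<open>t\<close> of order \<open>1 / sqrt n\<close>
  forces the variance to be at least of order \<open>n\<close>. The local bound has no logarithm;
  the claimed factor enters only through being at least 1.\<close>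

section \<open>Random subsets\<close>

text \<open>The mean of \<open>h S\<close> for a random subset \<open>S\<close> of \<open>I\<close> that contains each element independently with
  probability \<open>p\<close>. A finite sum, so that no integrability conditions arise; a graph is a set of
  two-element vertex sets.\<close>
definition bern_mean :: "real \<Rightarrow> 'e set \<Rightarrow> ('e set \<Rightarrow> 'b::real_normed_vector) \<Rightarrow> 'b" where
  "bern_mean p I h = (\<Sum>S\<in>Pow I. (p ^ card S * (1 - p) ^ card (I - S)) *\<^sub>R h S)"

lemma bern_mean_cong: "(\<And>S. S \<subseteq> I \<Longrightarrow> h S = h' S) \<Longrightarrow> bern_mean p I h = bern_mean p I h'"
  unfolding bern_mean_def by (intro sum.cong) auto

lemma bern_mean_add: "bern_mean p I (\<lambda>S. h S + h' S) = bern_mean p I h + bern_mean p I h'"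
  unfolding bern_mean_def by (simp add: scaleR_add_right sum.distrib)

lemma bern_mean_diff: "bern_mean p I (\<lambda>S. h S - h' S) = bern_mean p I h - bern_mean p I h'"
  unfolding bern_mean_def by (simp add: scaleR_diff_right sum_subtractf)

lemma bern_mean_sum: "bern_mean p I (\<lambda>S. \<Sum>j\<in>J. h j S) = (\<Sum>j\<in>J. bern_mean p I (h j))"
  unfolding bern_mean_def by (simp add: scaleR_sum_right, subst sum.swap) simp

lemma bern_mean_mult_left:
  fixes h :: "'e set \<Rightarrow> 'b::real_normed_algebra"
  shows "bern_mean p I (\<lambda>S. c * h S) = c * bern_mean p I h"
  unfolding bern_mean_def by (simp add: sum_distrib_left)

lemma bern_mean_mult_right:
  fixes h :: "'e set \<Rightarrow> 'b::real_normed_algebra"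
  shows "bern_mean p I (\<lambda>S. h S * c) = bern_mean p I h * c"
  unfolding bern_mean_def by (simp add: sum_distrib_right)

lemma bern_mean_of_real:
  "bern_mean p I (\<lambda>S. of_real (h S) :: 'b::real_normed_algebra_1) = of_real (bern_mean p I h)"
  unfolding bern_mean_def by (simp add: scaleR_conv_of_real)

lemma bern_mean_empty: "bern_mean p {} h = h {}"
  by (simp add: bern_mean_def)

text \<open>Independence: on disjoint index sets cardinalities add, so the weight of
  \<open>S \<union> T\<close> is a product. Iterated means serve as conditioning throughout.\<close>

lemma bern_mean_Un:
  assumes "finite I" "finite J" "I \<inter> J = {}"
  shows "bern_mean p (I \<union> J) h = bern_mean p I (\<lambda>S. bern_mean p J (\<lambda>T. h (S \<union> T)))"
proof -
  have "bern_mean p I (\<lambda>S. bern_mean p J (\<lambda>T. h (S \<union> T))) =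
        (\<Sum>(S,T)\<in>Pow I \<times> Pow J. (p ^ card S * (1 - p) ^ card (I - S)) *\<^sub>R
           ((p ^ card T * (1 - p) ^ card (J - T)) *\<^sub>R h (S \<union> T)))"
    unfolding bern_mean_def by (simp add: scaleR_sum_right sum.cartesian_product)
  also have "\<dots> = bern_mean p (I \<union> J) h"
    unfolding bern_mean_def
  proof (rule sum.reindex_bij_witness[where i = "\<lambda>S. (S \<inter> I, S \<inter> J)" and j = "\<lambda>(S,T). S \<union> T"])
    fix x assume x: "x \<in> Pow I \<times> Pow J"
    obtain S T where ST: "x = (S, T)" by force
    have sub: "S \<subseteq> I" "T \<subseteq> J" using x ST by auto
    have fin: "finite S" "finite T" using sub assms by (auto intro: finite_subset)
    have c1: "card (S \<union> T) = card S + card T"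
      using sub fin assms by (intro card_Un_disjoint) auto
    have "I \<union> J - (S \<union> T) = (I - S) \<union> (J - T)" using sub assms(3) by auto
    then have c2: "card (I \<union> J - (S \<union> T)) = card (I - S) + card (J - T)"
      using sub assms by (simp, intro card_Un_disjoint) auto
    show "(p ^ card ((\<lambda>(S,T). S \<union> T) x) * (1 - p) ^ card (I \<union> J - (\<lambda>(S,T). S \<union> T) x)) *\<^sub>R
            h ((\<lambda>(S,T). S \<union> T) x) =
          (case x of (S,T) \<Rightarrow> (p ^ card S * (1 - p) ^ card (I - S)) *\<^sub>R
           ((p ^ card T * (1 - p) ^ card (J - T)) *\<^sub>R h (S \<union> T)))"
      by (simp add: ST c1 c2 power_add mult_ac)
  qed (use assms(3) in auto)
  finally show ?thesis by simp
qed

lemma bern_mean_singleton: "bern_mean p {x} h = (1 - p) *\<^sub>R h {} + p *\<^sub>R h {x}"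
  by (simp add: bern_mean_def Pow_insert)

lemma bern_mean_insert:
  assumes "finite I" "x \<notin> I"
  shows "bern_mean p (insert x I) h = (1 - p) *\<^sub>R bern_mean p I h + p *\<^sub>R bern_mean p I (\<lambda>S. h (insert x S))"
  using bern_mean_Un[of "{x}" I p h] assms by (simp add: bern_mean_singleton)

lemma bern_mean_const: "finite I \<Longrightarrow> bern_mean p I (\<lambda>_. c) = c"
  by (induction I rule: finite_induct) (simp_all add: bern_mean_empty bern_mean_insert flip: scaleR_add_left)

text \<open>Binomial generating function; at exponentials it is the moment generating function
  behind both the smoothing loss and the constant \<open>L\<close>.\<close>

lemma bern_mean_power_card:
  fixes z :: real
  shows "finite I \<Longrightarrow> bern_mean p I (\<lambda>S. z ^ card S) = (1 - p + p * z) ^ card I"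
proof (induction I rule: finite_induct)
  case empty
  show ?case by (simp add: bern_mean_empty)
next
  case (insert x I)
  have "bern_mean p I (\<lambda>S. z ^ card (insert x S)) = bern_mean p I (\<lambda>S. z * z ^ card S)"
    by (rule bern_mean_cong) (use insert in \<open>metis card_insert_disjoint finite_subset power_Suc subsetD\<close>)
  then show ?case
    using insert by (simp add: bern_mean_insert bern_mean_mult_left algebra_simps)
qed

lemma bern_mean_mono:
  assumes "0 \<le> p" "p \<le> 1" "\<And>S. S \<subseteq> I \<Longrightarrow> h S \<le> (h' S :: real)"
  shows "bern_mean p I h \<le> bern_mean p I h'"
  unfolding bern_mean_def using assms by (intro sum_mono scaleR_left_mono) auto

lemma bern_mean_nonneg:
  assumes "0 \<le> p" "p \<le> 1" "\<And>S. S \<subseteq> I \<Longrightarrow> 0 \<le> (h S :: real)"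
  shows "0 \<le> bern_mean p I h"
  unfolding bern_mean_def using assms by (intro sum_nonneg) auto

lemma norm_bern_mean_le:
  assumes "0 \<le> p" "p \<le> 1" "\<And>S. S \<subseteq> I \<Longrightarrow> norm (h S) \<le> h' S"
  shows "norm (bern_mean p I h) \<le> bern_mean p I h'"
  unfolding bern_mean_def using assms
  by (intro order_trans[OF norm_sum] sum_mono) (auto intro!: mult_left_mono)

text \<open>The weight of a set depends on its cardinality only, so a cardinality-preserving
  involution preserves the law.\<close>

lemma bern_mean_reindex_invariant:
  assumes "finite I" "\<And>S. S \<subseteq> I \<Longrightarrow> \<tau> S \<subseteq> I" "\<And>S. S \<subseteq> I \<Longrightarrow> \<tau> (\<tau> S) = S"
    "\<And>S. S \<subseteq> I \<Longrightarrow> card (\<tau> S) = card S"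
  shows "bern_mean p I (\<lambda>S. h (\<tau> S)) = bern_mean p I h"
  unfolding bern_mean_def
proof (rule sum.reindex_bij_witness[where i = \<tau> and j = \<tau>])
  fix S assume "S \<in> Pow I"
  then have S: "S \<subseteq> I" by simp
  then have "card (I - \<tau> S) = card (I - S)"
    using assms finite_subset[OF S] finite_subset[OF assms(2)[OF S]] by (simp add: card_Diff_subset)
  then show "(p ^ card (\<tau> S) * (1 - p) ^ card (I - \<tau> S)) *\<^sub>R h (\<tau> S) =
             (p ^ card S * (1 - p) ^ card (I - S)) *\<^sub>R h (\<tau> S)"
    using assms S by simp
qed (use assms in auto)

lemma bern_mean_image:
  assumes "inj_on f I"
  shows "bern_mean p (f ` I) h = bern_mean p I (\<lambda>S. h (f ` S))"
proof -
  have "bij_betw ((`) f) (Pow I) (Pow (f ` I))"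
    using assms by (simp add: bij_betw_Pow inj_on_imp_bij_betw)
  then have "bern_mean p (f ` I) h =
      (\<Sum>S\<in>Pow I. (p ^ card (f ` S) * (1 - p) ^ card (f ` I - f ` S)) *\<^sub>R h (f ` S))"
    unfolding bern_mean_def by (rule sum.reindex_bij_betw[symmetric])
  also have "\<dots> = bern_mean p I (\<lambda>S. h (f ` S))"
    unfolding bern_mean_def
  proof (intro sum.cong refl)
    fix S assume "S \<in> Pow I"
    then have S: "S \<subseteq> I" by simp
    have "f ` I - f ` S = f ` (I - S)"
      using inj_on_image_set_diff[OF assms, of I S] S by auto
    then show "(p ^ card (f ` S) * (1 - p) ^ card (f ` I - f ` S)) *\<^sub>R h (f ` S) =
        (p ^ card S * (1 - p) ^ card (I - S)) *\<^sub>R h (f ` S)"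
      using S assms by (simp add: card_image inj_on_subset inj_on_diff)
  qed
  finally show ?thesis .
qed

lemma bern_mean_restrict:
  assumes "finite I" "J \<subseteq> I"
  shows "bern_mean p I (\<lambda>S. h (S \<inter> J)) = bern_mean p J h"
proof -
  have "bern_mean p (J \<union> (I - J)) (\<lambda>S. h (S \<inter> J)) = bern_mean p J (\<lambda>S. bern_mean p (I - J) (\<lambda>T. h ((S \<union> T) \<inter> J)))"
    using assms finite_subset by (intro bern_mean_Un) auto
  also have "\<dots> = bern_mean p J (\<lambda>S. bern_mean p (I - J) (\<lambda>T. h S))"
    by (intro bern_mean_cong arg_cong[of _ _ h]) auto
  also have "\<dots> = bern_mean p J h"
    using assms by (simp add: bern_mean_const)
  finally show ?thesis using assms by (simp add: Un_absorb1)
qed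

text \<open>Independence of functions of disjoint blocks, by splitting off one block at a
  time.\<close>

lemma bern_mean_prod_disjoint:
  fixes f :: "'i \<Rightarrow> 'e set \<Rightarrow> real"
  assumes "finite J" "\<And>i. i \<in> J \<Longrightarrow> finite (P i)" "disjoint_family_on P J"
  shows "bern_mean p (\<Union>i\<in>J. P i) (\<lambda>S. \<Prod>i\<in>J. f i (S \<inter> P i)) = (\<Prod>i\<in>J. bern_mean p (P i) (f i))"
  using assms
proof (induction J rule: finite_induct)
  case empty
  show ?case by (simp add: bern_mean_empty)
next
  case (insert j J)
  let ?U = "\<Union>i\<in>J. P i"
  have disj: "P j \<inter> ?U = {}"
    using insert.prems(2) insert.hyps unfolding disjoint_family_on_def by fastforce
  have "bern_mean p (P j \<union> ?U) (\<lambda>S. \<Prod>i\<in>insert j J. f i (S \<inter> P i)) =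
      bern_mean p (P j) (\<lambda>S. bern_mean p ?U (\<lambda>T. \<Prod>i\<in>insert j J. f i ((S \<union> T) \<inter> P i)))"
    using insert disj by (intro bern_mean_Un) auto
  also have "\<dots> = bern_mean p (P j) (\<lambda>S. bern_mean p ?U (\<lambda>T. f j S * (\<Prod>i\<in>J. f i (T \<inter> P i))))"
  proof (intro bern_mean_cong)
    fix S T assume S: "S \<subseteq> P j" and T: "T \<subseteq> ?U"
    have "(S \<union> T) \<inter> P j = S" using S T disj by auto
    moreover have "(S \<union> T) \<inter> P i = T \<inter> P i" if "i \<in> J" for i
      using S disj that by blast
    ultimately show "(\<Prod>i\<in>insert j J. f i ((S \<union> T) \<inter> P i)) = f j S * (\<Prod>i\<in>J. f i (T \<inter> P i))"
      using insert.hyps by simp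
  qed
  also have "\<dots> = bern_mean p (P j) (f j) * bern_mean p ?U (\<lambda>T. \<Prod>i\<in>J. f i (T \<inter> P i))"
    by (simp add: bern_mean_mult_left bern_mean_mult_right)
  also have "\<dots> = (\<Prod>i\<in>insert j J. bern_mean p (P i) (f i))"
    using insert by (simp add: disjoint_family_on_def)
  finally show ?case by simp
qed

text \<open>If every \<open>\<tau> i\<close> preserves the law and the other factors, the oscillating factor
  \<open>cis (t * W S)\<close> may be averaged over the two points \<open>S\<close> and \<open>\<tau> i S\<close>.\<close>
lemma bern_mean_involution_average:
  fixes W :: "'e set \<Rightarrow> real" and g :: "'e set \<Rightarrow> complex"
  assumes "finite J" "finite I"
    and \<tau>: "\<And>i S. i \<in> J \<Longrightarrow> S \<subseteq> I \<Longrightarrow> \<tau> i S \<subseteq> I"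
      "\<And>i S. i \<in> J \<Longrightarrow> S \<subseteq> I \<Longrightarrow> \<tau> i (\<tau> i S) = S"
      "\<And>i S. i \<in> J \<Longrightarrow> S \<subseteq> I \<Longrightarrow> card (\<tau> i S) = card S"
    and g: "\<And>i S. i \<in> J \<Longrightarrow> S \<subseteq> I \<Longrightarrow> g (\<tau> i S) = g S"
    and W: "\<And>i S. i \<in> J \<Longrightarrow> S \<subseteq> I \<Longrightarrow> W (\<tau> i S) = W S + D i S"
    and D: "\<And>i j S. i \<in> J \<Longrightarrow> j \<in> J \<Longrightarrow> i \<noteq> j \<Longrightarrow> S \<subseteq> I \<Longrightarrow> D j (\<tau> i S) = D j S"
  shows "bern_mean p I (\<lambda>S. g S * cis (t * W S)) =
    bern_mean p I (\<lambda>S. g S * cis (t * W S) * (\<Prod>i\<in>J. (1 + cis (t * D i S)) / 2))"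
proof -
  have "K \<subseteq> J \<Longrightarrow> bern_mean p I (\<lambda>S. g S * cis (t * W S)) =
    bern_mean p I (\<lambda>S. g S * cis (t * W S) * (\<Prod>i\<in>K. (1 + cis (t * D i S)) / 2))" if "finite K" for K
    using that
  proof (induction K rule: finite_induct)
    case empty
    show ?case by simp
  next
    case (insert i K)
    let ?h = "\<lambda>S. g S * cis (t * W S) * (\<Prod>i\<in>K. (1 + cis (t * D i S)) / 2)"
    have i: "i \<in> J" and K: "K \<subseteq> J" using insert by auto
    have "bern_mean p I (\<lambda>S. ?h (\<tau> i S)) = bern_mean p I ?h"
      using \<tau> i assms(2) by (intro bern_mean_reindex_invariant) auto
    moreover have "bern_mean p I (\<lambda>S. ?h (\<tau> i S)) = bern_mean p I (\<lambda>S. ?h S * cis (t * D i S))"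
    proof (intro bern_mean_cong)
      fix S assume S: "S \<subseteq> I"
      have "(\<Prod>j\<in>K. (1 + cis (t * D j (\<tau> i S))) / 2) = (\<Prod>j\<in>K. (1 + cis (t * D j S)) / 2)"
        using D[OF i _ _ S] K insert.hyps by (intro prod.cong refl) (metis subsetD)
      then show "?h (\<tau> i S) = ?h S * cis (t * D i S)"
        using g[OF i S] W[OF i S] by (simp add: cis_mult[symmetric] distrib_left mult_ac)
    qed
    ultimately have "bern_mean p I ?h = (1/2) * (bern_mean p I ?h + bern_mean p I (\<lambda>S. ?h S * cis (t * D i S)))"
      by simp
    also have "\<dots> = bern_mean p I (\<lambda>S. (1/2) * (?h S + ?h S * cis (t * D i S)))"
      by (simp only: bern_mean_mult_left bern_mean_add)
    also have "\<dots> = bern_mean p I (\<lambda>S. g S * cis (t * W S) * (\<Prod>i\<in>insert i K. (1 + cis (t * D i S)) / 2))"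
      using insert.hyps by (intro bern_mean_cong) (simp add: field_simps)
    finally show ?case using insert.IH K by simp
  qed
  then show ?thesis using assms(1) by blast
qed

section \<open>Graphs and the degree-preserving swap\<close>

definition clique :: "nat set \<Rightarrow> nat set set" where
  "clique A = {e. e \<subseteq> A \<and> card e = 2}"

definition nbhd :: "nat set set \<Rightarrow> nat \<Rightarrow> nat set" where
  "nbhd S u = {w. {u, w} \<in> S}"

definition vdeg :: "nat set set \<Rightarrow> nat \<Rightarrow> nat" where
  "vdeg S u = card (nbhd S u)"

text \<open>The count of the theorem for a graph on \<open>A\<close>. The vertex set is a parameter
  because vertices are removed later.\<close>

definition off_count :: "nat \<Rightarrow> nat set \<Rightarrow> nat set set \<Rightarrow> real" where
  "off_count d A S = (\<Sum>j\<in>A. of_bool (vdeg S j \<noteq> d))"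

lemma finite_clique: "finite A \<Longrightarrow> finite (clique A)"
  unfolding clique_def by (rule finite_subset[of _ "Pow A"]) auto

lemma doubleton_in_clique: "{u, w} \<in> clique A \<longleftrightarrow> u \<noteq> w \<and> u \<in> A \<and> w \<in> A"
  by (auto simp: clique_def card_insert_if)

lemma cliqueE:
  assumes "e \<in> clique A"
  obtains u w where "e = {u, w}" "u \<noteq> w" "u \<in> A" "w \<in> A"
  using assms by (auto simp: clique_def card_2_iff)

lemma nbhd_subset: "S \<subseteq> clique A \<Longrightarrow> nbhd S u \<subseteq> A - {u}"
  unfolding nbhd_def using doubleton_in_clique by blast

lemma finite_nbhd: "finite A \<Longrightarrow> S \<subseteq> clique A \<Longrightarrow> finite (nbhd S u)"
  using nbhd_subset[of S A u] finite_subset by blast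

text \<open>At most one vertex of \<open>V\<close>, adjacent to exactly one of the two vertices with neighbourhoods \<open>N\<close>
  and \<open>M\<close>. Choosing it through the symmetric difference, which the swap preserves, makes \<open>swap\<close> an
  involution.\<close>
definition swap_set :: "nat set \<Rightarrow> nat set \<Rightarrow> nat set \<Rightarrow> nat set" where
  "swap_set V N M = (if sym_diff N M \<inter> V = {} then {} else {Min (sym_diff N M \<inter> V)})"

definition swap :: "nat set \<Rightarrow> nat \<Rightarrow> nat \<Rightarrow> nat set set \<Rightarrow> nat set set" where
  "swap V u v S = sym_diff S (\<Union>w\<in>swap_set V (nbhd S u) (nbhd S v). {{u, w}, {v, w}})"

lemma swap_set_cases:
  assumes "finite V"
  obtains "swap_set V N M = {}" "N \<inter> V = M \<inter> V" |
     w where "swap_set V N M = {w}" "w \<in> V" "w \<in> N \<longleftrightarrow> w \<notin> M"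
proof (cases "sym_diff N M \<inter> V = {}")
  case True
  then show ?thesis using that(1) by (auto simp: swap_set_def)
next
  case False
  then have "Min (sym_diff N M \<inter> V) \<in> sym_diff N M \<inter> V"
    using assms by (intro Min_in) auto
  then show ?thesis using that(2) False by (auto simp: swap_set_def)
qed

lemma swap_set_swap:
  assumes "finite V"
  shows "swap_set V (sym_diff N (swap_set V N M)) (sym_diff M (swap_set V N M)) = swap_set V N M"
proof -
  have "sym_diff (sym_diff N X) (sym_diff M X) = sym_diff N M" for X by auto
  then show ?thesis by (simp add: swap_set_def)
qed

context
  fixes A V :: "nat set" and u v :: nat
  assumes fin: "finite A" and V: "V \<subseteq> A" and uv: "u \<in> A" "v \<in> A" "u \<noteq> v" "u \<notin> V" "v \<notin> V"
begin

lemma finV: "finite V"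
  using V fin finite_subset by blast

lemma nbhd_swap:
  assumes "S \<subseteq> clique A"
  shows "nbhd (swap V u v S) u = sym_diff (nbhd S u) (swap_set V (nbhd S u) (nbhd S v))"
    and "nbhd (swap V u v S) v = sym_diff (nbhd S v) (swap_set V (nbhd S u) (nbhd S v))"
    and "x \<notin> {u, v} \<union> V \<Longrightarrow> nbhd (swap V u v S) x = nbhd S x"
  by (rule swap_set_cases[OF finV, of "nbhd S u" "nbhd S v"];
      use uv in \<open>auto simp: swap_def nbhd_def doubleton_eq_iff\<close>)+

text \<open>The vertex \<open>w\<close> whose edge is moved loses one of \<open>u\<close>,
  \<open>v\<close> as a neighbour and gains the other, so even its degree stays.\<close>

lemma vdeg_swap:
  assumes S: "S \<subseteq> clique A" and x: "x \<noteq> u" "x \<noteq> v"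
  shows "vdeg (swap V u v S) x = vdeg S x"
proof (rule swap_set_cases[OF finV, of "nbhd S u" "nbhd S v"])
  assume "swap_set V (nbhd S u) (nbhd S v) = {}"
  then show ?thesis by (simp add: swap_def)
next
  fix w assume w: "swap_set V (nbhd S u) (nbhd S v) = {w}" "w \<in> V" "w \<in> nbhd S u \<longleftrightarrow> w \<notin> nbhd S v"
  have sw: "swap V u v S = sym_diff S {{u, w}, {v, w}}" by (simp add: swap_def w(1))
  show ?thesis
  proof (cases "x = w")
    case False
    then have "nbhd (swap V u v S) x = nbhd S x"
      using x by (auto simp: sw nbhd_def doubleton_eq_iff)
    then show ?thesis by (simp add: vdeg_def)
  next
    case True
    have nbhd: "nbhd (swap V u v S) x = sym_diff (nbhd S x) {u, v}"
      using x True by (auto simp: sw nbhd_def doubleton_eq_iff)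
    have "u \<in> nbhd S x \<longleftrightarrow> v \<notin> nbhd S x"
      using w(3) True by (auto simp: nbhd_def insert_commute)
    then consider "u \<in> nbhd S x" "v \<notin> nbhd S x" | "u \<notin> nbhd S x" "v \<in> nbhd S x" by auto
    then have "card (sym_diff (nbhd S x) {u, v}) = card (nbhd S x)"
    proof cases
      case 1
      then have "sym_diff (nbhd S x) {u, v} = insert v (nbhd S x - {u})" by auto
      then show ?thesis using 1 finite_nbhd[OF fin S, of x]
        by (metis DiffD1 card_Suc_Diff1 card_insert_disjoint finite_Diff)
    next
      case 2
      then have "sym_diff (nbhd S x) {u, v} = insert u (nbhd S x - {v})" by auto
      then show ?thesis using 2 finite_nbhd[OF fin S, of x]
        by (metis DiffD1 card_Suc_Diff1 card_insert_disjoint finite_Diff)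
    qed
    then show ?thesis by (simp add: vdeg_def nbhd)
  qed
qed

lemma swap_subset: "S \<subseteq> clique A \<Longrightarrow> swap V u v S \<subseteq> clique A"
  by (rule swap_set_cases[OF finV, of "nbhd S u" "nbhd S v"];
      use uv V in \<open>auto simp: swap_def doubleton_in_clique\<close>)

lemma swap_swap:
  assumes "S \<subseteq> clique A"
  shows "swap V u v (swap V u v S) = S"
proof -
  have "swap_set V (nbhd (swap V u v S) u) (nbhd (swap V u v S) v) = swap_set V (nbhd S u) (nbhd S v)"
    using nbhd_swap[OF assms] swap_set_swap[OF finV] by simp
  then show ?thesis unfolding swap_def by auto
qed

text \<open>A nontrivial swap trades exactly one edge for another; hence the law of the random graph
  is invariant.\<close>

lemma card_swap:
  assumes "S \<subseteq> clique A"
  shows "card (swap V u v S) = card S"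
proof (rule swap_set_cases[OF finV, of "nbhd S u" "nbhd S v"])
  assume "swap_set V (nbhd S u) (nbhd S v) = {}"
  then show ?thesis by (simp add: swap_def)
next
  fix w assume w: "swap_set V (nbhd S u) (nbhd S v) = {w}" "w \<in> V" "w \<in> nbhd S u \<longleftrightarrow> w \<notin> nbhd S v"
  have fS: "finite S" using assms finite_clique[OF fin] finite_subset by blast
  have sw: "swap V u v S = sym_diff S {{u, w}, {v, w}}" by (simp add: swap_def w(1))
  have ne: "{u, w} \<noteq> {v, w}" using uv by (auto simp: doubleton_eq_iff)
  consider "{u, w} \<in> S" "{v, w} \<notin> S" | "{u, w} \<notin> S" "{v, w} \<in> S"
    using w(3) by (auto simp: nbhd_def)
  then show ?thesis
  proof cases
    case 1
    then have "swap V u v S = insert {v, w} (S - {{u, w}})" using sw by auto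
    then show ?thesis using 1 fS ne by (metis DiffD1 card_Suc_Diff1 card_insert_disjoint finite_Diff)
  next
    case 2
    then have "swap V u v S = insert {u, w} (S - {{v, w}})" using sw by auto
    then show ?thesis using 2 fS ne by (metis DiffD1 card_Suc_Diff1 card_insert_disjoint finite_Diff)
  qed
qed

text \<open>All moved edges join \<open>{u, v}\<close> to \<open>V\<close>. This makes an amplitude
  that depends on the edges at \<open>F\<close> invariant under the swap.\<close>

lemma swap_edges_away:
  assumes "S \<subseteq> clique A" "F \<inter> (V \<union> {u, v}) = {}"
  shows "{e \<in> swap V u v S. e \<inter> F \<noteq> {}} = {e \<in> S. e \<inter> F \<noteq> {}}"
  by (rule swap_set_cases[OF finV, of "nbhd S u" "nbhd S v"];
      use assms in \<open>auto simp: swap_def\<close>)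

lemma off_count_swap:
  assumes S: "S \<subseteq> clique A"
  defines "X \<equiv> swap_set V (nbhd S u) (nbhd S v)"
  shows "off_count d A (swap V u v S) = off_count d A S +
     (of_bool (card (sym_diff (nbhd S u) X) \<noteq> d) + of_bool (card (sym_diff (nbhd S v) X) \<noteq> d)
      - of_bool (card (nbhd S u) \<noteq> d) - of_bool (card (nbhd S v) \<noteq> d))"
proof -
  have A: "A = insert u (insert v (A - {u, v}))" using uv by auto
  have *: "off_count d A T = of_bool (card (nbhd T u) \<noteq> d) + of_bool (card (nbhd T v) \<noteq> d)
       + (\<Sum>j\<in>A - {u, v}. of_bool (vdeg T j \<noteq> d))" for T
    unfolding off_count_def by (subst A) (use fin uv in \<open>simp add: vdeg_def\<close>)
  have "(\<Sum>j\<in>A - {u, v}. of_bool (vdeg (swap V u v S) j \<noteq> d)) =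
        (\<Sum>j\<in>A - {u, v}. of_bool (vdeg S j \<noteq> d) :: real)"
    by (intro sum.cong refl) (use vdeg_swap[OF S] in auto)
  then show ?thesis
    unfolding * using nbhd_swap[OF S] by (simp add: X_def)
qed

end

text \<open>The increment in \<open>off_count_swap\<close>, written through the two neighbourhoods
  alone. The swap of another pair leaves these neighbourhoods unchanged, as the averaging lemma
  demands.\<close>

definition swap_gain :: "nat \<Rightarrow> nat set \<Rightarrow> nat set \<Rightarrow> nat set \<Rightarrow> real" where
  "swap_gain d V N M = (let X = swap_set V N M in
     of_bool (card (sym_diff N X) \<noteq> d) + of_bool (card (sym_diff M X) \<noteq> d)
      - of_bool (card N \<noteq> d) - of_bool (card M \<noteq> d))"

text \<open>Two distinct neighbourhoods of size \<open>d + 1\<close> become neighbourhoods of sizes \<open>d\<close> and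
  \<open>d + 2\<close>, so exactly one of the two vertices acquires degree \<open>d\<close>.\<close>
lemma swap_gain_good:
  assumes "finite V" "N \<subseteq> V" "M \<subseteq> V" "card N = Suc d" "card M = Suc d" "N \<noteq> M"
  shows "swap_gain d V N M = - 1"
proof (rule swap_set_cases[OF assms(1), of N M])
  assume "N \<inter> V = M \<inter> V"
  then show ?thesis using assms by auto
next
  fix w assume w: "swap_set V N M = {w}" "w \<in> V" "w \<in> N \<longleftrightarrow> w \<notin> M"
  have fin: "finite N" "finite M" using assms finite_subset by blast+
  have *: "card (sym_diff N {w}) = (if w \<in> N then d else d + 2)"
    if "finite N" "card N = Suc d" for N
  proof (cases "w \<in> N")
    case True
    then have "sym_diff N {w} = N - {w}" by auto
    then show ?thesis using True that by simp
  next
    case False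
    then have "sym_diff N {w} = insert w N" by auto
    then show ?thesis using False that by simp
  qed
  show ?thesis
    using *[OF fin(1) assms(4)] *[OF fin(2) assms(5)] w assms(4,5) unfolding swap_gain_def Let_def w(1)
    by auto
qed

section \<open>Smoothing\<close>

lemma norm_average_cis: "norm ((1 + cis x) / 2) = \<bar>cos (x / 2)\<bar>"
proof -
  have "(1 + cis x) / 2 = cis (x / 2) * complex_of_real (cos (x / 2))"
    using cos_double_cos[of "x / 2"] sin_double[of "x / 2"]
    by (simp add: complex_eq_iff power2_eq_square)
  then show ?thesis by (simp add: norm_mult)
qed

definition depends_on :: "nat set \<Rightarrow> nat set \<Rightarrow> (nat set set \<Rightarrow> 'b) \<Rightarrow> bool" where
  "depends_on A F g \<longleftrightarrow> (\<forall>S T. S \<subseteq> clique A \<and> T \<subseteq> clique A \<and>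
      {e \<in> S. e \<inter> F \<noteq> {}} = {e \<in> T. e \<inter> F \<noteq> {}} \<longrightarrow> g S = g T)"

definition star_pair :: "nat set \<Rightarrow> nat \<Rightarrow> nat \<Rightarrow> nat set set" where
  "star_pair V u v = (\<lambda>w. {u, w}) ` V \<union> (\<lambda>w. {v, w}) ` V"

text \<open>The event on which a swap surely changes the count. It is tested on subsets of
  \<open>star_pair V u v\<close>, where both neighbourhoods lie in \<open>V\<close>.\<close>

definition good_pair :: "nat \<Rightarrow> nat \<Rightarrow> nat \<Rightarrow> nat set set \<Rightarrow> bool" where
  "good_pair d u v T \<longleftrightarrow> card (nbhd T u) = Suc d \<and> card (nbhd T v) = Suc d \<and> nbhd T u \<noteq> nbhd T v"

text \<open>An edge has two ends and all the vertices \<open>u i\<close>, \<open>v i\<close> are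
  distinct, so an edge touches at most two pairs.\<close>

lemma card_touched_le:
  fixes u v :: "'i \<Rightarrow> nat"
  assumes "finite J" "finite S" "\<And>e. e \<in> S \<Longrightarrow> finite e \<and> card e = 2"
    and inj: "inj_on u J" "inj_on v J" "u ` J \<inter> v ` J = {}"
  shows "card {i\<in>J. \<exists>e\<in>S. u i \<in> e \<or> v i \<in> e} \<le> 2 * card S"
proof -
  have one: "card {i\<in>J. u i \<in> e \<or> v i \<in> e} \<le> 2" if e: "e \<in> S" for e
  proof -
    let ?I = "{i\<in>J. u i \<in> e \<or> v i \<in> e}"
    let ?f = "\<lambda>i. if u i \<in> e then u i else v i"
    have "inj_on ?f ?I"
      using inj by (intro inj_onI) (auto split: if_splits dest: inj_onD)
    moreover have "?f ` ?I \<subseteq> e" by auto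
    ultimately have "card ?I \<le> card e"
      using assms(3)[OF e] card_inj_on_le by blast
    then show ?thesis using assms(3)[OF e] by simp
  qed
  have "{i\<in>J. \<exists>e\<in>S. u i \<in> e \<or> v i \<in> e} = (\<Union>e\<in>S. {i\<in>J. u i \<in> e \<or> v i \<in> e})" by auto
  then have "card {i\<in>J. \<exists>e\<in>S. u i \<in> e \<or> v i \<in> e} \<le> (\<Sum>e\<in>S. card {i\<in>J. u i \<in> e \<or> v i \<in> e})"
    using card_UN_le[OF assms(2)] by simp
  also have "\<dots> \<le> (\<Sum>e\<in>S. 2)" using one by (intro sum_mono)
  finally show ?thesis by simp
qed

text \<open>Conditioning on the edges that join chosen vertices to each other or to \<open>F\<close>
  leaves disjoint stars, so the factors of the pairs become independent. A pair without such an edge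
  contributes at most \<open>exp (- \<theta>)\<close>, any other pair at most 1. At most twice as
  many pairs are spoiled as there are such edges; the generating function of their number at
  \<open>exp (2 * \<theta>)\<close> gives the last factor.\<close>

lemma norm_bern_mean_cis_le:
  fixes u v :: "'i \<Rightarrow> nat" and g :: "nat set set \<Rightarrow> complex" and t :: real
  assumes p: "0 \<le> p" "p \<le> 1" and A: "finite A" and J: "finite J"
    and inj: "inj_on u J" "inj_on v J" "u ` J \<inter> v ` J = {}"
    and sub: "F \<subseteq> A" "u ` J \<subseteq> A - F" "v ` J \<subseteq> A - F"
    and g: "depends_on A F g" "\<And>S. S \<subseteq> clique A \<Longrightarrow> norm (g S) \<le> B"
    and q: "0 \<le> q" "\<And>i. i \<in> J \<Longrightarrow> q \<le>
      bern_mean p (star_pair (A - F - u ` J - v ` J) (u i) (v i)) (\<lambda>T. of_bool (good_pair d (u i) (v i) T))"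
  defines "\<theta> \<equiv> (1 - \<bar>cos (t / 2)\<bar>) * q"
  shows "norm (bern_mean p (clique A) (\<lambda>S. g S * cis (t * off_count d A S))) \<le>
    B * (exp (- (\<theta> * card J)) * (1 - p + p * exp (2 * \<theta>)) ^ (card (u ` J \<union> v ` J) * card (F \<union> u ` J \<union> v ` J)))"
proof -
  define U where "U = u ` J \<union> v ` J"
  define V where "V = A - F - u ` J - v ` J"
  define \<tau> where "\<tau> i = swap V (u i) (v i)" for i
  define D where "D i S = swap_gain d V (nbhd S (u i)) (nbhd S (v i))" for i S
  define P where "P i = star_pair V (u i) (v i)" for i
  \<comment> \<open>Every edge at a chosen vertex either lies in one of the stars \<open>P i\<close>
    or avoids \<open>V\<close>; the latter ones form \<open>E1\<close>.\<close>
  define E1 where "E1 = {e \<in> clique A. e \<inter> U \<noteq> {} \<and> e \<inter> V = {}}"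
  define \<kappa> where "\<kappa> = \<bar>cos (t / 2)\<bar>"
  define unt where "unt S i \<longleftrightarrow> (\<forall>e\<in>S. u i \<notin> e \<and> v i \<notin> e)" for S i
  \<comment> \<open>Equal to \<open>\<kappa>\<close> on the good event and to 1 elsewhere, in a form
    affine in the indicator, so that its mean is immediate.\<close>
  define f where "f S i = (\<lambda>T. 1 - (1 - \<kappa>) * of_bool (unt S i \<and> good_pair d (u i) (v i) T))" for S i
  have \<kappa>: "0 \<le> \<kappa>" "\<kappa> \<le> 1" by (auto simp: \<kappa>_def)
  have V: "V \<subseteq> A" "finite V" using A by (auto simp: V_def)
  have B: "0 \<le> B" using g(2)[of "{}"] norm_ge_zero order_trans by blast
  have uv: "u i \<in> A" "v i \<in> A" "u i \<noteq> v i" "u i \<notin> V" "v i \<notin> V" "u i \<notin> F" "v i \<notin> F" if "i \<in> J" for i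
    using that sub inj by (auto simp: V_def)
  have uv': "u i \<noteq> u j" "u i \<noteq> v j" "v i \<noteq> v j" "v i \<noteq> u j" if "i \<in> J" "j \<in> J" "i \<noteq> j" for i j
    using that inj by (auto dest: inj_onD)
  note sw = A V(1) uv(1,2,3,4,5)
  have avg: "bern_mean p (clique A) (\<lambda>S. g S * cis (t * off_count d A S)) =
    bern_mean p (clique A) (\<lambda>S. g S * cis (t * off_count d A S) * (\<Prod>i\<in>J. (1 + cis (t * D i S)) / 2))"
  proof (rule bern_mean_involution_average[where \<tau> = \<tau>])
    show "g (\<tau> i S) = g S" if i: "i \<in> J" and S: "S \<subseteq> clique A" for i S
    proof -
      have "{e \<in> \<tau> i S. e \<inter> F \<noteq> {}} = {e \<in> S. e \<inter> F \<noteq> {}}"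
        unfolding \<tau>_def using swap_edges_away[OF sw S, OF i i i i i, of F] uv[OF i] i
        by (auto simp: V_def)
      then show ?thesis
        using g(1) S swap_subset[OF sw S, OF i i i i i] unfolding depends_on_def \<tau>_def by blast
    qed
    show "D j (\<tau> i S) = D j S" if "i \<in> J" "j \<in> J" "i \<noteq> j" "S \<subseteq> clique A" for i j S
      using nbhd_swap(3)[OF sw that(4), OF that(1) that(1) that(1) that(1) that(1)] uv[OF that(2)] uv'[OF that(1-3)] that
      by (simp add: D_def \<tau>_def)
  qed (use J finite_clique[OF A] swap_subset[OF sw] swap_swap[OF sw] card_swap[OF sw] off_count_swap[OF sw]
       in \<open>auto simp: \<tau>_def D_def swap_gain_def Let_def\<close>)
  \<comment> \<open>If no edge of \<open>E1\<close> touches pair \<open>i\<close>, the full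
    neighbourhoods of \<open>u i\<close> and \<open>v i\<close> are those seen inside the star
    \<open>P i\<close>, and the swap gain is \<open>- 1\<close>.\<close>
  have fac: "norm ((1 + cis (t * D i S)) / 2) \<le> f (S \<inter> E1) i (S \<inter> P i)"
    if i: "i \<in> J" and S: "S \<subseteq> clique A" for i S
  proof (cases "unt (S \<inter> E1) i \<and> good_pair d (u i) (v i) (S \<inter> P i)")
    case True
    have key: "nbhd S x = nbhd (S \<inter> P i) x \<and> nbhd S x \<subseteq> V" if x: "x = u i \<or> x = v i" for x
    proof -
      have "w \<in> V" if w: "{x, w} \<in> S" for w
      proof (rule ccontr)
        assume "w \<notin> V"
        then have "{x, w} \<in> S \<inter> E1" using w x uv[OF i] i S by (auto simp: E1_def U_def)
        then show False using True x unfolding unt_def by blast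
      qed
      then show ?thesis using x by (auto simp: nbhd_def P_def star_pair_def)
    qed
    have "D i S = - 1"
      unfolding D_def using True key by (intro swap_gain_good[OF V(2)]) (auto simp: good_pair_def)
    then have "norm ((1 + cis (t * D i S)) / 2) = \<kappa>"
      unfolding norm_average_cis by (simp add: \<kappa>_def)
    then show ?thesis using True by (simp add: f_def)
  next
    case False
    then have "f (S \<inter> E1) i (S \<inter> P i) = 1" by (auto simp: f_def)
    then show ?thesis unfolding norm_average_cis by simp
  qed
  have f0: "0 \<le> f S i T" for S i T using \<kappa> by (auto simp: f_def)
  have finP: "finite (P i)" for i using V by (simp add: P_def star_pair_def)
  have disjP: "disjoint_family_on P J"
    unfolding disjoint_family_on_def
  proof (intro ballI impI)
    fix i j assume ij: "i \<in> J" "j \<in> J" "i \<noteq> j"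
    show "P i \<inter> P j = {}"
      using uv[OF ij(1)] uv[OF ij(2)] uv'[OF ij]
      by (auto simp: P_def star_pair_def doubleton_eq_iff)
  qed
  let ?E2 = "\<Union>i\<in>J. P i"
  have E2: "?E2 \<subseteq> clique A" "finite ?E2"
    using uv V finP J by (auto simp: P_def star_pair_def doubleton_in_clique)
  have E1: "E1 \<subseteq> clique A" "finite E1" using finite_clique[OF A] by (auto simp: E1_def)
  have disjE: "E1 \<inter> P i = {}" for i by (auto simp: E1_def P_def star_pair_def)
  have prodbound: "bern_mean p ?E2 (\<lambda>T. \<Prod>i\<in>J. f S i (T \<inter> P i)) \<le> exp (- (\<theta> * card J)) * exp (2 * \<theta>) ^ card S"
    if S: "S \<subseteq> E1" for S
  proof -
    have \<theta>: "0 \<le> \<theta>" using q(1) by (simp add: \<theta>_def)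
    have "bern_mean p ?E2 (\<lambda>T. \<Prod>i\<in>J. f S i (T \<inter> P i)) = (\<Prod>i\<in>J. bern_mean p (P i) (f S i))"
      using J finP disjP by (intro bern_mean_prod_disjoint) auto
    also have "\<dots> \<le> (\<Prod>i\<in>J. exp (- (\<theta> * of_bool (unt S i))))"
    proof (intro prod_mono conjI)
      fix i assume i: "i \<in> J"
      show "0 \<le> bern_mean p (P i) (f S i)" using f0 p by (intro bern_mean_nonneg) auto
      show "bern_mean p (P i) (f S i) \<le> exp (- (\<theta> * of_bool (unt S i)))"
      proof (cases "unt S i")
        case True
        have "bern_mean p (P i) (f S i) = 1 - (1 - \<kappa>) * bern_mean p (P i) (\<lambda>T. of_bool (good_pair d (u i) (v i) T))"
          using True finP by (simp add: f_def bern_mean_diff bern_mean_const bern_mean_mult_left)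
        also have "\<dots> \<le> 1 - (1 - \<kappa>) * q"
          using q(2)[OF i] \<kappa> by (simp add: P_def V_def mult_left_mono)
        also have "\<dots> \<le> exp (- \<theta>)"
          using exp_ge_add_one_self[of "- \<theta>"] by (simp add: \<theta>_def \<kappa>_def)
        finally show ?thesis using True by simp
      qed (simp add: f_def bern_mean_const[OF finP])
    qed
    also have "\<dots> = exp (- (\<theta> * card {i\<in>J. unt S i}))"
      using J by (simp add: exp_sum[symmetric] sum_negf sum_distrib_left[symmetric] of_bool_def
          sum.If_cases Collect_conj_eq Int_commute)
    \<comment> \<open>The lower bound for the number of untouched pairs may be negative; the
      exponential bound stays valid.\<close>
    also have "\<dots> \<le> exp (- (\<theta> * (real (card J) - 2 * real (card S))))"
    proof -
      have "card {i\<in>J. \<not> unt S i} \<le> 2 * card S"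
        using card_touched_le[OF J _ _ inj, of S] S E1 finite_subset[OF S E1(2)]
        by (fastforce simp: unt_def clique_def intro: card_ge_0_finite)
      moreover have "card J = card {i\<in>J. unt S i} + card {i\<in>J. \<not> unt S i}"
        using J by (subst card_Un_disjoint[symmetric]) (auto intro: arg_cong[of _ _ card])
      ultimately have "real (card J) - 2 * real (card S) \<le> card {i\<in>J. unt S i}" by linarith
      then show ?thesis using \<theta> by (simp add: mult_left_mono)
    qed
    also have "\<dots> = exp (- (\<theta> * card J)) * exp (2 * \<theta>) ^ card S"
      by (simp add: exp_of_nat_mult[symmetric] exp_add[symmetric] algebra_simps)
    finally show ?thesis .
  qed
  have cardE1: "card E1 \<le> card U * card (F \<union> U)"
  proof -
    have "E1 \<subseteq> (\<lambda>(x, y). {x, y}) ` (U \<times> (F \<union> U))"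
    proof
      fix e assume e: "e \<in> E1"
      then obtain x y where xy: "e = {x, y}" "x \<in> A" "y \<in> A" unfolding E1_def by (blast elim: cliqueE)
      have "x \<in> F \<union> U" "y \<in> F \<union> U" using e xy by (auto simp: E1_def V_def U_def)
      moreover have "x \<in> U \<or> y \<in> U" using e xy by (auto simp: E1_def)
      ultimately show "e \<in> (\<lambda>(x, y). {x, y}) ` (U \<times> (F \<union> U))"
        using xy(1) by (auto simp: image_iff insert_commute)
    qed
    moreover have "finite U" "finite F" using J A sub finite_subset by (auto simp: U_def)
    ultimately have "card E1 \<le> card (U \<times> (F \<union> U))"
      by (meson card_image_le card_mono finite_SigmaI finite_UnI finite_imageI le_trans)
    then show ?thesis by (simp add: card_cartesian_product)
  qed
  have "norm (bern_mean p (clique A) (\<lambda>S. g S * cis (t * off_count d A S))) \<le>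
      bern_mean p (clique A) (\<lambda>S. B * (\<Prod>i\<in>J. f (S \<inter> E1) i (S \<inter> P i)))"
    unfolding avg
  proof (rule norm_bern_mean_le[OF p])
    fix S assume S: "S \<subseteq> clique A"
    show "norm (g S * cis (t * off_count d A S) * (\<Prod>i\<in>J. (1 + cis (t * D i S)) / 2)) \<le>
       B * (\<Prod>i\<in>J. f (S \<inter> E1) i (S \<inter> P i))"
      unfolding norm_mult prod_norm[symmetric]
      using g(2)[OF S] fac[OF _ S] B by (simp only: norm_cis mult_1_right)
        (intro mult_mono prod_mono prod_nonneg; simp)
  qed
  \<comment> \<open>The dominating product sees only the edges in \<open>E1\<close> and in the
    stars, so the remaining edges integrate out.\<close>
  also have "\<dots> = B * bern_mean p (clique A) (\<lambda>S. (\<lambda>R. \<Prod>i\<in>J. f (R \<inter> E1) i (R \<inter> P i)) (S \<inter> (E1 \<union> ?E2)))"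
  proof -
    have "S \<inter> (E1 \<union> ?E2) \<inter> E1 = S \<inter> E1" for S by auto
    moreover have "S \<inter> (E1 \<union> ?E2) \<inter> P i = S \<inter> P i" if "i \<in> J" for S i using that by auto
    ultimately show ?thesis by (simp add: bern_mean_mult_left cong: prod.cong)
  qed
  also have "\<dots> = B * bern_mean p (E1 \<union> ?E2) (\<lambda>R. \<Prod>i\<in>J. f (R \<inter> E1) i (R \<inter> P i))"
    using E1 E2 finite_clique[OF A] by (subst bern_mean_restrict) auto
  also have "\<dots> = B * bern_mean p E1 (\<lambda>S. bern_mean p ?E2 (\<lambda>T. \<Prod>i\<in>J. f ((S \<union> T) \<inter> E1) i ((S \<union> T) \<inter> P i)))"
    using E1 E2 disjE by (subst bern_mean_Un) auto
  also have "\<dots> = B * bern_mean p E1 (\<lambda>S. bern_mean p ?E2 (\<lambda>T. \<Prod>i\<in>J. f S i (T \<inter> P i)))"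
  proof -
    have "(S \<union> T) \<inter> E1 = S" "(S \<union> T) \<inter> P i = T \<inter> P i" if "S \<subseteq> E1" "T \<subseteq> ?E2" for S T i
      using that disjE by blast+
    then show ?thesis by (intro arg_cong[of _ _ "(*) B"] bern_mean_cong) (simp cong: prod.cong)
  qed
  also have "\<dots> \<le> B * bern_mean p E1 (\<lambda>S. exp (- (\<theta> * card J)) * exp (2 * \<theta>) ^ card S)"
    using prodbound p B by (intro mult_left_mono bern_mean_mono) auto
  also have "\<dots> = B * (exp (- (\<theta> * card J)) * (1 - p + p * exp (2 * \<theta>)) ^ card E1)"
    using E1 by (simp add: bern_mean_mult_left bern_mean_power_card)
  also have "\<dots> \<le> B * (exp (- (\<theta> * card J)) * (1 - p + p * exp (2 * \<theta>)) ^ (card U * card (F \<union> U)))"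
  proof -
    have "0 \<le> \<theta>" using q(1) by (simp add: \<theta>_def)
    then have "p * 1 \<le> p * exp (2 * \<theta>)" using p by (intro mult_left_mono) auto
    then show ?thesis using B cardE1 by (intro mult_left_mono power_increasing) auto
  qed
  finally show ?thesis by (simp add: U_def Un_assoc)
qed

section \<open>The probability of a good pair\<close>

lemma one_minus_cos_ge:
  assumes "\<bar>y\<bar> \<le> pi / 2"
  shows "y\<^sup>2 / 3 \<le> 1 - cos y"
proof -
  obtain s where s: "cos y = (\<Sum>m<4. cos_coeff m * y ^ m) + cos (s + 1/2 * real 4 * pi) / fact 4 * y ^ 4"
    using Maclaurin_cos_expansion[of y 4] by auto
  \<comment> \<open>Fourth-order Taylor expansion. Since \<open>y ^ 4\<close> is at most
    \<open>4 * y^2\<close> for \<open>y\<close> of modulus at most 2, there remains the factor 1/2 -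
    1/6 = 1/3.\<close>
  have "cos y \<le> 1 - y\<^sup>2 / 2 + y ^ 4 / 24"
  proof -
    have "cos (s + 1/2 * real 4 * pi) * y ^ 4 \<le> 1 * y ^ 4" by (intro mult_right_mono) auto
    moreover have "{..<4} = {0, 1, 2, 3::nat}" by auto
    then have "(\<Sum>m<4. cos_coeff m * y ^ m) = 1 - y\<^sup>2 / 2"
      by (simp add: cos_coeff_def)
    moreover have "fact 4 = (24::real)" by (simp add: fact_numeral)
    ultimately show ?thesis unfolding s by simp
  qed
  moreover have "y ^ 4 \<le> 4 * y\<^sup>2"
  proof -
    have "\<bar>y\<bar> \<le> 2" using assms pi_less_4 by linarith
    then have "\<bar>y\<bar>\<^sup>2 \<le> 2\<^sup>2" by (intro power_mono) auto
    then have "y\<^sup>2 * y\<^sup>2 \<le> 4 * y\<^sup>2" by (intro mult_right_mono) auto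
    then show ?thesis by (simp flip: power_add)
  qed
  ultimately show ?thesis by simp
qed

text \<open>Sum over the \<open>C * (C - 1)\<close> ordered pairs of distinct neighbourhoods of size
  \<open>d + 1\<close>. Prescribing one star has probability
  \<open>p ^ (d + 1) * (1 - p) ^ (card V - d - 1)\<close>; the second exponent is enlarged to
  \<open>card V\<close>.\<close>

lemma bern_mean_good_pair_ge:
  fixes d :: nat
  assumes "finite V" "u \<noteq> v" "u \<notin> V" "v \<notin> V" "0 \<le> p" "p \<le> 1"
  defines "C \<equiv> real (card V choose Suc d)"
  shows "C * (C - 1) * (p ^ Suc d * (1 - p) ^ card V)\<^sup>2 \<le>
    bern_mean p (star_pair V u v) (\<lambda>T. of_bool (good_pair d u v T))"
proof -
  define NN where "NN = {N. N \<subseteq> V \<and> card N = Suc d}"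
  define b where "b S = p ^ card S * (1 - p) ^ card (V - S)" for S :: "nat set"
  define a where "a = p ^ Suc d * (1 - p) ^ card V"
  have NN: "finite NN" "NN \<subseteq> Pow V" "real (card NN) = C"
    using assms n_subsets[of V "Suc d"] by (auto simp: NN_def C_def)
  have a0: "0 \<le> a" and b0: "0 \<le> b S" for S using assms by (auto simp: a_def b_def)
  have ab: "a \<le> b S" if "S \<in> NN" for S
  proof -
    have "card (V - S) \<le> card V" using assms by (intro card_mono) auto
    then have "(1 - p) ^ card V \<le> (1 - p) ^ card (V - S)"
      using assms by (intro power_decreasing) auto
    then show ?thesis using that assms by (auto simp: a_def b_def NN_def intro!: mult_left_mono)
  qed
  have inj: "inj_on (\<lambda>w. {x, w}) V" for x :: nat by (auto simp: inj_on_def doubleton_eq_iff)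
  have disj: "(\<lambda>w. {u, w}) ` V \<inter> (\<lambda>w. {v, w}) ` V = {}"
    using assms by (auto simp: doubleton_eq_iff)
  have nbhd: "nbhd ((\<lambda>w. {u, w}) ` N \<union> (\<lambda>w. {v, w}) ` M) u = N"
           "nbhd ((\<lambda>w. {u, w}) ` N \<union> (\<lambda>w. {v, w}) ` M) v = M" if "N \<subseteq> V" "M \<subseteq> V" for N M
    using that assms by (auto simp: nbhd_def doubleton_eq_iff)
  have "C * (C - 1) * a\<^sup>2 = (\<Sum>N\<in>NN. \<Sum>M\<in>NN - {N}. a * a)"
  proof (cases "NN = {}")
    case False
    then have "1 \<le> card NN" using NN(1) by (simp add: card_gt_0_iff Suc_leI)
    then have "real (card NN - 1) = C - 1" using NN(3) by (simp add: of_nat_diff)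
    then show ?thesis using NN by (simp add: power2_eq_square)
  qed (use NN in auto)
  also have "\<dots> \<le> (\<Sum>N\<in>NN. \<Sum>M\<in>NN - {N}. b N * b M)"
    using ab a0 b0 by (intro sum_mono mult_mono) auto
  also have "\<dots> = (\<Sum>N\<in>NN. \<Sum>M\<in>NN - {N}. b N * (b M * of_bool (good_pair d u v ((\<lambda>w. {u, w}) ` N \<union> (\<lambda>w. {v, w}) ` M))))"
    by (intro sum.cong refl) (auto simp: good_pair_def nbhd NN_def)
  also have "\<dots> \<le> (\<Sum>N\<in>Pow V. \<Sum>M\<in>Pow V. b N * (b M * of_bool (good_pair d u v ((\<lambda>w. {u, w}) ` N \<union> (\<lambda>w. {v, w}) ` M))))"
    using NN assms(1) b0 by (intro sum_mono2 order_trans[OF sum_mono sum_mono2] sum_mono2) 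
      (auto intro!: sum_nonneg mult_nonneg_nonneg sum_mono2)
  also have "\<dots> = bern_mean p (star_pair V u v) (\<lambda>T. of_bool (good_pair d u v T))"
    unfolding star_pair_def using assms(1) disj
    by (simp add: bern_mean_Un bern_mean_image[OF inj]) (simp add: bern_mean_def b_def sum_distrib_left mult.assoc)
  finally show ?thesis by (simp add: a_def)
qed

lemma exp_le_one_minus_power:
  fixes p :: real
  assumes "0 \<le> p" "p \<le> 1 / 2"
  shows "exp (- (2 * p * real k)) \<le> (1 - p) ^ k"
proof -
  have "- 2 * p \<le> ln (1 - p)"
  proof -
    have "2 * p\<^sup>2 \<le> p" using assms mult_right_mono[of p "1/2" p] by (simp add: power2_eq_square)
    then show ?thesis using ln_one_minus_pos_lower_bound[OF assms] by simp
  qed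
  then have "exp (- 2 * p) \<le> 1 - p" using assms by (simp add: ln_ge_iff)
  then have "exp (- 2 * p) ^ k \<le> (1 - p) ^ k" by (intro power_mono) auto
  then show ?thesis by (simp add: exp_of_nat_mult[symmetric] mult_ac)
qed

text \<open>The degree of a vertex into \<open>V\<close> is binomial with mean between
  \<open>lam / 4\<close> and \<open>lam\<close>, so it equals \<open>d + 1\<close> with probability
  bounded below, and two independent neighbourhoods of this size differ at least half of the
  time.\<close>

lemma good_pair_prob_bounded_below:
  fixes lam :: real and d :: nat
  assumes "lam > 0"
  shows "\<exists>(q::real) N. 0 < q \<and> q \<le> 1 \<and> (\<forall>n\<ge>N. \<forall>V u v. finite V \<longrightarrow> card V \<le> n \<longrightarrow> n \<le> 4 * card V \<longrightarrow>
      u \<noteq> v \<longrightarrow> u \<notin> V \<longrightarrow> v \<notin> V \<longrightarrow>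
      q \<le> bern_mean (lam / real n) (star_pair V u v) (\<lambda>T. of_bool (good_pair d u v T)))"
proof -
  \<comment> \<open>A lower bound for \<open>C * p ^ Suc d * (1 - p) ^ card V\<close>: the binomial
    coefficient \<open>C\<close> is at least \<open>(card V / (d + 1)) ^ (d + 1)\<close>,
    \<open>p * card V\<close> is at least \<open>lam / 4\<close>, and the last power is at least
    \<open>exp (- 2 * lam)\<close>.\<close>
  define r where "r = (lam / (4 * real (Suc d))) ^ Suc d * exp (- (2 * lam))"
  \<comment> \<open>The first entry gives \<open>C \<ge> 2\<close>, hence
    \<open>C * (C - 1) \<ge> C^2 / 2\<close>; the second gives \<open>p \<le> 1 / 2\<close>.\<close>
  define N where "N = max (8 * Suc d) (nat \<lceil>2 * lam\<rceil>)"
  have r: "0 < r" using assms by (simp add: r_def)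
  have main: "min 1 (r\<^sup>2 / 2) \<le> bern_mean (lam / real n) (star_pair V u v) (\<lambda>T. of_bool (good_pair d u v T))"
    if n: "N \<le> n" and V: "finite V" "card V \<le> n" "n \<le> 4 * card V" and uv: "u \<noteq> v" "u \<notin> V" "v \<notin> V"
    for n V u v
  proof -
    define p where "p = lam / real n"
    define C where "C = real (card V choose Suc d)"
    have n0: "n > 0" "2 * lam \<le> n" "8 * Suc d \<le> n" using n by (auto simp: N_def)
    have p: "0 \<le> p" "p \<le> 1 / 2" using assms n0 by (auto simp: p_def field_simps)
    have cV: "2 * Suc d \<le> card V" using V(3) n0(3) by simp
    have Cge: "(real (card V) / real (Suc d)) ^ Suc d \<le> C"
      unfolding C_def using cV by (intro binomial_ge_n_over_k_pow_k) simp
    have "(2::real) \<le> 2 ^ Suc d" by simp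
    also have "\<dots> \<le> (real (card V) / real (Suc d)) ^ Suc d"
    proof (intro power_mono)
      have "real (2 * Suc d) \<le> real (card V)" using cV by (simp only: of_nat_le_iff)
      then show "2 \<le> real (card V) / real (Suc d)" by (simp add: field_simps)
    qed simp
    finally have C2: "2 \<le> C" using Cge by linarith
    have "(lam / (4 * real (Suc d))) ^ Suc d \<le> (real (card V) / real (Suc d) * p) ^ Suc d"
    proof (intro power_mono)
      have "lam * real n \<le> lam * (4 * real (card V))"
        using V(3) assms by (intro mult_left_mono) auto
      then have "lam / 4 \<le> real (card V) * p" using n0 by (simp add: p_def field_simps)
      then have "lam / 4 / real (Suc d) \<le> real (card V) * p / real (Suc d)"
        by (intro divide_right_mono) auto
      then show "lam / (4 * real (Suc d)) \<le> real (card V) / real (Suc d) * p" by simp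
    qed (use assms in auto)
    also have "\<dots> = (real (card V) / real (Suc d)) ^ Suc d * p ^ Suc d" by (rule power_mult_distrib)
    also have "\<dots> \<le> C * p ^ Suc d" using Cge p by (intro mult_right_mono) auto
    finally have 1: "(lam / (4 * real (Suc d))) ^ Suc d \<le> C * p ^ Suc d" .
    have "exp (- (2 * lam)) \<le> exp (- (2 * p * real (card V)))"
    proof -
      have "lam * real (card V) \<le> lam * real n" using V assms by (intro mult_left_mono) auto
      then have "2 * p * real (card V) \<le> 2 * lam" using n0 by (simp add: p_def field_simps)
      then show ?thesis by simp
    qed
    also have "\<dots> \<le> (1 - p) ^ card V" by (rule exp_le_one_minus_power[OF p])
    finally have 2: "exp (- (2 * lam)) \<le> (1 - p) ^ card V" .
    have "r \<le> C * p ^ Suc d * (1 - p) ^ card V"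
      unfolding r_def using 1 2 C2 p by (intro mult_mono) auto
    then have "r\<^sup>2 \<le> (C * p ^ Suc d * (1 - p) ^ card V)\<^sup>2" using r by (intro power_mono) auto
    then have "r\<^sup>2 / 2 \<le> C * C / 2 * (p ^ Suc d * (1 - p) ^ card V)\<^sup>2"
      by (simp add: power2_eq_square mult_ac)
    also have "\<dots> \<le> C * (C - 1) * (p ^ Suc d * (1 - p) ^ card V)\<^sup>2"
    proof (intro mult_right_mono)
      have "C * 2 \<le> C * C" using C2 by (intro mult_left_mono) auto
      then show "C * C / 2 \<le> C * (C - 1)" by (simp add: algebra_simps)
    qed auto
    also have "\<dots> \<le> bern_mean p (star_pair V u v) (\<lambda>T. of_bool (good_pair d u v T))"
      unfolding C_def using V uv p by (intro bern_mean_good_pair_ge) auto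
    finally show ?thesis by (simp add: p_def)
  qed
  show ?thesis
    using r main by (intro exI[of _ "min 1 (r\<^sup>2 / 2)"] exI[of _ N]) auto
qed

section \<open>The uniform smoothing estimate\<close>

lemma obtain_disjoint_pairs:
  assumes "finite X" "2 * m \<le> card X"
  obtains u v :: "nat \<Rightarrow> 'a" where "inj_on u {..<m}" "inj_on v {..<m}"
    "u ` {..<m} \<inter> v ` {..<m} = {}" "u ` {..<m} \<subseteq> X" "v ` {..<m} \<subseteq> X"
proof -
  obtain f where f: "bij_betw f {..<card X} X"
    using ex_bij_betw_nat_finite[OF assms(1)] by (auto simp: atLeast0LessThan)
  then have inj: "inj_on f {..<card X}" and im: "f ` {..<card X} = X"
    by (auto simp: bij_betw_def)
  show thesis
  proof (rule that[of f "\<lambda>i. f (m + i)"])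
    show "inj_on f {..<m}" using inj by (rule inj_on_subset) (use assms in auto)
    show "inj_on (\<lambda>i. f (m + i)) {..<m}"
    proof (rule inj_onI)
      fix i j assume "i \<in> {..<m}" "j \<in> {..<m}" "f (m + i) = f (m + j)"
      then show "i = j" using inj_onD[OF inj, of "m + i" "m + j"] assms(2) by auto
    qed
    show "f ` {..<m} \<inter> (\<lambda>i. f (m + i)) ` {..<m} = {}"
    proof -
      have "f i \<noteq> f (m + j)" if "i < m" "j < m" for i j
        using inj_onD[OF inj, of i "m + j"] that assms(2) by auto
      then show ?thesis by auto
    qed
    show "f ` {..<m} \<subseteq> X" "(\<lambda>i. f (m + i)) ` {..<m} \<subseteq> X"
      using im assms(2) by auto
  qed
qed

lemma exp_minus_one_le_two_mult:
  fixes x :: real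
  assumes "0 \<le> x" "x \<le> 1"
  shows "exp (2 * x) - 1 \<le> 16 * x"
proof -
  have "exp (2 * x) * (1 - exp (- (2 * x))) \<le> exp 2 * (2 * x)"
    using assms exp_ge_add_one_self[of "- (2 * x)"] by (intro mult_mono) auto
  moreover have "exp (2::real) \<le> 8"
  proof -
    have "exp (2::real) = exp 1 * exp 1" by (simp flip: exp_add)
    also have "\<dots> \<le> (272/100) * (272/100)"
      using e_less_272 by (intro mult_mono) auto
    finally show ?thesis by simp
  qed
  then have "exp 2 * (2 * x) \<le> 8 * (2 * x)" using assms(1) by (intro mult_right_mono) simp_all
  moreover have "exp (2 * x) * (1 - exp (- (2 * x))) = exp (2 * x) - 1"
    by (simp add: right_diff_distrib exp_minus)
  ultimately show ?thesis by linarith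
qed

text \<open>Up to two vertices may be missing while the edge probability stays
  \<open>lam / n\<close>: the expansion below removes a vertex and then one of its neighbours. The
  constants are uniform in \<open>A\<close>, \<open>F\<close>, \<open>t\<close>, \<open>g\<close>
  and \<open>n\<close>.\<close>

definition smooth_bound :: "real \<Rightarrow> nat \<Rightarrow> real \<Rightarrow> real \<Rightarrow> nat \<Rightarrow> bool" where
  "smooth_bound lam d c C N \<longleftrightarrow> (\<forall>n\<ge>N. \<forall>A F t g B.
      finite A \<longrightarrow> card A \<le> n \<longrightarrow> n \<le> card A + 2 \<longrightarrow> F \<subseteq> A \<longrightarrow> \<bar>t\<bar> \<le> pi \<longrightarrow>
      depends_on A F g \<longrightarrow> (\<forall>S\<subseteq>clique A. norm (g S) \<le> B) \<longrightarrow>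
      norm (bern_mean (lam / real n) (clique A) (\<lambda>S. g S * cis (t * off_count d A S))) \<le>
        B * exp (C * real (card F) - c * real n * t\<^sup>2))"

lemma smoothing:
  fixes lam :: real and d :: nat
  assumes lam: "lam > 0"
  shows "\<exists>c C N. 0 < c \<and> 0 \<le> C \<and> smooth_bound lam d c C N"
proof -
  obtain q :: real and N1 where q: "0 < q" "q \<le> 1" and q3: "\<forall>n\<ge>N1. \<forall>V u v. finite V \<longrightarrow> card V \<le> n \<longrightarrow>
      n \<le> 4 * card V \<longrightarrow> u \<noteq> v \<longrightarrow> u \<notin> V \<longrightarrow> v \<notin> V \<longrightarrow>
      q \<le> bern_mean (lam / real n) (star_pair V u v) (\<lambda>T. of_bool (good_pair d u v T))"
    using good_pair_prob_bounded_below[OF lam, of d] by blast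
  \<comment> \<open>The bound 1/16 leaves at least a quarter of the vertices for \<open>V\<close>;
    the bound \<open>1 / (256 * lam)\<close> keeps the loss from spoiled pairs below half of the
    gain \<open>\<theta> * m\<close>.\<close>
  define \<epsilon> where "\<epsilon> = min (1/16) (1 / (256 * lam))"
  \<comment> \<open>Since \<open>\<theta> \<ge> q * t^2 / 12\<close> and
    \<open>m \<ge> \<epsilon> * n / 2\<close>, half of the gain is at least
    \<open>q * \<epsilon> * n * t^2 / 48\<close>.\<close>
  define c where "c = q * \<epsilon> / 48"
  \<comment> \<open>Chosen to make the estimate trivial when \<open>F\<close> has more than
    \<open>2 * \<epsilon> * n\<close> vertices: \<open>t^2\<close> is at most 16, so the exponent is
    then nonnegative.\<close>
  define C where "C = c * 16 / (2 * \<epsilon>)"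
  define N where "N = max (max N1 4) (max (nat \<lceil>2 / \<epsilon>\<rceil>) (nat \<lceil>lam\<rceil>))"
  have \<epsilon>: "0 < \<epsilon>" "\<epsilon> \<le> 1/16" "\<epsilon> \<le> 1 / (256 * lam)" using lam by (auto simp: \<epsilon>_def)
  have c: "0 < c" using q \<epsilon> by (simp add: c_def)
  have C: "0 \<le> C" using c \<epsilon> by (simp add: C_def)
  have main: "norm (bern_mean (lam / real n) (clique A) (\<lambda>S. g S * cis (t * off_count d A S))) \<le>
        B * exp (C * real (card F) - c * real n * t\<^sup>2)"
    if n: "N \<le> n" and A: "finite A" "card A \<le> n" "n \<le> card A + 2" and F: "F \<subseteq> A"
      and t: "\<bar>t\<bar> \<le> pi" and g: "depends_on A F g" "\<And>S. S \<subseteq> clique A \<Longrightarrow> norm (g S) \<le> B"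
    for n A F t g B
  proof -
    define p where "p = lam / real n"
    have n0: "N1 \<le> n" "4 \<le> n" "2 / \<epsilon> \<le> n" "lam \<le> n" using n by (auto simp: N_def)
    have p: "0 \<le> p" "p \<le> 1" using lam n0 by (auto simp: p_def)
    have B: "0 \<le> B" using g(2)[of "{}"] norm_ge_zero order_trans by blast
    have finF: "finite F" using F A finite_subset by blast
    show ?thesis
    proof (cases "2 * \<epsilon> * n < card F")
      case True
      have "t\<^sup>2 \<le> 16"
      proof -
        have "\<bar>t\<bar>\<^sup>2 \<le> 4\<^sup>2" using t pi_less_4 by (intro power_mono) auto
        then show ?thesis by simp
      qed
      then have "c * real n * t\<^sup>2 \<le> c * real n * 16" using c by (intro mult_left_mono) auto
      also have "\<dots> = C * (2 * \<epsilon> * real n)" using \<epsilon> by (simp add: C_def)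
      also have "\<dots> \<le> C * real (card F)" using C True by (intro mult_left_mono) auto
      finally have "B * 1 \<le> B * exp (C * real (card F) - c * real n * t\<^sup>2)"
        using B by (intro mult_left_mono) auto
      moreover have "norm (bern_mean p (clique A) (\<lambda>S. g S * cis (t * off_count d A S))) \<le> bern_mean p (clique A) (\<lambda>_. B)"
        using g(2) by (intro norm_bern_mean_le[OF p]) (simp add: norm_mult)
      then have "norm (bern_mean p (clique A) (\<lambda>S. g S * cis (t * off_count d A S))) \<le> B"
        using finite_clique[OF A(1)] by (simp add: bern_mean_const)
      ultimately show ?thesis by (simp add: p_def)
    next
      case False
      then have cF: "real (card F) \<le> 2 * \<epsilon> * n" by simp
      define m where "m = nat \<lfloor>\<epsilon> * n\<rfloor>"
      have m: "real m \<le> \<epsilon> * n" "\<epsilon> * n / 2 \<le> real m"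
      proof -
        have "1 \<le> \<epsilon> * n / 2" using n0(3) \<epsilon> by (simp add: field_simps)
        moreover have "real m = of_int \<lfloor>\<epsilon> * n\<rfloor>" using \<epsilon> by (simp add: m_def)
        ultimately show "real m \<le> \<epsilon> * n" "\<epsilon> * n / 2 \<le> real m" by linarith+
      qed
      have en: "\<epsilon> * n \<le> n / 16" using \<epsilon>(2) mult_right_mono[of \<epsilon> "1/16" "real n"] by simp
      have small: "real (card F) + 2 * real m \<le> real n / 4" using m cF en by linarith
      have cAF: "real (card (A - F)) = real (card A) - real (card F)"
        using F A finF by (simp add: card_Diff_subset card_mono of_nat_diff)
      have "2 * real m \<le> real (card (A - F))"
        unfolding cAF using small n0(2) A(3) by linarith
      then have "2 * m \<le> card (A - F)" by linarith
      then obtain u v :: "nat \<Rightarrow> nat" where uv: "inj_on u {..<m}" "inj_on v {..<m}"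
        "u ` {..<m} \<inter> v ` {..<m} = {}" "u ` {..<m} \<subseteq> A - F" "v ` {..<m} \<subseteq> A - F"
        using obtain_disjoint_pairs[of "A - F" m] A(1) by blast
      define V where "V = A - F - u ` {..<m} - v ` {..<m}"
      have cU: "card (u ` {..<m} \<union> v ` {..<m}) = 2 * m"
        using uv by (simp add: card_Un_disjoint card_image)
      have "V = (A - F) - (u ` {..<m} \<union> v ` {..<m})" by (auto simp: V_def)
      then have "card V = card (A - F) - 2 * m"
        using uv A(1) by (simp add: card_Diff_subset flip: cU)
      then have cV: "n \<le> 4 * card V" "card V \<le> n"
        using small cAF n0(2) A by linarith+
      define \<theta> where "\<theta> = (1 - \<bar>cos (t / 2)\<bar>) * q"
      have cos0: "0 \<le> cos (t / 2)" using t by (intro cos_ge_zero) auto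
      have \<theta>: "0 \<le> \<theta>" "\<theta> \<le> 1"
        using q cos0 by (auto simp: \<theta>_def intro!: mult_le_one)
      have \<theta>t: "q * t\<^sup>2 / 12 \<le> \<theta>"
      proof -
        have "(t / 2)\<^sup>2 / 3 \<le> 1 - cos (t / 2)" using t by (intro one_minus_cos_ge) auto
        then have "(t / 2)\<^sup>2 / 3 * q \<le> \<theta>" using q cos0 by (simp add: \<theta>_def)
        then show ?thesis by (simp add: power_divide field_simps)
      qed
      have cFU: "card (F \<union> u ` {..<m} \<union> v ` {..<m}) \<le> card F + 2 * m"
        using card_Un_le[of F "u ` {..<m} \<union> v ` {..<m}"] cU by (simp add: Un_assoc)
      have "norm (bern_mean p (clique A) (\<lambda>S. g S * cis (t * off_count d A S))) \<le>
        B * (exp (- (\<theta> * card {..<m})) * (1 - p + p * exp (2 * \<theta>)) ^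
          (card (u ` {..<m} \<union> v ` {..<m}) * card (F \<union> u ` {..<m} \<union> v ` {..<m})))"
        unfolding \<theta>_def
      proof (rule norm_bern_mean_cis_le[OF p A(1) _ uv(1-3) F uv(4,5) g])
        fix i assume i: "i \<in> {..<m}"
        show "q \<le> bern_mean p (star_pair (A - F - u ` {..<m} - v ` {..<m}) (u i) (v i))
             (\<lambda>T. of_bool (good_pair d (u i) (v i) T))"
          unfolding p_def V_def[symmetric] using i uv(3) A n0 cV
          by (intro q3[rule_format]) (auto simp: V_def)
      qed (use q in auto)
      also have "\<dots> \<le> B * (exp (- (\<theta> * m)) * exp (16 * \<theta> * p) ^ (2 * m * (card F + 2 * m)))"
      proof -
        have "1 - p + p * exp (2 * \<theta>) = 1 + p * (exp (2 * \<theta>) - 1)" by (simp add: algebra_simps)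
        also have "\<dots> \<le> 1 + p * (16 * \<theta>)"
          using exp_minus_one_le_two_mult[OF \<theta>] p by (intro add_left_mono mult_left_mono) auto
        also have "\<dots> \<le> exp (16 * \<theta> * p)"
          using exp_ge_add_one_self[of "16 * \<theta> * p"] by (simp add: mult_ac)
        finally have 1: "1 - p + p * exp (2 * \<theta>) \<le> exp (16 * \<theta> * p)" .
        have "0 \<le> 1 - p + p * exp (2 * \<theta>)" using p by simp
        then have "(1 - p + p * exp (2 * \<theta>)) ^ (2 * m * card (F \<union> u ` {..<m} \<union> v ` {..<m})) \<le>
            exp (16 * \<theta> * p) ^ (2 * m * card (F \<union> u ` {..<m} \<union> v ` {..<m}))"
          using 1 by (intro power_mono)
        also have "\<dots> \<le> exp (16 * \<theta> * p) ^ (2 * m * (card F + 2 * m))"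
          using cFU \<theta> p by (intro power_increasing mult_left_mono) auto
        finally show ?thesis using B by (simp add: cU mult_left_mono)
      qed
      also have "\<dots> \<le> B * exp (C * real (card F) - c * real n * t\<^sup>2)"
      proof (intro mult_left_mono B)
        have "exp (- (\<theta> * m)) * exp (16 * \<theta> * p) ^ (2 * m * (card F + 2 * m)) =
          exp (\<theta> * m * (32 * p * (card F + 2 * m) - 1))"
          by (simp add: exp_of_nat_mult[symmetric] exp_add[symmetric] algebra_simps)
        also have "\<dots> \<le> exp (- (c * real n * t\<^sup>2))"
        proof -
          have "256 * lam * (\<epsilon> * n) \<le> n"
          proof -
            have "256 * lam * \<epsilon> \<le> 1" using \<epsilon>(3) lam by (simp add: field_simps)
            then show ?thesis using mult_right_mono[of "256 * lam * \<epsilon>" 1 "real n"] by simp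
          qed
          then have "lam * (real (card F) + 2 * real m) \<le> real n / 64"
            using mult_left_mono[of "real (card F) + 2 * real m" "4 * (\<epsilon> * n)" lam] m cF lam
            by linarith
          then have "p * (real (card F) + 2 * real m) \<le> 1 / 64"
            using n0 by (simp add: p_def field_simps)
          then have "32 * p * real (card F + 2 * m) - 1 \<le> - 1 / 2" by simp
          then have "\<theta> * m * (32 * p * (card F + 2 * m) - 1) \<le> \<theta> * m * (- 1 / 2)"
            using \<theta> by (intro mult_left_mono) auto
          moreover have "c * real n * t\<^sup>2 \<le> \<theta> * m / 2"
          proof -
            have "(q * t\<^sup>2 / 12) * (\<epsilon> * n / 2) \<le> \<theta> * m"
              using \<theta>t m \<theta> \<epsilon> by (intro mult_mono) auto
            then show ?thesis by (simp add: c_def field_simps)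
          qed
          ultimately show ?thesis by simp
        qed
        also have "\<dots> \<le> exp (C * real (card F) - c * real n * t\<^sup>2)" using C by simp
        finally show "exp (- (\<theta> * m)) * exp (16 * \<theta> * p) ^ (2 * m * (card F + 2 * m)) \<le>
          exp (C * real (card F) - c * real n * t\<^sup>2)" .
      qed
      finally show ?thesis by (simp add: p_def)
    qed
  qed
  then have "smooth_bound lam d c C N" unfolding smooth_bound_def by blast
  then show ?thesis using c C by blast
qed

section \<open>Removing a vertex\<close>

lemma clique_insert:
  assumes "v \<notin> A"
  shows "clique (insert v A) = (\<lambda>j. {v, j}) ` A \<union> clique A" "(\<lambda>j. {v, j}) ` A \<inter> clique A = {}"
proof -
  show "clique (insert v A) = (\<lambda>j. {v, j}) ` A \<union> clique A"
  proof (intro equalityI subsetI)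
    fix e assume "e \<in> clique (insert v A)"
    then obtain x y where "e = {x, y}" "x \<noteq> y" "x \<in> insert v A" "y \<in> insert v A" by (rule cliqueE)
    then show "e \<in> (\<lambda>j. {v, j}) ` A \<union> clique A"
      by (auto simp: doubleton_in_clique insert_commute)
  next
    fix e assume "e \<in> (\<lambda>j. {v, j}) ` A \<union> clique A"
    then show "e \<in> clique (insert v A)"
    proof
      assume "e \<in> (\<lambda>j. {v, j}) ` A"
      then show ?thesis using assms by (auto simp: doubleton_in_clique)
    qed (auto simp: clique_def)
  qed
  show "(\<lambda>j. {v, j}) ` A \<inter> clique A = {}" using assms by (auto simp: doubleton_in_clique)
qed

text \<open>The star at the new vertex is independent of the graph on \<open>A\<close>, and its edge
  set is encoded by the random neighbourhood \<open>M\<close>.\<close>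

lemma bern_mean_clique_insert:
  assumes "finite A" "v \<notin> A"
  shows "bern_mean p (clique (insert v A)) h = bern_mean p A (\<lambda>M. bern_mean p (clique A) (\<lambda>S. h (S \<union> (\<lambda>j. {v, j}) ` M)))"
proof -
  have "inj_on (\<lambda>j. {v, j}) A" by (auto simp: inj_on_def doubleton_eq_iff)
  then show ?thesis
    unfolding clique_insert(1)[OF assms(2)]
    using assms clique_insert(2)[OF assms(2)] finite_clique[OF assms(1)]
    by (subst bern_mean_Un) (simp_all add: bern_mean_image Un_commute)
qed

lemma
  assumes "S \<subseteq> clique A" "finite A" "v \<notin> A" "M \<subseteq> A"
  shows vdeg_insert_new: "vdeg (S \<union> (\<lambda>j. {v, j}) ` M) v = card M"
    and vdeg_insert_old: "j \<in> A \<Longrightarrow> vdeg (S \<union> (\<lambda>j. {v, j}) ` M) j = vdeg S j + of_bool (j \<in> M)"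
proof -
  have "nbhd (S \<union> (\<lambda>j. {v, j}) ` M) v = M"
    using assms doubleton_in_clique by (fastforce simp: nbhd_def doubleton_eq_iff)
  then show "vdeg (S \<union> (\<lambda>j. {v, j}) ` M) v = card M" by (simp add: vdeg_def)
next
  assume j: "j \<in> A"
  then have "nbhd (S \<union> (\<lambda>j. {v, j}) ` M) j = (if j \<in> M then insert v (nbhd S j) else nbhd S j)"
    using assms by (auto simp: nbhd_def doubleton_eq_iff)
  moreover have "v \<notin> nbhd S j" using assms nbhd_subset[OF assms(1)] by blast
  ultimately show "vdeg (S \<union> (\<lambda>j. {v, j}) ` M) j = vdeg S j + of_bool (j \<in> M)"
    using finite_nbhd[OF assms(2,1), of j] by (simp add: vdeg_def)
qed

text \<open>The change of the indicator of degree unequal to \<open>d\<close> when the degree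
  \<open>k\<close> grows by one.\<close>

definition jump :: "nat \<Rightarrow> nat \<Rightarrow> real" where
  "jump d k = of_bool (k = d) - of_bool (Suc k = d)"

lemma abs_jump_le: "\<bar>jump d k\<bar> \<le> 1"
  by (simp add: jump_def)

lemma off_count_insert:
  assumes "S \<subseteq> clique A" "finite A" "v \<notin> A" "M \<subseteq> A"
  shows "off_count d (insert v A) (S \<union> (\<lambda>j. {v, j}) ` M) =
    of_bool (card M \<noteq> d) + (\<Sum>j\<in>M. jump d (vdeg S j)) + off_count d A S"
proof -
  have "(\<Sum>j\<in>A. of_bool (vdeg (S \<union> (\<lambda>j. {v, j}) ` M) j \<noteq> d)) =
        (\<Sum>j\<in>A. of_bool (vdeg S j \<noteq> d) + of_bool (j \<in> M) * jump d (vdeg S j))"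
    by (intro sum.cong refl) (auto simp: vdeg_insert_old[OF assms] jump_def)
  also have "\<dots> = off_count d A S + (\<Sum>j\<in>M. jump d (vdeg S j))"
    using assms(2,4) by (simp add: sum.distrib off_count_def sum.If_cases of_bool_def Int_absorb1 if_distrib[of "\<lambda>x. x * _"] cong: if_cong)
  finally show ?thesis
    using assms by (simp add: off_count_def vdeg_insert_new[OF assms])
qed

lemma bern_mean_card_cong:
  assumes "finite A" "finite B" "card A = card B"
  shows "bern_mean p A (\<lambda>M. f (card M)) = bern_mean p B (\<lambda>M. f (card M))"
proof -
  obtain h where h: "bij_betw h A B" using finite_same_card_bij[OF assms] by blast
  then have inj: "inj_on h A" and B: "B = h ` A" by (auto simp: bij_betw_def)
  have "card (h ` M) = card M" if "M \<subseteq> A" for M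
    using inj that by (meson card_image inj_on_subset)
  then show ?thesis
    unfolding B bern_mean_image[OF inj] by (intro bern_mean_cong) simp
qed

lemma norm_cis_minus_one_le: "norm (cis x - 1) \<le> \<bar>x\<bar>"
  using iexp_approx1[of x 0] by (simp add: cis_conv_exp)

lemma norm_cis_taylor_one_le: "norm (cis x - 1 - \<i> * x) \<le> x\<^sup>2 / 2"
  using iexp_approx1[of x 1] by (simp add: cis_conv_exp algebra_simps power2_eq_square abs_mult_self_eq)

text \<open>Masking the degrees outside \<open>F\<close> by 0 gives any functional of the degrees in
  \<open>F\<close> the form required of an amplitude.\<close>

lemma depends_on_degrees: "depends_on A F (\<lambda>S. f (\<lambda>j. if j \<in> F then vdeg S j else 0))"
  unfolding depends_on_def
proof (intro allI impI arg_cong[of _ _ f] ext)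
  fix S T j assume eq: "S \<subseteq> clique A \<and> T \<subseteq> clique A \<and> {e \<in> S. e \<inter> F \<noteq> {}} = {e \<in> T. e \<inter> F \<noteq> {}}"
  have "nbhd S j = nbhd T j" if "j \<in> F"
    using eq that by (auto simp: nbhd_def set_eq_iff)
  then show "(if j \<in> F then vdeg S j else 0) = (if j \<in> F then vdeg T j else 0)"
    by (simp add: vdeg_def)
qed

text \<open>A single \<open>n\<close> is fixed together with the smoothing constants. The constants
  \<open>L\<close> and \<open>distance_const\<close> built here depend only on \<open>lam\<close>,
  \<open>c\<close> and \<open>C\<close>, so they are uniform in \<open>n\<close>.\<close>

locale smoothed_graph =
  fixes lam c C :: real and d N n :: nat
  assumes lam: "0 < lam" and c: "0 < c" and C: "0 \<le> C" and sm: "smooth_bound lam d c C N"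
    and n: "N \<le> n" "lam \<le> real n"
begin

definition p :: real where "p = lam / real n"

definition Z :: "nat set \<Rightarrow> real \<Rightarrow> complex" where
  "Z A t = bern_mean p (clique A) (\<lambda>S. cis (t * off_count d A S))"

text \<open>Dominates the Poisson moment generating function \<open>exp (lam * (exp x - 1))\<close>
  at \<open>x = C + 2\<close>: the summand \<open>C\<close> pays for smoothing, 2 for the factor
  \<open>(1 + card M)^2\<close> of the Taylor remainder.\<close>

definition L :: real where "L = exp (lam * exp (C + 2))"

definition decay :: "real \<Rightarrow> real" where "decay t = exp (- (c * real n * t\<^sup>2))"

lemma p: "0 \<le> p" "p \<le> 1" and n_pos: "0 < n"
  using lam n by (auto simp: p_def)

lemma L_ge_1: "1 \<le> L"
  using lam by (simp add: L_def)

lemma decay_pos: "0 < decay t" by (simp add: decay_def)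

lemma bern_mean_exp_card_le:
  assumes "finite A" "card A \<le> n"
  shows "bern_mean p A (\<lambda>M. (1 + real (card M))\<^sup>2 * exp (C * card M)) \<le> L"
proof -
  have "bern_mean p A (\<lambda>M. (1 + real (card M))\<^sup>2 * exp (C * card M)) \<le> bern_mean p A (\<lambda>M. exp (C + 2) ^ card M)"
  proof (intro bern_mean_mono p)
    fix M
    have "(1 + real (card M))\<^sup>2 \<le> (exp (real (card M)))\<^sup>2"
      by (intro power_mono) (auto simp: exp_ge_add_one_self)
    also have "\<dots> = exp (2 * real (card M))" by (simp flip: exp_double)
    finally have "(1 + real (card M))\<^sup>2 * exp (C * card M) \<le> exp (2 * real (card M)) * exp (C * card M)"
      by (intro mult_right_mono) auto
    then show "(1 + real (card M))\<^sup>2 * exp (C * card M) \<le> exp (C + 2) ^ card M"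
      by (simp add: exp_of_nat_mult[symmetric] exp_add[symmetric] algebra_simps)
  qed
  also have "\<dots> = (1 + p * (exp (C + 2) - 1)) ^ card A"
    using assms by (simp add: bern_mean_power_card algebra_simps)
  also have "\<dots> \<le> exp (p * exp (C + 2)) ^ card A"
  proof (intro power_mono)
    have "p * (exp (C + 2) - 1) \<le> p * exp (C + 2)" using p by (intro mult_left_mono) auto
    then show "1 + p * (exp (C + 2) - 1) \<le> exp (p * exp (C + 2))"
      using exp_ge_add_one_self[of "p * exp (C + 2)"] by linarith
    show "0 \<le> 1 + p * (exp (C + 2) - 1)" using p C by simp
  qed
  also have "\<dots> \<le> exp (p * exp (C + 2)) ^ n"
    using assms p by (intro power_increasing) auto
  also have "\<dots> = L" using n_pos by (simp add: L_def p_def flip: exp_of_nat_mult)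
  finally show ?thesis .
qed

lemma bern_mean_card_power_le:
  assumes "finite A" "card A \<le> n"
  shows "bern_mean p A (\<lambda>M. (1 + real (card M)) * exp (C * card M)) \<le> L" "bern_mean p A (\<lambda>M. 1 + real (card M)) \<le> L"
proof -
  have 1: "1 + real (card M) \<le> (1 + real (card M))\<^sup>2" for M :: "'z set"
    by (simp add: power2_eq_square)
  have "bern_mean p A (\<lambda>M. (1 + real (card M)) * exp (C * card M)) \<le>
      bern_mean p A (\<lambda>M. (1 + real (card M))\<^sup>2 * exp (C * card M))"
    using 1 by (intro bern_mean_mono p mult_right_mono) auto
  then show *: "bern_mean p A (\<lambda>M. (1 + real (card M)) * exp (C * card M)) \<le> L"
    using bern_mean_exp_card_le[OF assms] by linarith
  have "bern_mean p A (\<lambda>M. 1 + real (card M)) \<le> bern_mean p A (\<lambda>M. (1 + real (card M)) * exp (C * card M))"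
    using C by (intro bern_mean_mono p) simp
  then show "bern_mean p A (\<lambda>M. 1 + real (card M)) \<le> L" using * by linarith
qed

lemma smooth_degrees:
  assumes "finite A" "card A \<le> n" "n \<le> card A + 2" "M \<subseteq> A" "\<bar>t\<bar> \<le> pi"
    "\<And>h. norm (f h) \<le> B"
  shows "norm (bern_mean p (clique A) (\<lambda>S. f (\<lambda>j. if j \<in> M then vdeg S j else 0) * cis (t * off_count d A S))) \<le>
    B * exp (C * card M) * decay t"
  using sm[unfolded smooth_bound_def, rule_format, OF n(1) assms(1-5) depends_on_degrees[of A M f]] assms(6)
  by (simp add: p_def decay_def mult.assoc flip: exp_add)

lemma abs_sum_jump_le:
  assumes "\<bar>x\<bar> \<le> 1" "finite M"
  shows "\<bar>x + (\<Sum>j\<in>M. jump d (h j))\<bar> \<le> 1 + real (card M)"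
proof -
  have "\<bar>\<Sum>j\<in>M. jump d (h j)\<bar> \<le> (\<Sum>j\<in>M. 1)"
    by (intro order_trans[OF sum_abs] sum_mono abs_jump_le)
  then show ?thesis using assms by simp
qed

section \<open>Taylor expansion of the effect of a star\<close>

context
  fixes A :: "nat set" and t :: real
  assumes A: "finite A" "card A \<le> n" "n \<le> card A + 2" and t: "\<bar>t\<bar> \<le> pi"
begin

text \<open>Here \<open>x\<close> stands for the indicator of the new vertex. The exponential of the
  shift minus 1 is a function of the degrees in \<open>M\<close>, hence an admissible amplitude of
  modulus at most \<open>\<bar>t\<bar> * (1 + card M)\<close>.\<close>

lemma star_shift_order_zero:
  assumes M: "M \<subseteq> A" and x: "\<bar>x\<bar> \<le> 1"
  shows "norm (bern_mean p (clique A) (\<lambda>S. cis (t * (x + (\<Sum>j\<in>M. jump d (vdeg S j)) + off_count d A S))) - Z A t)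
    \<le> \<bar>t\<bar> * ((1 + real (card M)) * exp (C * card M)) * decay t"
proof -
  define f where "f h = cis (t * (x + (\<Sum>j\<in>M. jump d (h j)))) - 1" for h
  have finM: "finite M" using M A(1) finite_subset by blast
  have "norm (f h) \<le> \<bar>t\<bar> * (1 + real (card M))" for h
    unfolding f_def using abs_sum_jump_le[OF x finM, of h]
    by (intro order_trans[OF norm_cis_minus_one_le]) (simp add: abs_mult mult_left_mono)
  then have "norm (bern_mean p (clique A) (\<lambda>S. f (\<lambda>j. if j \<in> M then vdeg S j else 0) * cis (t * off_count d A S))) \<le>
     \<bar>t\<bar> * (1 + real (card M)) * exp (C * card M) * decay t"
    by (intro smooth_degrees[where f = f] A M t)
  also have "(\<lambda>S. f (\<lambda>j. if j \<in> M then vdeg S j else 0) * cis (t * off_count d A S)) =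
     (\<lambda>S. cis (t * (x + (\<Sum>j\<in>M. jump d (vdeg S j)) + off_count d A S)) - cis (t * off_count d A S))"
    by (simp add: f_def left_diff_distrib cis_mult algebra_simps cong: sum.cong)
  finally show ?thesis by (simp add: bern_mean_diff Z_def mult.assoc)
qed

text \<open>The same argument with the quadratic Taylor remainder as amplitude. The linear terms are
  kept, for they produce the coefficient of the differential inequality.\<close>

lemma star_shift_order_one:
  assumes M: "M \<subseteq> A" and x: "\<bar>x\<bar> \<le> 1"
  shows "norm (bern_mean p (clique A) (\<lambda>S. cis (t * (x + (\<Sum>j\<in>M. jump d (vdeg S j)) + off_count d A S))) - Z A t
      - \<i> * t * (x * Z A t + (\<Sum>j\<in>M. bern_mean p (clique A) (\<lambda>S. jump d (vdeg S j) * cis (t * off_count d A S)))))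
    \<le> t\<^sup>2 * ((1 + real (card M))\<^sup>2 * exp (C * card M)) * decay t"
proof -
  define y where "y h = x + (\<Sum>j\<in>M. jump d (h j))" for h
  define f where "f h = cis (t * y h) - 1 - \<i> * (t * y h)" for h
  have finM: "finite M" using M A(1) finite_subset by blast
  have "norm (f h) \<le> t\<^sup>2 * (1 + real (card M))\<^sup>2" for h
  proof -
    have "\<bar>y h\<bar>\<^sup>2 \<le> (1 + real (card M))\<^sup>2"
      unfolding y_def by (intro power_mono abs_sum_jump_le[OF x finM]) auto
    then have "t\<^sup>2 * (y h)\<^sup>2 \<le> t\<^sup>2 * (1 + real (card M))\<^sup>2" by (intro mult_left_mono) auto
    moreover have "norm (f h) \<le> (t * y h)\<^sup>2 / 2"
      unfolding f_def using norm_cis_taylor_one_le[of "t * y h"] by simp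
    moreover have "0 \<le> norm (f h)" by simp
    ultimately show ?thesis unfolding power_mult_distrib by linarith
  qed
  then have "norm (bern_mean p (clique A) (\<lambda>S. f (\<lambda>j. if j \<in> M then vdeg S j else 0) * cis (t * off_count d A S))) \<le>
     t\<^sup>2 * (1 + real (card M))\<^sup>2 * exp (C * card M) * decay t"
    by (intro smooth_degrees[where f = f] A M t)
  also have "(\<lambda>S. f (\<lambda>j. if j \<in> M then vdeg S j else 0) * cis (t * off_count d A S)) =
     (\<lambda>S. cis (t * (x + (\<Sum>j\<in>M. jump d (vdeg S j)) + off_count d A S)) - cis (t * off_count d A S)
        - \<i> * t * (x * cis (t * off_count d A S) + (\<Sum>j\<in>M. jump d (vdeg S j) * cis (t * off_count d A S))))"
  proof
    fix S
    have *: "y (\<lambda>j. if j \<in> M then vdeg S j else 0) = x + (\<Sum>j\<in>M. jump d (vdeg S j))"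
      by (simp add: y_def cong: sum.cong)
    have "cis (t * (x + (\<Sum>j\<in>M. jump d (vdeg S j)) + off_count d A S)) =
        cis (t * (x + (\<Sum>j\<in>M. jump d (vdeg S j)))) * cis (t * off_count d A S)"
      by (simp add: cis_mult distrib_left)
    then show "f (\<lambda>j. if j \<in> M then vdeg S j else 0) * cis (t * off_count d A S) =
      cis (t * (x + (\<Sum>j\<in>M. jump d (vdeg S j)) + off_count d A S)) - cis (t * off_count d A S)
        - \<i> * t * (x * cis (t * off_count d A S) + (\<Sum>j\<in>M. jump d (vdeg S j) * cis (t * off_count d A S)))"
      unfolding f_def * by (simp add: algebra_simps flip: sum_distrib_right)
  qed
  finally show ?thesis by (simp add: bern_mean_diff bern_mean_add bern_mean_sum bern_mean_mult_left Z_def mult.assoc)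
qed

end

text \<open>The degree of \<open>v\<close> is \<open>card M\<close>, independent of the graph on
  \<open>A\<close>, so \<open>g\<close> factors out up to the shift error. With \<open>g = 1\<close>
  this compares two vertex sets; with \<open>g = jump d\<close> it brings in the mean jump.\<close>

lemma vertex_removal_order_zero:
  assumes A: "finite A" "card A < n" "n \<le> card A + 2" "v \<notin> A" and t: "\<bar>t\<bar> \<le> pi"
    and g: "\<And>k. \<bar>g k\<bar> \<le> (1::real)"
  shows "norm (bern_mean p (clique (insert v A)) (\<lambda>S. g (vdeg S v) * cis (t * off_count d (insert v A) S))
      - of_real (bern_mean p A (\<lambda>M. g (card M))) * Z A t) \<le> \<bar>t\<bar> * L * decay t"
proof -
  let ?T = "\<lambda>M. bern_mean p (clique A) (\<lambda>S. cis (t * (of_bool (card M \<noteq> d) + (\<Sum>j\<in>M. jump d (vdeg S j)) + off_count d A S)))"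
  have "bern_mean p (clique (insert v A)) (\<lambda>S. g (vdeg S v) * cis (t * off_count d (insert v A) S)) =
      bern_mean p A (\<lambda>M. of_real (g (card M)) * ?T M)"
    unfolding bern_mean_clique_insert[OF A(1,4)] bern_mean_mult_left[symmetric]
    using A by (intro bern_mean_cong) (simp add: vdeg_insert_new off_count_insert)
  then have "bern_mean p (clique (insert v A)) (\<lambda>S. g (vdeg S v) * cis (t * off_count d (insert v A) S))
      - of_real (bern_mean p A (\<lambda>M. g (card M))) * Z A t = bern_mean p A (\<lambda>M. of_real (g (card M)) * (?T M - Z A t))"
    by (simp add: right_diff_distrib bern_mean_diff bern_mean_mult_right bern_mean_of_real)
  also have "norm \<dots> \<le> bern_mean p A (\<lambda>M. (\<bar>t\<bar> * decay t) * ((1 + real (card M)) * exp (C * card M)))"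
  proof (intro norm_bern_mean_le p)
    fix M assume M: "M \<subseteq> A"
    have "norm (of_real (g (card M)) * (?T M - Z A t)) \<le> 1 * (\<bar>t\<bar> * ((1 + real (card M)) * exp (C * card M)) * decay t)"
      unfolding norm_mult using g A t M by (intro mult_mono star_shift_order_zero) auto
    then show "norm (of_real (g (card M)) * (?T M - Z A t)) \<le> \<bar>t\<bar> * decay t * ((1 + real (card M)) * exp (C * card M))"
      by (simp add: mult_ac)
  qed
  also have "\<dots> \<le> (\<bar>t\<bar> * decay t) * L"
    unfolding bern_mean_mult_left using A decay_pos[of t] by (intro mult_left_mono bern_mean_card_power_le) auto
  finally show ?thesis by (simp add: mult_ac)
qed

section \<open>The constants of the first-order expansion\<close>

definition xbar :: real where "xbar = bern_mean p {..<n - 1} (\<lambda>M. of_bool (card M \<noteq> d))"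

text \<open>The mean jump of a neighbour of the removed vertex, which has \<open>n - 2\<close>
  further possible neighbours. The interval stands for any set of that size.\<close>

definition beta :: real where "beta = bern_mean p {..<n - 2} (\<lambda>M. jump d (card M))"

text \<open>The covariance of the indicator of a vertex with that indicator plus the linearised
  effect \<open>beta * card M\<close> on its neighbours.\<close>

definition kappa :: real where
  "kappa = bern_mean p {..<n - 1} (\<lambda>M. (of_bool (card M \<noteq> d) - xbar) * (of_bool (card M \<noteq> d) + beta * card M))"

lemma xbar_bounds: "0 \<le> xbar" "xbar \<le> 1"
proof -
  show "0 \<le> xbar" unfolding xbar_def by (intro bern_mean_nonneg p) auto
  have "xbar \<le> bern_mean p {..<n - 1} (\<lambda>_. 1)" unfolding xbar_def by (intro bern_mean_mono p) auto
  then show "xbar \<le> 1" by (simp add: bern_mean_const)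
qed

lemma abs_beta_le: "\<bar>beta\<bar> \<le> 1"
proof -
  have "norm beta \<le> bern_mean p {..<n - 2} (\<lambda>_. 1)"
    unfolding beta_def using abs_jump_le by (intro norm_bern_mean_le p) simp
  then show ?thesis by (simp add: bern_mean_const)
qed

lemma abs_centred_le: "\<bar>of_bool b - xbar\<bar> \<le> 1"
  using xbar_bounds by auto

lemma abs_linear_part_le: "\<bar>of_bool b + beta * real k\<bar> \<le> 1 + real k"
proof -
  have "\<bar>beta * real k\<bar> \<le> 1 * real k"
    unfolding abs_mult using abs_beta_le by (intro mult_mono) auto
  then show ?thesis by auto
qed

lemma abs_kappa_le: "\<bar>kappa\<bar> \<le> L"
proof -
  have "norm kappa \<le> bern_mean p {..<n - 1} (\<lambda>M. 1 + real (card M))"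
    unfolding kappa_def
  proof (intro norm_bern_mean_le p)
    fix M :: "nat set"
    have "norm ((of_bool (card M \<noteq> d) - xbar) * (of_bool (card M \<noteq> d) + beta * card M)) \<le> 1 * (1 + real (card M))"
      unfolding norm_mult using abs_centred_le abs_linear_part_le by (intro mult_mono) auto
    then show "norm ((of_bool (card M \<noteq> d) - xbar) * (of_bool (card M \<noteq> d) + beta * card M)) \<le> 1 + real (card M)"
      by simp
  qed
  also have "\<dots> \<le> L" by (intro bern_mean_card_power_le) auto
  finally show ?thesis by simp
qed

context
  fixes A :: "nat set" and v :: nat and t :: real
  assumes A: "finite A" "card A = n - 1" "v \<notin> A" and t: "\<bar>t\<bar> \<le> pi"
begin

lemma Z_insert_diff: "norm (Z (insert v A) t - Z A t) \<le> \<bar>t\<bar> * L * decay t"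
  using vertex_removal_order_zero[of A v t "\<lambda>_. 1"] A t n_pos
  by (simp add: bern_mean_const Z_def)

text \<open>Removing \<open>j\<close> turns the jump into the factor \<open>beta\<close> times
  \<open>Z (A - {j}) t\<close>; two further comparisons lead from there to
  \<open>Z (insert v A) t\<close>. Each of the three steps costs
  \<open>\<bar>t\<bar> * L * decay t\<close>, because \<open>beta\<close> has modulus at most
  1.\<close>

lemma jump_cis_approx:
  assumes j: "j \<in> A"
  shows "norm (bern_mean p (clique A) (\<lambda>S. jump d (vdeg S j) * cis (t * off_count d A S)) - beta * Z (insert v A) t)
    \<le> 3 * (\<bar>t\<bar> * L * decay t)"
proof -
  let ?A = "A - {j}"
  have A': "insert j ?A = A" using j by auto
  have cA: "card ?A = n - 2" using A j by simp
  have "0 < card A" using A j card_gt_0_iff by blast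
  then have n2: "2 \<le> n" using A(2) by linarith
  have cA': "card ?A < n" "n \<le> card ?A + 2" using cA n2 by linarith+
  have beta: "bern_mean p ?A (\<lambda>M. jump d (card M)) = beta"
    unfolding beta_def using A cA by (intro bern_mean_card_cong) auto
  have "norm (bern_mean p (clique A) (\<lambda>S. jump d (vdeg S j) * cis (t * off_count d A S)) - beta * Z ?A t) \<le> \<bar>t\<bar> * L * decay t"
    using vertex_removal_order_zero[of ?A j t "jump d"] A(1) t cA' abs_jump_le
    unfolding A' beta by auto
  moreover have "norm (Z A t - Z ?A t) \<le> \<bar>t\<bar> * L * decay t"
    using vertex_removal_order_zero[of ?A j t "\<lambda>_. 1"] A(1) t cA'
    unfolding A' by (simp add: bern_mean_const Z_def)
  ultimately have *: "norm (bern_mean p (clique A) (\<lambda>S. jump d (vdeg S j) * cis (t * off_count d A S)) - beta * Z ?A t)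
     + norm (Z A t - Z ?A t) + norm (Z (insert v A) t - Z A t) \<le> 3 * (\<bar>t\<bar> * L * decay t)"
    using Z_insert_diff by linarith
  have eq: "bern_mean p (clique A) (\<lambda>S. jump d (vdeg S j) * cis (t * off_count d A S)) - beta * Z (insert v A) t =
     (bern_mean p (clique A) (\<lambda>S. jump d (vdeg S j) * cis (t * off_count d A S)) - beta * Z ?A t)
     - beta * (Z A t - Z ?A t) - beta * (Z (insert v A) t - Z A t)"
    by (simp add: algebra_simps)
  have b: "norm (beta * z) \<le> norm z" for z :: complex
    using abs_beta_le by (simp add: norm_mult mult_left_le_one_le)
  show ?thesis
    unfolding eq using * b[of "Z A t - Z ?A t"] b[of "Z (insert v A) t - Z A t"]
    by (intro order_trans[OF norm_triangle_ineq4] order_trans[OF add_mono[OF norm_triangle_ineq4 order_refl]]) linarith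
qed

text \<open>Centring by \<open>xbar\<close> cancels the zeroth-order term in the mean over
  \<open>M\<close>, so the first-order term leads. One factor \<open>L\<close> of the error stems
  from comparing vertex sets, the other from the mean over \<open>M\<close>.\<close>

lemma vertex_removal_order_one:
  "norm (bern_mean p (clique (insert v A)) (\<lambda>S. (of_bool (vdeg S v \<noteq> d) - xbar) * cis (t * off_count d (insert v A) S))
      - \<i> * t * kappa * Z (insert v A) t) \<le> t\<^sup>2 * (5 * L\<^sup>2) * decay t"
proof -
  let ?x = "\<lambda>M. of_bool (card M \<noteq> d) :: real"
  let ?g = "\<lambda>M. of_bool (card M \<noteq> d) - xbar"
  let ?T = "\<lambda>M. bern_mean p (clique A) (\<lambda>S. cis (t * (?x M + (\<Sum>j\<in>M. jump d (vdeg S j)) + off_count d A S)))"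
  let ?Y = "\<lambda>j. bern_mean p (clique A) (\<lambda>S. jump d (vdeg S j) * cis (t * off_count d A S))"
  let ?Z = "Z (insert v A) t"
  have cA: "card A < n" "card A \<le> n" "n \<le> card A + 2" using A n_pos by auto
  have "bern_mean p A (\<lambda>M. of_bool (card M \<noteq> d) :: real) = xbar"
    unfolding xbar_def using A by (intro bern_mean_card_cong) auto
  then have g0: "bern_mean p A ?g = 0"
    using A by (simp add: bern_mean_diff bern_mean_const)
  have kappa: "bern_mean p A (\<lambda>M. ?g M * (?x M + beta * card M)) = kappa"
    unfolding kappa_def using A by (intro bern_mean_card_cong[of A _ p "\<lambda>k. (of_bool (k \<noteq> d) - xbar) * (of_bool (k \<noteq> d) + beta * k)"]) auto
  have err: "norm (?T M - Z A t - \<i> * t * (?x M + beta * card M) * ?Z) \<le>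
     (t\<^sup>2 * (5 * L) * decay t) * ((1 + real (card M))\<^sup>2 * exp (C * card M))" if M: "M \<subseteq> A" for M
  proof -
    define m where "m = real (card M)"
    define D where "D = t\<^sup>2 * decay t"
    have D: "0 \<le> D" using decay_pos[of t] by (simp add: D_def)
    have m: "0 \<le> m" by (simp add: m_def)
    have 1: "norm (?T M - Z A t - \<i> * t * (?x M * Z A t + (\<Sum>j\<in>M. ?Y j))) \<le> D * ((1 + m)\<^sup>2 * exp (C * m))"
      using star_shift_order_one[OF A(1) cA(2,3) t M, of "?x M"] by (simp add: m_def D_def mult_ac)
    \<comment> \<open>Passing to the full vertex set costs first order in \<open>t\<close>; the
      prefactor \<open>\<i> * t\<close> of these terms makes the cost second order.\<close>
    have 2: "norm (?x M * (Z A t - ?Z) + (\<Sum>j\<in>M. ?Y j - beta * ?Z)) \<le> (1 + 3 * m) * (\<bar>t\<bar> * L * decay t)"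
    proof -
      have "norm (?x M * (Z A t - ?Z)) \<le> \<bar>t\<bar> * L * decay t"
        using Z_insert_diff order_trans[OF norm_ge_zero Z_insert_diff]
        by (auto simp: norm_minus_commute)
      moreover have "norm (\<Sum>j\<in>M. ?Y j - beta * ?Z) \<le> (\<Sum>j\<in>M. 3 * (\<bar>t\<bar> * L * decay t))"
        using M by (intro order_trans[OF norm_sum] sum_mono jump_cis_approx) auto
      ultimately show ?thesis
        using norm_triangle_ineq[of "?x M * (Z A t - ?Z)" "\<Sum>j\<in>M. ?Y j - beta * ?Z"]
        by (simp add: m_def algebra_simps)
    qed
    have "?T M - Z A t - \<i> * t * (?x M + beta * card M) * ?Z =
       (?T M - Z A t - \<i> * t * (?x M * Z A t + (\<Sum>j\<in>M. ?Y j))) +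
       \<i> * t * (?x M * (Z A t - ?Z) + (\<Sum>j\<in>M. ?Y j - beta * ?Z))"
      by (simp add: sum_subtractf) (simp add: algebra_simps)
    also have "norm \<dots> \<le> D * ((1 + m)\<^sup>2 * exp (C * m)) + \<bar>t\<bar> * ((1 + 3 * m) * (\<bar>t\<bar> * L * decay t))"
    proof (rule order_trans[OF norm_triangle_ineq add_mono[OF 1]])
      show "norm (\<i> * t * (?x M * (Z A t - ?Z) + (\<Sum>j\<in>M. ?Y j - beta * ?Z))) \<le>
          \<bar>t\<bar> * ((1 + 3 * m) * (\<bar>t\<bar> * L * decay t))"
        using mult_left_mono[OF 2, of "\<bar>t\<bar>"] by (simp only: norm_mult) simp
    qed
    also have "\<dots> = D * ((1 + m)\<^sup>2 * exp (C * m)) + D * L * (1 + 3 * m)"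
    proof -
      have "\<bar>t\<bar> * ((1 + 3 * m) * (\<bar>t\<bar> * L * decay t)) = (\<bar>t\<bar> * \<bar>t\<bar>) * decay t * L * (1 + 3 * m)"
        by (simp only: mult_ac)
      then show ?thesis by (simp add: D_def power2_eq_square)
    qed
    also have "\<dots> \<le> (D * (5 * L)) * ((1 + m)\<^sup>2 * exp (C * m))"
    proof -
      define E where "E = (1 + m)\<^sup>2 * exp (C * m)"
      have E0: "0 \<le> E" by (simp add: E_def)
      have "1 + 3 * m \<le> 3 * ((1 + m)\<^sup>2 * 1)" using m by (simp add: power2_eq_square algebra_simps)
      also have "\<dots> \<le> 3 * E" unfolding E_def using C m by (intro mult_left_mono) auto
      finally have "D * L * (1 + 3 * m) \<le> D * L * (3 * E)" using D L_ge_1 by (intro mult_left_mono) auto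
      moreover have "D * E * 1 \<le> D * E * L" using D E0 L_ge_1 by (intro mult_left_mono) auto
      moreover have "0 \<le> D * E * L" using D E0 L_ge_1 by simp
      ultimately have "D * E + D * L * (1 + 3 * m) \<le> 5 * (D * E * L)" by (simp add: mult_ac)
      then show ?thesis by (simp add: E_def mult_ac)
    qed
    finally show ?thesis by (simp add: D_def m_def mult_ac)
  qed
  have "bern_mean p (clique (insert v A)) (\<lambda>S. (of_bool (vdeg S v \<noteq> d) - xbar) * cis (t * off_count d (insert v A) S)) =
      bern_mean p A (\<lambda>M. of_real (?g M) * ?T M)"
    unfolding bern_mean_clique_insert[OF A(1,3)] bern_mean_mult_left[symmetric]
    using A by (intro bern_mean_cong) (simp add: vdeg_insert_new off_count_insert)
  moreover have "bern_mean p A (\<lambda>M. of_real (?g M) * Z A t) = 0"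
    using g0 by (simp only: bern_mean_mult_right bern_mean_of_real) simp
  moreover have "bern_mean p A (\<lambda>M. of_real (?g M * (?x M + beta * card M)) * (\<i> * t * ?Z)) = \<i> * t * kappa * ?Z"
    by (simp only: bern_mean_mult_right bern_mean_of_real kappa) (simp add: mult_ac)
  moreover have "bern_mean p A (\<lambda>M. of_real (?g M) * (?T M - Z A t - \<i> * t * (?x M + beta * card M) * ?Z)) =
      bern_mean p A (\<lambda>M. of_real (?g M) * ?T M) - bern_mean p A (\<lambda>M. of_real (?g M) * Z A t)
      - bern_mean p A (\<lambda>M. of_real (?g M * (?x M + beta * card M)) * (\<i> * t * ?Z))"
    unfolding bern_mean_diff[symmetric] by (intro bern_mean_cong) (simp add: algebra_simps)
  ultimately have eq: "bern_mean p (clique (insert v A)) (\<lambda>S. (of_bool (vdeg S v \<noteq> d) - xbar) * cis (t * off_count d (insert v A) S))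
      - \<i> * t * kappa * ?Z = bern_mean p A (\<lambda>M. of_real (?g M) * (?T M - Z A t - \<i> * t * (?x M + beta * card M) * ?Z))"
    by simp
  have "norm (bern_mean p A (\<lambda>M. of_real (?g M) * (?T M - Z A t - \<i> * t * (?x M + beta * card M) * ?Z))) \<le> bern_mean p A (\<lambda>M. (t\<^sup>2 * (5 * L) * decay t) * ((1 + real (card M))\<^sup>2 * exp (C * card M)))"
  proof (intro norm_bern_mean_le p)
    fix M assume M: "M \<subseteq> A"
    have "\<bar>?g M\<bar> * norm (?T M - Z A t - \<i> * t * (?x M + beta * card M) * ?Z) \<le>
        1 * ((t\<^sup>2 * (5 * L) * decay t) * ((1 + real (card M))\<^sup>2 * exp (C * card M)))"
      by (rule mult_mono[OF abs_centred_le err[OF M]]) simp_all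
    then show "norm (of_real (?g M) * (?T M - Z A t - \<i> * t * (?x M + beta * card M) * ?Z)) \<le>
        (t\<^sup>2 * (5 * L) * decay t) * ((1 + real (card M))\<^sup>2 * exp (C * card M))"
      by (simp only: norm_mult norm_of_real mult_1)
  qed
  also have "\<dots> = (t\<^sup>2 * (5 * L) * decay t) * bern_mean p A (\<lambda>M. (1 + real (card M))\<^sup>2 * exp (C * card M))"
    by (rule bern_mean_mult_left)
  also have "\<dots> \<le> (t\<^sup>2 * (5 * L) * decay t) * L"
    by (rule mult_left_mono[OF bern_mean_exp_card_le[OF A(1) cA(2)]]) (use decay_pos[of t] L_ge_1 in simp)
  finally show ?thesis unfolding eq by (simp only: power2_eq_square mult_ac)
qed

end

end

section \<open>The characteristic function of the count\<close>

lemma eq_zero_if_abs_le_mult: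
  fixes a :: real
  assumes "\<And>t. 0 < t \<Longrightarrow> t \<le> 1 \<Longrightarrow> \<bar>a\<bar> \<le> B * t"
  shows "a = 0"
proof (rule ccontr)
  assume a: "a \<noteq> 0"
  have B: "\<bar>a\<bar> \<le> B" using assms[of 1] by simp
  then have B0: "0 < B" using a by linarith
  have "\<bar>a\<bar> \<le> B * (\<bar>a\<bar> / (2 * B))"
    using a B B0 by (intro assms) (auto simp: field_simps)
  then show False using a B0 by (simp add: field_simps)
qed

context smoothed_graph
begin

abbreviation G :: "nat set set" where "G \<equiv> clique {..<n}"

abbreviation X :: "nat set set \<Rightarrow> real" where "X \<equiv> off_count d {..<n}"

definition mu :: real where "mu = bern_mean p G X"

definition sigma2 :: real where "sigma2 = bern_mean p G (\<lambda>S. (X S - mu)\<^sup>2)"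

lemma insert_vertex:
  assumes "v < n"
  shows "insert v ({..<n} - {v}) = {..<n}" "card ({..<n} - {v}) = n - 1"
  using assms by auto

lemma finite_G: "finite G" by (intro finite_clique) auto

lemma bern_mean_vertex: "v < n \<Longrightarrow> bern_mean p G (\<lambda>S. of_bool (vdeg S v \<noteq> d)) = xbar"
proof -
  assume v: "v < n"
  let ?A = "{..<n} - {v}"
  have "bern_mean p (clique (insert v ?A)) (\<lambda>S. of_bool (vdeg S v \<noteq> d) :: real) =
      bern_mean p ?A (\<lambda>M. bern_mean p (clique ?A) (\<lambda>S. of_bool (vdeg (S \<union> (\<lambda>j. {v, j}) ` M) v \<noteq> d)))"
    by (rule bern_mean_clique_insert) auto
  also have "\<dots> = bern_mean p ?A (\<lambda>M. bern_mean p (clique ?A) (\<lambda>S. of_bool (card M \<noteq> d)))"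
    by (intro bern_mean_cong) (simp add: vdeg_insert_new[of _ ?A])
  also have "\<dots> = bern_mean p ?A (\<lambda>M. of_bool (card M \<noteq> d))"
    by (intro bern_mean_cong bern_mean_const finite_clique) auto
  also have "\<dots> = xbar"
    unfolding xbar_def using insert_vertex[OF v] by (intro bern_mean_card_cong) auto
  finally show ?thesis using insert_vertex[OF v] by simp
qed

lemma mu_eq: "mu = n * xbar"
  unfolding mu_def off_count_def bern_mean_sum by (simp add: bern_mean_vertex del: of_bool_eq_0_iff sum_of_bool_eq)

lemma centred_eq: "X S - mu = (\<Sum>v<n. of_bool (vdeg S v \<noteq> d) - xbar)"
  by (simp add: mu_eq off_count_def sum_subtractf)

lemma bern_mean_centred: "bern_mean p G (\<lambda>S. X S - mu) = 0"
  using finite_G by (simp add: bern_mean_diff bern_mean_const mu_def)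

lemma norm_Z_le: "\<bar>t::real\<bar> \<le> pi \<Longrightarrow> norm (Z {..<n} t) \<le> decay t"
  using smooth_degrees[of "{..<n}" "{}" t "\<lambda>_. 1" 1] by (simp add: Z_def)

text \<open>Rotated by \<open>cis (- (t * mu))\<close>, the first mean is \<open>- \<i>\<close>
  times the derivative of the centred characteristic function. This is the differential inequality
  before its coefficient is identified.\<close>

lemma centred_cis_approx_kappa:
  fixes t :: real
  assumes t: "\<bar>t\<bar> \<le> pi"
  shows "norm (bern_mean p G (\<lambda>S. (X S - mu) * cis (t * X S)) - \<i> * t * (n * kappa) * Z {..<n} t)
    \<le> n * (t\<^sup>2 * (5 * L\<^sup>2) * decay t)"
proof -
  let ?h = "\<lambda>v. bern_mean p G (\<lambda>S. (of_bool (vdeg S v \<noteq> d) - xbar) * cis (t * X S)) - \<i> * t * kappa * Z {..<n} t"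
  have "bern_mean p G (\<lambda>S. (X S - mu) * cis (t * X S)) =
      (\<Sum>v<n. bern_mean p G (\<lambda>S. (of_bool (vdeg S v \<noteq> d) - xbar) * cis (t * X S)))"
    unfolding centred_eq bern_mean_sum[symmetric] by (simp add: sum_distrib_right)
  then have "bern_mean p G (\<lambda>S. (X S - mu) * cis (t * X S)) - \<i> * t * (n * kappa) * Z {..<n} t = (\<Sum>v<n. ?h v)"
    by (simp add: sum_subtractf mult_ac)
  moreover have "norm (\<Sum>v<n. ?h v) \<le> (\<Sum>v<n. t\<^sup>2 * (5 * L\<^sup>2) * decay t)"
  proof (intro order_trans[OF norm_sum] sum_mono)
    fix v assume "v \<in> {..<n}"
    then have v: "v < n" by simp
    show "norm (?h v) \<le> t\<^sup>2 * (5 * L\<^sup>2) * decay t"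
      using vertex_removal_order_one[of "{..<n} - {v}" v t] t insert_vertex[OF v] by simp
  qed
  ultimately show ?thesis by simp
qed

text \<open>For fixed \<open>n\<close> the mean of \<open>m S * cis (t * m S)\<close> is
  \<open>\<i> * t * sigma2\<close> up to a multiple of \<open>t^2\<close> by direct expansion, and
  \<open>\<i> * t * n * kappa\<close> up to a multiple of \<open>t^2\<close> by the inequality
  above. Dividing by \<open>t\<close> and letting \<open>t\<close> tend to 0 equates the
  coefficients.\<close>

lemma sigma2_eq: "sigma2 = n * kappa"
proof -
  define m where "m S = X S - mu" for S
  define B where "B = bern_mean p G (\<lambda>S. \<bar>m S\<bar> * (m S)\<^sup>2) + n * \<bar>kappa\<bar> * bern_mean p G (\<lambda>S. \<bar>m S\<bar>) + n * (5 * L\<^sup>2)"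
  have "\<bar>sigma2 - n * kappa\<bar> \<le> B * t" if t: "0 < t" "t \<le> 1" for t :: real
  proof -
    have tpi: "\<bar>t\<bar> \<le> pi" using t pi_ge_two by linarith
    let ?e = "cis (- (t * mu))"
    have shift: "cis (t * X S) * ?e = cis (t * m S)" for S
      by (simp add: cis_mult m_def algebra_simps)
    have 1: "norm (bern_mean p G (\<lambda>S. m S * cis (t * m S)) - \<i> * t * (n * kappa) * bern_mean p G (\<lambda>S. cis (t * m S)))
        \<le> n * (t\<^sup>2 * (5 * L\<^sup>2))"
    proof -
      have "bern_mean p G (\<lambda>S. m S * cis (t * m S)) - \<i> * t * (n * kappa) * bern_mean p G (\<lambda>S. cis (t * m S)) =
         (bern_mean p G (\<lambda>S. m S * cis (t * X S)) - \<i> * t * (n * kappa) * Z {..<n} t) * ?e"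
        by (simp only: Z_def p_def left_diff_distrib mult.assoc bern_mean_mult_right[symmetric] shift)
      then have "norm (bern_mean p G (\<lambda>S. m S * cis (t * m S)) - \<i> * t * (n * kappa) * bern_mean p G (\<lambda>S. cis (t * m S)))
         = norm (bern_mean p G (\<lambda>S. m S * cis (t * X S)) - \<i> * t * (n * kappa) * Z {..<n} t)"
        by (simp add: norm_mult)
      also have "\<dots> \<le> n * (t\<^sup>2 * (5 * L\<^sup>2) * decay t)"
        unfolding m_def by (rule centred_cis_approx_kappa[OF tpi])
      also have "\<dots> \<le> n * (t\<^sup>2 * (5 * L\<^sup>2) * 1)"
        using c by (intro mult_left_mono) (auto simp: decay_def)
      finally show ?thesis by simp
    qed
    have 2: "norm (bern_mean p G (\<lambda>S. m S * cis (t * m S)) - \<i> * t * sigma2) \<le> t\<^sup>2 * bern_mean p G (\<lambda>S. \<bar>m S\<bar> * (m S)\<^sup>2)"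
    proof -
      have "bern_mean p G (\<lambda>S. of_real (m S)) = (0 :: complex)"
        unfolding bern_mean_of_real m_def bern_mean_centred by simp
      moreover have "bern_mean p G (\<lambda>S. of_real ((m S)\<^sup>2)) = complex_of_real sigma2"
        unfolding bern_mean_of_real by (simp add: m_def sigma2_def)
      ultimately have "bern_mean p G (\<lambda>S. m S * cis (t * m S)) - \<i> * t * sigma2 =
         bern_mean p G (\<lambda>S. m S * cis (t * m S)) - bern_mean p G (\<lambda>S. of_real (m S))
          - \<i> * t * bern_mean p G (\<lambda>S. of_real ((m S)\<^sup>2))" by simp
      also have "\<dots> = bern_mean p G (\<lambda>S. m S * (cis (t * m S) - 1 - \<i> * (t * m S)))"
        unfolding bern_mean_mult_left[symmetric] bern_mean_diff[symmetric]
        by (intro bern_mean_cong) (simp add: algebra_simps power2_eq_square)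
      finally have eq: "bern_mean p G (\<lambda>S. m S * cis (t * m S)) - \<i> * t * sigma2 =
          bern_mean p G (\<lambda>S. m S * (cis (t * m S) - 1 - \<i> * (t * m S)))" .
      have "norm (bern_mean p G (\<lambda>S. m S * (cis (t * m S) - 1 - \<i> * (t * m S)))) \<le>
          bern_mean p G (\<lambda>S. t\<^sup>2 * (\<bar>m S\<bar> * (m S)\<^sup>2))"
      proof (intro norm_bern_mean_le p)
        fix S
        have "norm (cis (t * m S) - 1 - \<i> * (t * m S)) \<le> (t * m S)\<^sup>2"
          using norm_cis_taylor_one_le[of "t * m S"] zero_le_power2[of "t * m S"] by linarith
        then have "\<bar>m S\<bar> * norm (cis (t * m S) - 1 - \<i> * (t * m S)) \<le> \<bar>m S\<bar> * (t * m S)\<^sup>2"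
          by (intro mult_left_mono) auto
        then show "norm (m S * (cis (t * m S) - 1 - \<i> * (t * m S))) \<le> t\<^sup>2 * (\<bar>m S\<bar> * (m S)\<^sup>2)"
          by (simp add: norm_mult power_mult_distrib mult_ac)
      qed
      then show ?thesis by (simp only: eq bern_mean_mult_left)
    qed
    have 3: "norm (bern_mean p G (\<lambda>S. cis (t * m S)) - 1) \<le> t * bern_mean p G (\<lambda>S. \<bar>m S\<bar>)"
    proof -
      have "bern_mean p G (\<lambda>S. cis (t * m S)) - 1 = bern_mean p G (\<lambda>S. cis (t * m S) - 1)"
        using finite_G by (simp add: bern_mean_diff bern_mean_const)
      moreover have "norm (bern_mean p G (\<lambda>S. cis (t * m S) - 1)) \<le> bern_mean p G (\<lambda>S. t * \<bar>m S\<bar>)"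
        using t norm_cis_minus_one_le[of "t * m _"] by (intro norm_bern_mean_le p) (simp add: abs_mult)
      ultimately show ?thesis by (simp add: bern_mean_mult_left)
    qed
    let ?E = "bern_mean p G (\<lambda>S. m S * cis (t * m S))" and ?C = "bern_mean p G (\<lambda>S. cis (t * m S))"
    have "t * \<bar>sigma2 - n * kappa\<bar> = norm (\<i> * t * of_real (sigma2 - n * kappa))"
      using t by (simp only: norm_mult norm_of_real) simp
    also have "\<i> * t * of_real (sigma2 - n * kappa) =
        (?E - \<i> * t * (n * kappa) * ?C) - (?E - \<i> * t * sigma2) + \<i> * t * (n * kappa) * (?C - 1)"
      by (simp add: algebra_simps)
    also have "norm \<dots> \<le> n * (t\<^sup>2 * (5 * L\<^sup>2)) + t\<^sup>2 * bern_mean p G (\<lambda>S. \<bar>m S\<bar> * (m S)\<^sup>2)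
        + t * (n * \<bar>kappa\<bar>) * (t * bern_mean p G (\<lambda>S. \<bar>m S\<bar>))"
    proof (rule order_trans[OF norm_triangle_ineq add_mono[OF order_trans[OF norm_triangle_ineq4 add_mono[OF 1 2]]]])
      have "norm (\<i> * t * (n * kappa) * (?C - 1)) = t * (n * \<bar>kappa\<bar>) * norm (?C - 1)"
        using t by (simp add: norm_mult)
      also have "\<dots> \<le> t * (n * \<bar>kappa\<bar>) * (t * bern_mean p G (\<lambda>S. \<bar>m S\<bar>))"
        using t 3 by (intro mult_left_mono) auto
      finally show "norm (\<i> * t * (n * kappa) * (?C - 1)) \<le> t * (n * \<bar>kappa\<bar>) * (t * bern_mean p G (\<lambda>S. \<bar>m S\<bar>))" .
    qed
    also have "\<dots> = t * (B * t)"
      by (simp add: B_def power2_eq_square algebra_simps)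
    finally show ?thesis using t by simp
  qed
  then have "sigma2 - n * kappa = 0" by (rule eq_zero_if_abs_le_mult)
  then show ?thesis by simp
qed

lemma sigma2_le: "sigma2 \<le> L * n"
  using abs_kappa_le mult_left_mono[of kappa L "real n"] by (simp add: sigma2_eq mult_ac)

lemma centred_cis_approx:
  fixes t :: real
  assumes t: "\<bar>t\<bar> \<le> pi"
  shows "norm (bern_mean p G (\<lambda>S. (X S - mu) * cis (t * (X S - mu))) - \<i> * t * sigma2 * bern_mean p G (\<lambda>S. cis (t * (X S - mu))))
    \<le> 5 * L\<^sup>2 * (n * t\<^sup>2 * decay t)"
    and "norm (bern_mean p G (\<lambda>S. cis (t * (X S - mu)))) \<le> decay t"
proof -
  let ?e = "cis (- (t * mu))"
  have shift: "cis (t * X S) * ?e = cis (t * (X S - mu))" for S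
    by (simp add: cis_mult algebra_simps)
  have C: "bern_mean p G (\<lambda>S. cis (t * (X S - mu))) = Z {..<n} t * ?e"
    by (simp only: Z_def bern_mean_mult_right[symmetric] shift)
  then show "norm (bern_mean p G (\<lambda>S. cis (t * (X S - mu)))) \<le> decay t"
    using norm_Z_le[OF t] by (simp add: norm_mult)
  have "bern_mean p G (\<lambda>S. (X S - mu) * cis (t * (X S - mu))) - \<i> * t * sigma2 * bern_mean p G (\<lambda>S. cis (t * (X S - mu))) =
     (bern_mean p G (\<lambda>S. (X S - mu) * cis (t * X S)) - \<i> * t * (n * kappa) * Z {..<n} t) * ?e"
    by (simp only: C sigma2_eq left_diff_distrib mult.assoc bern_mean_mult_right[symmetric] shift of_real_mult of_real_of_nat_eq)
  then have "norm (bern_mean p G (\<lambda>S. (X S - mu) * cis (t * (X S - mu))) - \<i> * t * sigma2 * bern_mean p G (\<lambda>S. cis (t * (X S - mu))))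
     \<le> n * (t\<^sup>2 * (5 * L\<^sup>2) * decay t)"
    using centred_cis_approx_kappa[OF t] by (simp add: norm_mult)
  then show "norm (bern_mean p G (\<lambda>S. (X S - mu) * cis (t * (X S - mu))) - \<i> * t * sigma2 * bern_mean p G (\<lambda>S. cis (t * (X S - mu))))
    \<le> 5 * L\<^sup>2 * (n * t\<^sup>2 * decay t)" by (simp add: mult_ac)
qed

text \<open>At \<open>t = 1 / sqrt (c * n)\<close> smoothing bounds the characteristic function by
  \<open>exp (- 1)\<close>, while its distance from 1 is at most \<open>t^2 * sigma2 / 2\<close>. A
  smaller variance would contradict the triangle inequality.\<close>

lemma sigma2_ge:
  assumes "1 \<le> c * n"
  shows "c * n \<le> sigma2"
proof -
  define t where "t = 1 / sqrt (c * n)"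
  have cn: "0 < c * n" using assms by linarith
  then have t0: "0 < t" by (simp add: t_def)
  have t2: "t\<^sup>2 = 1 / (c * n)" using cn by (simp add: t_def power_divide)
  have "t \<le> 1" using assms by (simp add: t_def)
  then have tpi: "\<bar>t\<bar> \<le> pi" using t0 pi_ge_two by linarith
  let ?m = "\<lambda>S. X S - mu"
  have "norm (bern_mean p G (\<lambda>S. cis (t * ?m S)) - 1) \<le> t\<^sup>2 * sigma2 / 2"
  proof -
    have "bern_mean p G (\<lambda>S. of_real (?m S)) = (0 :: complex)"
      unfolding bern_mean_of_real bern_mean_centred by simp
    then have "bern_mean p G (\<lambda>S. cis (t * ?m S)) - 1 =
        bern_mean p G (\<lambda>S. cis (t * ?m S)) - bern_mean p G (\<lambda>_. 1) - \<i> * t * bern_mean p G (\<lambda>S. of_real (?m S))"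
      using finite_G by (simp add: bern_mean_const)
    also have "\<dots> = bern_mean p G (\<lambda>S. cis (t * ?m S) - 1 - \<i> * (t * ?m S))"
      unfolding bern_mean_mult_left[symmetric] bern_mean_diff[symmetric]
      by (intro bern_mean_cong) (simp add: algebra_simps)
    finally have eq: "bern_mean p G (\<lambda>S. cis (t * ?m S)) - 1 = bern_mean p G (\<lambda>S. cis (t * ?m S) - 1 - \<i> * (t * ?m S))" .
    have "norm (bern_mean p G (\<lambda>S. cis (t * ?m S) - 1 - \<i> * (t * ?m S))) \<le> bern_mean p G (\<lambda>S. t\<^sup>2 / 2 * (?m S)\<^sup>2)"
    proof (intro norm_bern_mean_le p)
      fix S
      show "norm (cis (t * ?m S) - 1 - \<i> * (t * ?m S)) \<le> t\<^sup>2 / 2 * (?m S)\<^sup>2"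
        using norm_cis_taylor_one_le[of "t * ?m S"] by (simp add: power_mult_distrib)
    qed
    then show ?thesis by (simp only: eq bern_mean_mult_left sigma2_def)
  qed
  moreover have "1 \<le> norm (bern_mean p G (\<lambda>S. cis (t * ?m S)) - 1) + norm (bern_mean p G (\<lambda>S. cis (t * ?m S)))"
    using norm_triangle_ineq4[of "bern_mean p G (\<lambda>S. cis (t * ?m S))" "bern_mean p G (\<lambda>S. cis (t * ?m S)) - 1"]
    by simp
  moreover have "norm (bern_mean p G (\<lambda>S. cis (t * ?m S))) \<le> 1 / 2"
  proof -
    have "decay t = exp (- 1)" using c n_pos by (simp add: decay_def t2)
    also have "\<dots> \<le> 1 / 2" using exp_ge_add_one_self[of 1] by (simp add: exp_minus field_simps)
    finally show ?thesis using centred_cis_approx(2)[OF tpi] by linarith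
  qed
  ultimately have "1 \<le> t\<^sup>2 * sigma2" by linarith
  then show ?thesis using cn unfolding t2 by (simp add: le_divide_eq)
qed

end

section \<open>Fourier inversion and Bessel's inequality\<close>

lemma lint_cis_int:
  fixes k :: int
  shows "(LINT t:{-pi..pi}|lborel. cis (t * k)) = (if k = 0 then 2 * pi else 0)"
proof -
  have int: "set_integrable lborel {-pi..pi} (\<lambda>t. cis (t * k))"
    by (intro borel_integrable_atLeastAtMost' continuous_intros)
  show ?thesis
  proof (cases "k = 0")
    case True
    have "(LINT t:{-pi..pi}|lborel. (1::complex)) = integral {-pi..pi} (\<lambda>_. 1)"
      using int True by (intro set_borel_integral_eq_integral) simp
    then show ?thesis using True by (simp add: scaleR_conv_of_real)
  next
    case False
    have "((\<lambda>t. cis (t * k)) has_integral cis (pi * k) / (\<i> * k) - cis (- pi * k) / (\<i> * k)) {-pi..pi}"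
    proof (rule fundamental_theorem_of_calculus)
      fix x :: real
      have "((\<lambda>z. exp (\<i> * (z * complex_of_int k)) / (\<i> * complex_of_int k)) has_field_derivative exp (\<i> * (complex_of_real x * complex_of_int k))) (at (complex_of_real x))"
        using False by (auto intro!: derivative_eq_intros) (simp add: mult_ac)
      then have "((\<lambda>t. exp (\<i> * (complex_of_real t * complex_of_int k)) / (\<i> * complex_of_int k)) has_vector_derivative exp (\<i> * (complex_of_real x * complex_of_int k))) (at x within {-pi..pi})"
        by (rule has_vector_derivative_real_field)
      then show "((\<lambda>t. cis (t * k) / (\<i> * k)) has_vector_derivative cis (x * k)) (at x within {-pi..pi})"
        by (simp add: cis_conv_exp)
    qed simp
    moreover have "cis (pi * k) = cis (- pi * k)"
    proof -
      have "sin (pi * of_int k) = 0" by (rule sin_npi_int)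
      then show ?thesis by (simp add: complex_eq_iff)
    qed
    ultimately have "integral {-pi..pi} (\<lambda>t. cis (t * k)) = 0"
      by (simp add: integral_unique)
    then show ?thesis using False set_borel_integral_eq_integral(2)[OF int] by simp
  qed
qed

text \<open>Fourier inversion with a weight: Fubini reduces it to the orthogonality of the
  characters. The weights 1 and \<open>x - mu\<close> serve the characteristic function and its
  derivative.\<close>

lemma pmf_fourier_coeff:
  fixes P :: "int pmf" and w :: "int \<Rightarrow> real" and mu :: real
  assumes w: "integrable (measure_pmf P) w"
  shows "(LINT t:{-pi..pi}|lborel.
      measure_pmf.expectation P (\<lambda>x. w x * cis (t * (x - mu))) * cis (- (t * (a - mu)))) = 2 * pi * w a * pmf P a"
proof -
  define \<nu> where "\<nu> = restrict_space lborel {-pi..pi}"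
  interpret \<nu>: finite_measure \<nu>
    unfolding \<nu>_def by (intro finite_measureI) (simp add: space_restrict_space emeasure_restrict_space)
  interpret pair_sigma_finite "measure_pmf P" \<nu> ..
  define f where "f x t = of_real (w x) * cis (t * (x - a))" for x :: int and t :: real
  have meas: "case_prod f \<in> borel_measurable (measure_pmf P \<Otimes>\<^sub>M \<nu>)"
  proof -
    have m: "case_prod f \<in> borel_measurable (count_space UNIV \<Otimes>\<^sub>M \<nu>)"
    proof (rule measurable_pair_measure_countable1)
      fix x :: int
      have "(\<lambda>t. f x t) \<in> borel_measurable borel"
        unfolding f_def by (intro borel_measurable_continuous_onI continuous_intros)
      then show "(\<lambda>y. case_prod f (x, y)) \<in> borel_measurable \<nu>"
        unfolding \<nu>_def by (simp add: measurable_restrict_space1)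
    qed simp
    have sets: "sets (measure_pmf P \<Otimes>\<^sub>M \<nu>) = sets (count_space UNIV \<Otimes>\<^sub>M \<nu>)"
      by (intro sets_pair_measure_cong) auto
    show ?thesis unfolding measurable_cong_sets[OF sets refl] by (rule m)
  qed
  have int: "integrable (measure_pmf P \<Otimes>\<^sub>M \<nu>) (case_prod f)"
  proof (rule Fubini_integrable[OF meas])
    show "integrable (measure_pmf P) (\<lambda>x. \<integral>y. norm (case_prod f (x, y)) \<partial>\<nu>)"
      using w by (simp add: f_def norm_mult)
    have "integrable \<nu> (\<lambda>y. f x y)" for x
    proof (rule \<nu>.integrable_const_bound[of _ "\<bar>w x\<bar>"])
      show "(\<lambda>y. f x y) \<in> borel_measurable \<nu>"
        unfolding \<nu>_def f_def
        by (intro measurable_restrict_space1) (simp add: borel_measurable_continuous_onI continuous_intros)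
    qed (simp add: f_def norm_mult)
    then show "AE x in measure_pmf P. integrable \<nu> (\<lambda>y. case_prod f (x, y))" by simp
  qed
  have lint: "(\<integral>t. g t \<partial>\<nu>) = (LINT t:{-pi..pi}|lborel. g t)" for g :: "real \<Rightarrow> complex"
    unfolding \<nu>_def set_lebesgue_integral_def by (rule integral_restrict_space) simp
  have "(LINT t:{-pi..pi}|lborel.
      measure_pmf.expectation P (\<lambda>x. w x * cis (t * (x - mu))) * cis (- (t * (a - mu)))) =
      (\<integral>t. \<integral>x. f x t \<partial>measure_pmf P \<partial>\<nu>)"
    unfolding lint
  proof (intro arg_cong[of _ _ "set_lebesgue_integral lborel {-pi..pi}"] ext)
    fix t
    have "measure_pmf.expectation P (\<lambda>x. w x * cis (t * (x - mu))) * cis (- (t * (a - mu))) =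
        measure_pmf.expectation P (\<lambda>x. w x * cis (t * (x - mu)) * cis (- (t * (a - mu))))"
      by simp
    also have "\<dots> = measure_pmf.expectation P (\<lambda>x. f x t)"
      by (simp add: f_def mult.assoc cis_mult algebra_simps)
    finally show "measure_pmf.expectation P (\<lambda>x. w x * cis (t * (x - mu))) * cis (- (t * (a - mu))) =
      measure_pmf.expectation P (\<lambda>x. f x t)" .
  qed
  also have "\<dots> = (\<integral>x. \<integral>t. f x t \<partial>\<nu> \<partial>measure_pmf P)"
    by (rule Fubini_integral[OF int])
  also have "\<dots> = (\<integral>x. of_real (w a * 2 * pi) * indicator {a} x \<partial>measure_pmf P)"
  proof (intro Bochner_Integration.integral_cong refl)
    fix x
    have "(\<integral>t. f x t \<partial>\<nu>) = of_real (w x) * (LINT t:{-pi..pi}|lborel. cis (t * of_int (x - a)))"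
      by (simp add: f_def lint)
    also have "\<dots> = of_real (w a * 2 * pi) * indicator {a} x"
      unfolding lint_cis_int by (auto simp: indicator_def)
    finally show "(\<integral>t. f x t \<partial>\<nu>) = of_real (w a * 2 * pi) * indicator {a} x" .
  qed
  also have "\<dots> = complex_of_real (2 * pi * w a * pmf P a)"
  proof -
    have "(\<lambda>x. complex_of_real (w a * 2 * pi) * indicator {a} x) = (\<lambda>x. complex_of_real (w a * 2 * pi * indicat_real {a} x))"
      by (auto simp: indicator_def)
    moreover have "measure_pmf.expectation P (indicat_real {a}) = pmf P a"
      by (simp add: measure_pmf_single)
    ultimately show ?thesis by simp
  qed
  finally show ?thesis .
qed

text \<open>With \<open>T\<close> the partial Fourier sum, expand the nonnegative integral of
  \<open>(norm (F t - T t))^2\<close>; the mixed terms and the square of \<open>T\<close> all equal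
  \<open>2 * pi * S\<close>.\<close>

lemma bessel_inequality:
  fixes g :: "int \<Rightarrow> real" and F :: "real \<Rightarrow> complex" and mu :: real
  assumes "finite A" and F: "continuous_on {-pi..pi} F"
    and coeff: "\<And>a. a \<in> A \<Longrightarrow> (LINT t:{-pi..pi}|lborel. F t * cis (- (t * (a - mu)))) = 2 * pi * g a"
  shows "2 * pi * (\<Sum>a\<in>A. (g a)\<^sup>2) \<le> (LINT t:{-pi..pi}|lborel. (norm (F t))\<^sup>2)"
proof -
  let ?I = "\<lambda>h. (LINT t:{-pi..pi}|lborel. (h t :: complex))"
  define T where "T t = (\<Sum>a\<in>A. g a * cis (t * (a - mu)))" for t
  define S where "S = (\<Sum>a\<in>A. (g a)\<^sup>2)"
  have T: "continuous_on {-pi..pi} T" unfolding T_def by (intro continuous_intros)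
  have int: "set_integrable lborel {-pi..pi} h" if "continuous_on {-pi..pi} h" for h :: "real \<Rightarrow> complex"
    using that by (rule borel_integrable_atLeastAtMost')
  have cnjT: "cnj (T t) = (\<Sum>a\<in>A. g a * cis (- (t * (a - mu))))" for t
    by (simp add: T_def cis_cnj)
  have pair: "?I (\<lambda>t. H t * cnj (T t)) = 2 * pi * S"
    if H: "continuous_on {-pi..pi} H" and
      c: "\<And>a. a \<in> A \<Longrightarrow> ?I (\<lambda>t. H t * cis (- (t * (a - mu)))) = 2 * pi * g a" for H
  proof -
    have "?I (\<lambda>t. H t * cnj (T t)) = ?I (\<lambda>t. \<Sum>a\<in>A. g a * (H t * cis (- (t * (a - mu)))))"
      unfolding cnjT by (simp add: sum_distrib_left mult_ac)
    also have "\<dots> = (\<Sum>a\<in>A. ?I (\<lambda>t. g a * (H t * cis (- (t * (a - mu))))))"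
      unfolding set_lebesgue_integral_def scaleR_sum_right
    proof (rule Bochner_Integration.integral_sum)
      fix a assume "a \<in> A"
      have "set_integrable lborel {-pi..pi} (\<lambda>t. g a * (H t * cis (- (t * (a - mu)))))"
        using H by (intro int continuous_intros)
      then show "integrable lborel (\<lambda>x. indicat_real {- pi..pi} x *\<^sub>R (g a * (H x * cis (- (x * (a - mu))))))"
        by (simp add: set_integrable_def)
    qed
    also have "\<dots> = (\<Sum>a\<in>A. g a * (2 * pi * g a))"
      using c by simp
    finally show ?thesis by (simp add: S_def sum_distrib_left power2_eq_square mult_ac)
  qed
  have TT: "?I (\<lambda>t. T t * cis (- (t * (a - mu)))) = 2 * pi * g a" if "a \<in> A" for a
  proof -
    have "?I (\<lambda>t. T t * cis (- (t * (a - mu)))) = ?I (\<lambda>t. \<Sum>b\<in>A. g b * cis (t * of_int (b - a)))"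
    proof (intro arg_cong[of _ _ "set_lebesgue_integral lborel {-pi..pi}"] ext)
      fix t
      have "cis (t * (b - mu)) * cis (- (t * (a - mu))) = cis (t * of_int (b - a))" for b
        by (simp add: cis_mult algebra_simps)
      then show "T t * cis (- (t * (a - mu))) = (\<Sum>b\<in>A. g b * cis (t * of_int (b - a)))"
        by (simp add: T_def sum_distrib_right mult.assoc del: of_int_diff)
    qed
    also have "\<dots> = (\<Sum>b\<in>A. ?I (\<lambda>t. g b * cis (t * of_int (b - a))))"
      unfolding set_lebesgue_integral_def scaleR_sum_right
    proof (rule Bochner_Integration.integral_sum)
      fix b assume "b \<in> A"
      have "set_integrable lborel {-pi..pi} (\<lambda>t. g b * cis (t * of_int (b - a)))"
        by (intro int continuous_intros)
      then show "integrable lborel (\<lambda>t. indicat_real {- pi..pi} t *\<^sub>R (g b * cis (t * of_int (b - a))))"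
        by (simp add: set_integrable_def)
    qed
    also have "\<dots> = (\<Sum>b\<in>A. if b = a then complex_of_real (2 * pi * g a) else 0)"
      by (intro sum.cong refl) (use lint_cis_int in \<open>auto simp del: of_int_diff\<close>)
    finally show ?thesis using that assms(1) by simp
  qed
  have 1: "?I (\<lambda>t. F t * cnj (T t)) = 2 * pi * S" by (rule pair[OF F coeff])
  have 2: "?I (\<lambda>t. T t * cnj (T t)) = 2 * pi * S" by (rule pair[OF T TT])
  have eq: "of_real ((norm (F t - T t))\<^sup>2) = of_real ((norm (F t))\<^sup>2) - F t * cnj (T t) - cnj (F t * cnj (T t)) + T t * cnj (T t)" for t
    by (simp add: complex_norm_square algebra_simps del: of_real_power)
  have i1: "set_integrable lborel {-pi..pi} (\<lambda>t. of_real ((norm (F t))\<^sup>2) :: complex)"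
    using F by (intro int continuous_intros)
  have i2: "set_integrable lborel {-pi..pi} (\<lambda>t. F t * cnj (T t))"
    "set_integrable lborel {-pi..pi} (\<lambda>t. cnj (F t * cnj (T t)))"
    "set_integrable lborel {-pi..pi} (\<lambda>t. T t * cnj (T t))"
    using F T by (intro int continuous_intros; simp)+
  have cnj: "?I (\<lambda>t. cnj (F t * cnj (T t))) = cnj (?I (\<lambda>t. F t * cnj (T t)))"
    unfolding set_lebesgue_integral_def Bochner_Integration.integral_cnj[symmetric]
    by (intro Bochner_Integration.integral_cong refl) (auto simp: indicator_def)
  have "complex_of_real (LINT t:{-pi..pi}|lborel. (norm (F t - T t))\<^sup>2) =
      ?I (\<lambda>t. of_real ((norm (F t))\<^sup>2) - F t * cnj (T t) - cnj (F t * cnj (T t)) + T t * cnj (T t))"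
    by (simp only: set_integral_complex_of_real[symmetric] eq)
  also have "\<dots> = ?I (\<lambda>t. of_real ((norm (F t))\<^sup>2)) - ?I (\<lambda>t. F t * cnj (T t))
      - ?I (\<lambda>t. cnj (F t * cnj (T t))) + ?I (\<lambda>t. T t * cnj (T t))"
    by (simp only: set_integral_add(2) set_integral_diff(2) set_integral_diff(1) i1 i2)
  also have "\<dots> = complex_of_real ((LINT t:{-pi..pi}|lborel. (norm (F t))\<^sup>2) - 2 * pi * S)"
    unfolding cnj 1 2 set_integral_complex_of_real by simp
  finally have "(LINT t:{-pi..pi}|lborel. (norm (F t - T t))\<^sup>2) =
      (LINT t:{-pi..pi}|lborel. (norm (F t))\<^sup>2) - 2 * pi * S"
    by (simp only: of_real_eq_iff)
  moreover have "0 \<le> (LINT t:{-pi..pi}|lborel. (norm (F t - T t))\<^sup>2)"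
    unfolding set_lebesgue_integral_def by (intro Bochner_Integration.integral_nonneg) auto
  ultimately show ?thesis by (simp add: S_def)
qed

text \<open>The Gaussian bounds are later relaxed to this kernel, whose primitive is an
  arctangent.\<close>

lemma lint_cauchy_kernel_le:
  fixes s :: real
  assumes "0 < s"
  shows "(LINT t:{-pi..pi}|lborel. 1 / (1 + s\<^sup>2 * t\<^sup>2)) \<le> pi / s"
proof -
  have pos: "1 + s\<^sup>2 * t\<^sup>2 > 0" for t by (simp add: add_pos_nonneg)
  have int: "set_integrable lborel {-pi..pi} (\<lambda>t. 1 / (1 + s\<^sup>2 * t\<^sup>2))"
    using pos by (intro borel_integrable_atLeastAtMost' continuous_intros) (metis less_irrefl)
  have "((\<lambda>t. 1 / (1 + s\<^sup>2 * t\<^sup>2)) has_integral arctan (s * pi) / s - arctan (s * (- pi)) / s) {-pi..pi}"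
  proof (rule fundamental_theorem_of_calculus)
    fix x :: real
    have "((\<lambda>t. arctan (s * t) / s) has_real_derivative 1 / (1 + s\<^sup>2 * x\<^sup>2)) (at x within {-pi..pi})"
      using assms by (auto intro!: derivative_eq_intros simp: power_mult_distrib inverse_eq_divide)
    then show "((\<lambda>t. arctan (s * t) / s) has_vector_derivative 1 / (1 + s\<^sup>2 * x\<^sup>2)) (at x within {-pi..pi})"
      by (simp add: has_real_derivative_iff_has_vector_derivative)
  qed simp
  then have "(LINT t:{-pi..pi}|lborel. 1 / (1 + s\<^sup>2 * t\<^sup>2)) = arctan (s * pi) / s - arctan (s * (- pi)) / s"
    using set_borel_integral_eq_integral(2)[OF int] by (simp add: integral_unique)
  also have "\<dots> = 2 * arctan (s * pi) / s" by (simp add: arctan_minus)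
  also have "\<dots> \<le> pi / s"
    using assms arctan_ubound[of "s * pi"] by (intro divide_right_mono) auto
  finally show ?thesis .
qed

text \<open>Comparison of a decreasing summand with its integral, one step at a time by the mean
  value theorem.\<close>

lemma sum_cauchy_kernel_nat_le:
  fixes s :: real
  assumes "0 < s"
  shows "(\<Sum>k<Suc m. 1 / (1 + (real k / s)\<^sup>2)) \<le> 1 + s * arctan (m / s)"
proof (induction m)
  case 0
  show ?case by simp
next
  case (Suc m)
  have "\<exists>z>m / s. z < Suc m / s \<and> arctan (Suc m / s) - arctan (m / s) = (Suc m / s - m / s) * inverse (1 + z\<^sup>2)"
    using assms by (intro MVT2) (auto simp: divide_strict_right_mono intro!: DERIV_arctan)
  then obtain z where z: "m / s < z" "z < Suc m / s"
    "arctan (Suc m / s) - arctan (m / s) = (Suc m / s - m / s) * inverse (1 + z\<^sup>2)" by blast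
  have "0 \<le> z" using z(1) assms by (meson divide_nonneg_pos of_nat_0_le_iff order.strict_trans1 less_imp_le)
  then have "z\<^sup>2 \<le> (Suc m / s)\<^sup>2" using z by (intro power_mono) auto
  then have "1 / (1 + (Suc m / s)\<^sup>2) \<le> inverse (1 + z\<^sup>2)"
    by (simp add: inverse_eq_divide frac_le add_pos_nonneg)
  also have "\<dots> = s * (arctan (Suc m / s) - arctan (m / s))"
  proof -
    have "Suc m / s - m / s = 1 / s" by (simp flip: diff_divide_distrib)
    then show ?thesis using assms unfolding z(3) by simp
  qed
  finally have "1 / (1 + (Suc m / s)\<^sup>2) \<le> s * (arctan (Suc m / s) - arctan (m / s))" .
  then show ?case using Suc.IH by (simp add: algebra_simps)
qed

text \<open>Split at the integer part of \<open>mu\<close>. On each side, counting steps away from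
  it injects the points into the naturals without exceeding the distance to \<open>mu\<close>, and
  the one-sided sum is at most \<open>1 + 2 * s\<close>.\<close>

lemma sum_cauchy_kernel_int_le:
  fixes s mu :: real
  assumes "1 \<le> s" "finite (A :: int set)"
  shows "(\<Sum>a\<in>A. 1 / (1 + ((a - mu) / s)\<^sup>2)) \<le> 6 * s"
proof -
  define j where "j = \<lfloor>mu\<rfloor>"
  have half: "(\<Sum>a\<in>B. 1 / (1 + ((a - mu) / s)\<^sup>2)) \<le> 3 * s"
    if B: "finite B" and f: "inj_on f B" "\<And>a. a \<in> B \<Longrightarrow> real (f a) \<le> \<bar>a - mu\<bar>" for B :: "int set" and f :: "int \<Rightarrow> nat"
  proof -
    obtain m where "\<forall>x\<in>f ` B. x < m"
      using B finite_nat_set_iff_bounded[of "f ` B"] by blast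
    then have m: "f ` B \<subseteq> {..<Suc m}" by fastforce
    have "(\<Sum>a\<in>B. 1 / (1 + ((a - mu) / s)\<^sup>2)) \<le> (\<Sum>a\<in>B. 1 / (1 + (real (f a) / s)\<^sup>2))"
    proof (intro sum_mono divide_left_mono)
      fix a assume a: "a \<in> B"
      have "(real (f a))\<^sup>2 \<le> \<bar>a - mu\<bar>\<^sup>2" using f(2)[OF a] by (intro power_mono) auto
      then show "1 + (real (f a) / s)\<^sup>2 \<le> 1 + ((a - mu) / s)\<^sup>2"
        using assms by (simp add: power_divide divide_right_mono)
    qed (auto simp: add_pos_nonneg)
    also have "\<dots> = (\<Sum>k\<in>f ` B. 1 / (1 + (real k / s)\<^sup>2))"
      using f(1) by (simp add: sum.reindex)
    also have "\<dots> \<le> (\<Sum>k<Suc m. 1 / (1 + (real k / s)\<^sup>2))"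
      using m by (intro sum_mono2) auto
    also have "\<dots> \<le> 1 + s * arctan (m / s)"
      using assms by (intro sum_cauchy_kernel_nat_le) auto
    also have "\<dots> \<le> 1 + s * 2"
    proof -
      have "arctan (m / s) \<le> 2" using arctan_ubound[of "m / s"] pi_less_4 by linarith
      then show ?thesis using assms by (intro add_left_mono mult_left_mono) auto
    qed
    also have "\<dots> \<le> 3 * s" using assms by simp
    finally show ?thesis .
  qed
  have j: "of_int j \<le> mu" "mu < of_int j + 1" by (auto simp: j_def)
  have "(\<Sum>a\<in>A. 1 / (1 + ((a - mu) / s)\<^sup>2)) =
      (\<Sum>a\<in>A \<inter> {..j}. 1 / (1 + ((a - mu) / s)\<^sup>2)) + (\<Sum>a\<in>A \<inter> {j<..}. 1 / (1 + ((a - mu) / s)\<^sup>2))"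
    using assms by (subst sum.union_disjoint[symmetric]) (auto intro!: sum.cong)
  also have "\<dots> \<le> 3 * s + 3 * s"
  proof (rule add_mono)
    show "(\<Sum>a\<in>A \<inter> {..j}. 1 / (1 + ((a - mu) / s)\<^sup>2)) \<le> 3 * s"
    proof (rule half[of _ "\<lambda>a. nat (j - a)"])
      show "real (nat (j - a)) \<le> \<bar>a - mu\<bar>" if "a \<in> A \<inter> {..j}" for a
      proof -
        have "real (nat (j - a)) = of_int j - of_int a" using that by simp
        then show ?thesis using j by linarith
      qed
    qed (use assms in \<open>auto simp: inj_on_def\<close>)
    show "(\<Sum>a\<in>A \<inter> {j<..}. 1 / (1 + ((a - mu) / s)\<^sup>2)) \<le> 3 * s"
    proof (rule half[of _ "\<lambda>a. nat (a - j - 1)"])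
      show "real (nat (a - j - 1)) \<le> \<bar>a - mu\<bar>" if "a \<in> A \<inter> {j<..}" for a
      proof -
        have "real (nat (a - j - 1)) = of_int a - of_int j - 1" using that by simp
        then show ?thesis using j by linarith
      qed
    qed (use assms in \<open>auto simp: inj_on_def\<close>)
  qed
  finally show ?thesis by simp
qed

section \<open>From characteristic functions to distances\<close>

definition centred_char :: "real \<Rightarrow> int pmf \<Rightarrow> real \<Rightarrow> complex" where
  "centred_char mu P t = measure_pmf.expectation P (\<lambda>x. cis (t * (real_of_int x - mu)))"

definition centred_char1 :: "real \<Rightarrow> int pmf \<Rightarrow> real \<Rightarrow> complex" where
  "centred_char1 mu P t = measure_pmf.expectation P (\<lambda>x. of_real (real_of_int x - mu) * cis (t * (real_of_int x - mu)))"

text \<open>Exhaust \<open>A\<close> by finite sets and use continuity from below.\<close>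

lemma abs_prob_diff_le:
  fixes P Q :: "int pmf"
  assumes "\<And>B. finite B \<Longrightarrow> (\<Sum>a\<in>B. \<bar>pmf P a - pmf Q a\<bar>) \<le> D"
  shows "\<bar>measure_pmf.prob P A - measure_pmf.prob Q A\<bar> \<le> D"
proof -
  define X where "X k = A \<inter> {- int k..int k}" for k :: nat
  have X: "incseq X" "(\<Union>k. X k) = A"
  proof -
    show "incseq X" by (auto simp: incseq_def X_def)
    have "a \<in> X (nat \<bar>a\<bar>)" if "a \<in> A" for a using that by (auto simp: X_def)
    moreover have "X k \<subseteq> A" for k by (auto simp: X_def)
    ultimately show "(\<Union>k. X k) = A" by blast
  qed
  have "(\<lambda>k. measure_pmf.prob R (X k)) \<longlonglongrightarrow> measure_pmf.prob R A" for R :: "int pmf"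
    using measure_pmf.finite_Lim_measure_incseq[of X R] X by auto
  then have "(\<lambda>k. \<bar>measure_pmf.prob P (X k) - measure_pmf.prob Q (X k)\<bar>) \<longlonglongrightarrow>
      \<bar>measure_pmf.prob P A - measure_pmf.prob Q A\<bar>"
    by (intro tendsto_rabs tendsto_diff)
  then show ?thesis
  proof (rule LIMSEQ_le_const2, intro exI allI impI)
    fix k
    have fin: "finite (X k)" by (auto simp: X_def)
    have "measure_pmf.prob P (X k) - measure_pmf.prob Q (X k) = (\<Sum>a\<in>X k. pmf P a - pmf Q a)"
      using fin by (simp add: measure_measure_pmf_finite sum_subtractf)
    then have "\<bar>measure_pmf.prob P (X k) - measure_pmf.prob Q (X k)\<bar> \<le> (\<Sum>a\<in>X k. \<bar>pmf P a - pmf Q a\<bar>)"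
      by (simp add: sum_abs)
    then show "\<bar>measure_pmf.prob P (X k) - measure_pmf.prob Q (X k)\<bar> \<le> D"
      using assms[OF fin] by linarith
  qed
qed

lemma centred_char_diff_coeff:
  fixes P Q :: "int pmf" and mu :: real
  assumes int: "integrable (measure_pmf P) real_of_int" "integrable (measure_pmf Q) real_of_int"
    and cont: "\<And>R. R \<in> {P, Q} \<Longrightarrow> continuous_on {-pi..pi} (centred_char mu R)"
      "\<And>R. R \<in> {P, Q} \<Longrightarrow> continuous_on {-pi..pi} (centred_char1 mu R)"
  shows "(LINT t:{-pi..pi}|lborel. (centred_char mu P t - centred_char mu Q t) * cis (- (t * (a - mu)))) =
      2 * pi * (pmf P a - pmf Q a)"
    and "(LINT t:{-pi..pi}|lborel. (centred_char1 mu P t - centred_char1 mu Q t) * cis (- (t * (a - mu)))) =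
      2 * pi * ((a - mu) * (pmf P a - pmf Q a))"
proof -
  have i: "integrable (measure_pmf R) (\<lambda>x. real_of_int x - mu)" if "R \<in> {P, Q}" for R
    using int that by auto
  have 0: "(LINT t:{-pi..pi}|lborel. centred_char mu R t * cis (- (t * (a - mu)))) = 2 * pi * pmf R a" for R
    using pmf_fourier_coeff[of R "\<lambda>_. 1" mu a] by (simp add: centred_char_def)
  have 1: "(LINT t:{-pi..pi}|lborel. centred_char1 mu R t * cis (- (t * (a - mu)))) = 2 * pi * (a - mu) * pmf R a"
    if "R \<in> {P, Q}" for R
    using pmf_fourier_coeff[OF i[OF that], of mu a] by (simp add: centred_char1_def)
  have s: "set_integrable lborel {-pi..pi} (\<lambda>t. centred_char mu R t * cis (- (t * (a - mu))))"
    "set_integrable lborel {-pi..pi} (\<lambda>t. centred_char1 mu R t * cis (- (t * (a - mu))))" if "R \<in> {P, Q}" for R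
    by (intro borel_integrable_atLeastAtMost' continuous_intros cont that)+
  show "(LINT t:{-pi..pi}|lborel. (centred_char mu P t - centred_char mu Q t) * cis (- (t * (a - mu)))) =
      2 * pi * (pmf P a - pmf Q a)"
    using s(1)[of P] s(1)[of Q] 0[of P] 0[of Q]
    by (simp add: left_diff_distrib set_integral_diff(2) right_diff_distrib del: minus_mult_right minus_mult_left)
  show "(LINT t:{-pi..pi}|lborel. (centred_char1 mu P t - centred_char1 mu Q t) * cis (- (t * (a - mu)))) =
      2 * pi * ((a - mu) * (pmf P a - pmf Q a))"
    using s(2)[of P] s(2)[of Q] 1[of P] 1[of Q]
    by (simp add: left_diff_distrib[of "centred_char1 mu P _"] set_integral_diff(2)) (simp add: algebra_simps)
qed

text \<open>Here \<open>s\<close> is the scale of the standard deviation. The second hypothesis is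
  weaker by a factor \<open>s\<close>, which matches the weight, where \<open>a - mu\<close> is
  divided by \<open>s\<close>: both parts of the weighted sum of squares are at most
  \<open>B^2 / (2 * s^3)\<close>.\<close>

lemma pmf_distance_bounds:
  fixes P Q :: "int pmf" and mu s B :: real
  assumes int: "integrable (measure_pmf P) real_of_int" "integrable (measure_pmf Q) real_of_int"
    and cont: "\<And>R. R \<in> {P, Q} \<Longrightarrow> continuous_on {-pi..pi} (centred_char mu R)"
      "\<And>R. R \<in> {P, Q} \<Longrightarrow> continuous_on {-pi..pi} (centred_char1 mu R)"
    and s: "1 \<le> s" and B: "0 \<le> B"
    and bound: "\<And>t. \<bar>t\<bar> \<le> pi \<Longrightarrow> norm (centred_char mu P t - centred_char mu Q t) \<le> B / (s * (1 + s\<^sup>2 * t\<^sup>2))"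
      "\<And>t. \<bar>t\<bar> \<le> pi \<Longrightarrow> norm (centred_char1 mu P t - centred_char1 mu Q t) \<le> B / (1 + s\<^sup>2 * t\<^sup>2)"
  shows "dloc P Q \<le> B / s\<^sup>2" "dTV P Q \<le> 3 * B / s"
proof -
  let ?k = "\<lambda>t. 1 / (1 + s\<^sup>2 * t\<^sup>2)"
  let ?f = "\<lambda>a. pmf P a - pmf Q a"
  let ?\<phi> = "\<lambda>t. centred_char mu P t - centred_char mu Q t" and ?\<phi>1 = "\<lambda>t. centred_char1 mu P t - centred_char1 mu Q t"
  have coeff: "(LINT t:{-pi..pi}|lborel. ?\<phi> t * cis (- (t * (a - mu)))) = 2 * pi * ?f a"
    "(LINT t:{-pi..pi}|lborel. ?\<phi>1 t * cis (- (t * (a - mu)))) = 2 * pi * ((a - mu) * ?f a)" for a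
    by (rule centred_char_diff_coeff[OF int]; use cont in blast)+
  have s0: "0 < s" using s by simp
  have pos: "1 + s\<^sup>2 * t\<^sup>2 \<ge> 1" for t by simp
  have k1: "0 \<le> ?k t" "?k t \<le> 1" for t
  proof -
    have "0 < 1 + s\<^sup>2 * t\<^sup>2" using pos[of t] by linarith
    then show "0 \<le> ?k t" "?k t \<le> 1" by (simp_all only: divide_le_eq_1_pos zero_le_divide_1_iff pos less_imp_le)
  qed
  have kcont: "continuous_on {-pi..pi} (\<lambda>t. c * ?k t)" for c
  proof (intro continuous_intros ballI)
    show "1 + s\<^sup>2 * t\<^sup>2 \<noteq> 0" for t using pos[of t] by linarith
  qed
  have kint: "(LINT t:{-pi..pi}|lborel. c * ?k t) \<le> c * (pi / s)" if "0 \<le> c" for c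
    unfolding set_integral_mult_right by (rule mult_left_mono[OF lint_cauchy_kernel_le[OF s0] that])
  have si: "set_integrable lborel {-pi..pi} h" if "continuous_on {-pi..pi} h" for h :: "real \<Rightarrow> real"
    using that by (rule borel_integrable_atLeastAtMost')
  have \<phi>: "continuous_on {-pi..pi} ?\<phi>" "continuous_on {-pi..pi} ?\<phi>1"
    using cont by (auto intro!: continuous_on_diff)
  have loc: "\<bar>?f a\<bar> \<le> B / s\<^sup>2" for a
  proof -
    have "2 * pi * \<bar>?f a\<bar> = norm (complex_of_real (2 * pi * ?f a))"
      by (simp only: norm_of_real abs_mult) simp
    also have "\<dots> = norm (LINT t:{-pi..pi}|lborel. ?\<phi> t * cis (- (t * (a - mu))))"
      unfolding coeff(1) ..
    also have "\<dots> \<le> (LINT t:{-pi..pi}|lborel. norm (?\<phi> t * cis (- (t * (a - mu)))))"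
      by (intro set_integral_norm_bound borel_integrable_atLeastAtMost' continuous_intros cont) auto
    also have "\<dots> \<le> (LINT t:{-pi..pi}|lborel. B / s * ?k t)"
    proof (rule set_integral_mono)
      show "set_integrable lborel {-pi..pi} (\<lambda>t. norm (?\<phi> t * cis (- (t * (a - mu)))))"
        by (intro si continuous_intros cont) auto
      fix t :: real assume "t \<in> {-pi..pi}"
      then have "\<bar>t\<bar> \<le> pi" by auto
      then show "norm (?\<phi> t * cis (- (t * (a - mu)))) \<le> B / s * ?k t"
        using bound(1)[of t] by (simp add: norm_mult)
    qed (rule si[OF kcont])
    also have "\<dots> \<le> B / s * (pi / s)" using B s0 by (intro kint) auto
    also have "\<dots> = 2 * pi * (B / s\<^sup>2 / 2)" by (simp add: power2_eq_square)
    finally have "\<bar>?f a\<bar> \<le> B / s\<^sup>2 / 2" by (rule mult_left_le_imp_le) simp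
    moreover have "0 \<le> B / s\<^sup>2" using B by simp
    moreover have "x \<le> y / 2 \<Longrightarrow> 0 \<le> y \<Longrightarrow> x \<le> y" for x y :: real by linarith
    ultimately show ?thesis by blast
  qed
  then show "dloc P Q \<le> B / s\<^sup>2" unfolding dloc_def by (intro cSUP_least) auto
  have "(\<Sum>a\<in>A. \<bar>?f a\<bar>) \<le> 3 * B / s" if A: "finite A" for A
  proof -
    have sq: "2 * pi * (\<Sum>a\<in>A. (h a)\<^sup>2) \<le> c\<^sup>2 * (pi / s)"
      if "continuous_on {-pi..pi} F" "0 \<le> c"
        "\<And>t. \<bar>t\<bar> \<le> pi \<Longrightarrow> norm (F t) \<le> c * ?k t"
        "\<And>a. (LINT t:{-pi..pi}|lborel. F t * cis (- (t * (a - mu)))) = 2 * pi * h a"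
      for F h c
    proof -
      have "2 * pi * (\<Sum>a\<in>A. (h a)\<^sup>2) \<le> (LINT t:{-pi..pi}|lborel. (norm (F t))\<^sup>2)"
        by (rule bessel_inequality[OF A that(1,4)])
      also have "\<dots> \<le> (LINT t:{-pi..pi}|lborel. c\<^sup>2 * ?k t)"
      proof (rule set_integral_mono)
        show "set_integrable lborel {-pi..pi} (\<lambda>t. (norm (F t))\<^sup>2)"
          using that(1) by (intro si continuous_intros)
        fix t :: real assume "t \<in> {-pi..pi}"
        then have "(norm (F t))\<^sup>2 \<le> (c * ?k t)\<^sup>2" by (intro power_mono that(3)) auto
        also have "\<dots> = c\<^sup>2 * (?k t * ?k t)" by (simp add: power2_eq_square)
        \<comment> \<open>The kernel is at most 1, so its square may be replaced by the kernel
          itself.\<close>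
        also have "\<dots> \<le> c\<^sup>2 * (1 * ?k t)"
          by (intro mult_left_mono mult_right_mono k1) auto
        finally show "(norm (F t))\<^sup>2 \<le> c\<^sup>2 * ?k t" by simp
      qed (rule si[OF kcont])
      also have "\<dots> \<le> c\<^sup>2 * (pi / s)" by (intro kint) simp
      finally show ?thesis .
    qed
    have 1: "2 * pi * (\<Sum>a\<in>A. (?f a)\<^sup>2) \<le> (B / s)\<^sup>2 * (pi / s)"
      using bound(1) B s0 by (intro sq[OF \<phi>(1) _ _ coeff(1)]) auto
    have 2: "2 * pi * (\<Sum>a\<in>A. ((a - mu) * ?f a)\<^sup>2) \<le> B\<^sup>2 * (pi / s)"
      using bound(2) B by (intro sq[OF \<phi>(2) _ _ coeff(2)]) auto
    define w where "w a = 1 + ((real_of_int a - mu) / s)\<^sup>2" for a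
    have w: "1 \<le> w a" for a by (simp add: w_def)
    have "2 * pi * (\<Sum>a\<in>A. w a * (?f a)\<^sup>2) =
        2 * pi * (\<Sum>a\<in>A. (?f a)\<^sup>2) + (2 * pi * (\<Sum>a\<in>A. ((a - mu) * ?f a)\<^sup>2)) / s\<^sup>2"
      by (simp add: w_def distrib_right sum.distrib distrib_left sum_divide_distrib sum_distrib_left power_mult_distrib power_divide)
    also have "\<dots> \<le> (B / s)\<^sup>2 * (pi / s) + B\<^sup>2 * (pi / s) / s\<^sup>2"
      using 1 2 by (intro add_mono divide_right_mono) auto
    also have "\<dots> = 2 * pi * (B\<^sup>2 / s ^ 3)"
      by (simp add: power_divide power2_eq_square power3_eq_cube mult_ac)
    finally have 3: "(\<Sum>a\<in>A. w a * (?f a)\<^sup>2) \<le> B\<^sup>2 / s ^ 3" by (rule mult_left_le_imp_le) simp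
    have "(\<Sum>a\<in>A. \<bar>?f a\<bar>)\<^sup>2 = (\<Sum>a\<in>A. (sqrt (w a) * \<bar>?f a\<bar>) * (1 / sqrt (w a)))\<^sup>2"
    proof (intro arg_cong[of _ _ "\<lambda>x. x\<^sup>2"] sum.cong refl)
      fix a
      have "sqrt (w a) \<noteq> 0" using w[of a] by simp
      then show "\<bar>?f a\<bar> = (sqrt (w a) * \<bar>?f a\<bar>) * (1 / sqrt (w a))" by simp
    qed
    also have "\<dots> \<le> (\<Sum>a\<in>A. (sqrt (w a) * \<bar>?f a\<bar>)\<^sup>2) * (\<Sum>a\<in>A. (1 / sqrt (w a))\<^sup>2)"
      by (rule Cauchy_Schwarz_ineq_sum)
    also have "\<dots> = (\<Sum>a\<in>A. w a * (?f a)\<^sup>2) * (\<Sum>a\<in>A. 1 / w a)"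
    proof -
      have "(sqrt (w a))\<^sup>2 = w a" for a using w[of a] by simp
      then show ?thesis by (simp add: power_mult_distrib power_divide)
    qed
    also have "\<dots> \<le> (B\<^sup>2 / s ^ 3) * (6 * s)"
    proof (rule mult_mono[OF 3])
      show "(\<Sum>a\<in>A. 1 / w a) \<le> 6 * s" unfolding w_def by (rule sum_cauchy_kernel_int_le[OF s A])
      show "0 \<le> (\<Sum>a\<in>A. 1 / w a)" using w by (intro sum_nonneg) (simp add: order_trans[OF zero_le_one])
    qed (use s0 in auto)
    also have "\<dots> \<le> (3 * B / s)\<^sup>2"
    proof -
      have "(B\<^sup>2 / s ^ 3) * (6 * s) = 6 * (B\<^sup>2 / s\<^sup>2)" using s0 by (simp add: power3_eq_cube power2_eq_square)
      also have "\<dots> \<le> 9 * (B\<^sup>2 / s\<^sup>2)" by (intro mult_right_mono) auto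
      finally show ?thesis by (simp add: power_divide power_mult_distrib)
    qed
    finally show ?thesis by (rule power2_le_imp_le) (use B s0 in simp)
  qed
  then have "\<bar>measure_pmf.prob P A - measure_pmf.prob Q A\<bar> \<le> 3 * B / s" for A
    by (intro abs_prob_diff_le) blast
  then show "dTV P Q \<le> 3 * B / s" unfolding dTV_def by (intro cSUP_least) auto
qed

section \<open>Poisson generating functions\<close>

lemma pmf_nat_expectation:
  fixes f :: "nat \<Rightarrow> 'b::{banach, second_countable_topology}"
  assumes "summable (\<lambda>k. norm (pmf p k *\<^sub>R f k))"
  shows "integrable (measure_pmf p) f" "(\<lambda>k. pmf p k *\<^sub>R f k) sums measure_pmf.expectation p f"
proof -
  have int: "integrable (count_space UNIV) (\<lambda>k. pmf p k *\<^sub>R f k)"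
    using assms by (simp add: integrable_count_space_nat_iff)
  then show "integrable (measure_pmf p) f"
    unfolding measure_pmf_eq_density by (subst integrable_density) auto
  have "measure_pmf.expectation p f = (\<integral>k. pmf p k *\<^sub>R f k \<partial>count_space UNIV)"
    unfolding measure_pmf_eq_density by (subst integral_density) auto
  then show "(\<lambda>k. pmf p k *\<^sub>R f k) sums measure_pmf.expectation p f"
    using sums_integral_count_space_nat[OF int] by simp
qed

text \<open>The recursion \<open>rec\<close> shifts the first-moment series by one index onto the
  generating function.\<close>

lemma poisson_generating_function:
  fixes m :: real and z :: complex
  assumes m: "0 < m" and z: "norm z \<le> 1"
  shows "measure_pmf.expectation (poisson_pmf m) (\<lambda>k. z ^ k) = exp (m * (z - 1))"
    and "measure_pmf.expectation (poisson_pmf m) (\<lambda>k. of_nat k * z ^ k) = m * z * exp (m * (z - 1))"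
    and "integrable (measure_pmf (poisson_pmf m)) real"
proof -
  have pmf: "pmf (poisson_pmf m) k = m ^ k / fact k * exp (- m)" for k
    using m by (rule pmf_poisson)
  have rec: "pmf (poisson_pmf m) (Suc k) * real (Suc k) = m * pmf (poisson_pmf m) k" for k
    unfolding pmf by (simp add: fact_Suc del: of_nat_Suc)
  have e: "exp (m * (z - 1)) = exp (m * z) * complex_of_real (exp (- m))"
    by (simp add: right_diff_distrib exp_diff exp_minus exp_of_real divide_inverse)
  have 0: "pmf (poisson_pmf m) k *\<^sub>R z ^ k = ((m * z) ^ k /\<^sub>R fact k) * complex_of_real (exp (- m))" for k
    unfolding pmf by (simp add: scaleR_conv_of_real power_mult_distrib field_simps)
  have 1: "pmf (poisson_pmf m) (Suc k) *\<^sub>R (of_nat (Suc k) * z ^ Suc k) = m * z * (pmf (poisson_pmf m) k *\<^sub>R z ^ k)" for k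
  proof -
    have "complex_of_real (pmf (poisson_pmf m) (Suc k)) * of_nat (Suc k) = m * complex_of_real (pmf (poisson_pmf m) k)"
      using rec[of k] by (metis of_real_mult of_real_of_nat_eq)
    then have "(complex_of_real (pmf (poisson_pmf m) (Suc k)) * of_nat (Suc k)) * z ^ Suc k = (m * complex_of_real (pmf (poisson_pmf m) k)) * z ^ Suc k"
      by simp
    then show ?thesis by (simp only: scaleR_conv_of_real power_Suc mult_ac)
  qed
  have n0: "summable (\<lambda>k. norm (pmf (poisson_pmf m) k *\<^sub>R w ^ k))" if "norm w \<le> 1" for w :: complex
  proof -
    have "norm (pmf (poisson_pmf m) k *\<^sub>R w ^ k) = (m * norm w) ^ k /\<^sub>R fact k * exp (- m)" for k
      unfolding pmf using m by (simp add: norm_power power_mult_distrib field_simps)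
    then show ?thesis
      using summable_mult2[OF sums_summable[OF exp_converges[of "m * norm w"]], of "exp (- m)"] by simp
  qed
  have n1: "summable (\<lambda>k. norm (pmf (poisson_pmf m) k *\<^sub>R (of_nat k * w ^ k)))" if "norm w \<le> 1" for w :: complex
  proof -
    have eq: "norm (pmf (poisson_pmf m) (Suc k) *\<^sub>R (of_nat (Suc k) * w ^ Suc k)) =
        (m * norm w) * norm (pmf (poisson_pmf m) k *\<^sub>R w ^ k)" for k
    proof -
      have "(pmf (poisson_pmf m) (Suc k) * real (Suc k)) * norm w ^ Suc k = (m * pmf (poisson_pmf m) k) * norm w ^ Suc k"
        using rec[of k] by simp
      then show ?thesis
        by (simp only: norm_scaleR norm_mult norm_power norm_of_nat power_Suc abs_of_nonneg pmf_nonneg mult_ac)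
    qed
    show ?thesis
      by (subst summable_Suc_iff[symmetric]) (simp only: eq summable_mult n0[OF that])
  qed
  have "(\<lambda>k. pmf (poisson_pmf m) k *\<^sub>R z ^ k) sums (exp (m * z) * complex_of_real (exp (- m)))"
    unfolding 0 by (intro sums_mult2 exp_converges)
  then show E0: "measure_pmf.expectation (poisson_pmf m) (\<lambda>k. z ^ k) = exp (m * (z - 1))"
    unfolding e using pmf_nat_expectation(2)[OF n0[OF z]] sums_unique2 by blast
  have "(\<lambda>k. m * z * (pmf (poisson_pmf m) k *\<^sub>R z ^ k)) sums (m * z * exp (m * (z - 1)))"
    using pmf_nat_expectation(2)[OF n0[OF z]] unfolding E0 by (rule sums_mult)
  then have "(\<lambda>k. pmf (poisson_pmf m) k *\<^sub>R (of_nat k * z ^ k)) sums (m * z * exp (m * (z - 1)))"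
    unfolding 1[symmetric] by (subst (asm) sums_Suc_iff) simp
  then show "measure_pmf.expectation (poisson_pmf m) (\<lambda>k. of_nat k * z ^ k) = m * z * exp (m * (z - 1))"
    using pmf_nat_expectation(2)[OF n1[OF z]] sums_unique2 by blast
  have "summable (\<lambda>k. norm (pmf (poisson_pmf m) k *\<^sub>R real k))"
    using n1[of 1] by simp
  then show "integrable (measure_pmf (poisson_pmf m)) real" by (rule pmf_nat_expectation)
qed

section \<open>The translated Poisson law and the differential inequality\<close>

text \<open>The translated law has mean exactly \<open>mu\<close>, so centring cancels the shift.
  Rounding affects only the variance \<open>m\<close>, which exceeds \<open>s2\<close> by less than
  1.\<close>

lemma TP_char_fun:
  fixes mu s2 :: real
  assumes s2: "0 < s2"
  obtains m where "s2 \<le> m" "m < s2 + 1"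
    "\<And>t. centred_char mu (TP mu s2) t = exp (m * (cis t - 1 - \<i> * t))"
    "\<And>t. centred_char1 mu (TP mu s2) t = m * (cis t - 1) * exp (m * (cis t - 1 - \<i> * t))"
    "integrable (measure_pmf (TP mu s2)) real_of_int"
proof
  define s where "s = \<lfloor>mu - s2\<rfloor>"
  define m where "m = mu - real_of_int s"
  have sb: "real_of_int s \<le> mu - s2" "mu - s2 < real_of_int s + 1" by (auto simp: s_def)
  show b: "s2 \<le> m" "m < s2 + 1" using sb by (auto simp: m_def)
  \<comment> \<open>Positivity rules out the degenerate branch of \<open>Po\<close>.\<close>
  have m0: "0 < m" using b s2 by linarith
  have "s2 + (mu - s2 - real_of_int s) = m" by (simp add: m_def)
  then have TP: "TP mu s2 = map_pmf (\<lambda>k. s + int k) (poisson_pmf m)"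
    using m0 by (simp add: TP_def Po_def Let_def flip: s_def)
  have shift: "real_of_int (s + int k) - mu = real k - m" for k by (simp add: m_def)
  have pow: "cis (t * (real k - m)) = cis (- (t * m)) * cis t ^ k" for t k
  proof -
    have "t * (real k - m) = - (t * m) + real k * t" by (simp add: algebra_simps)
    then show ?thesis by (simp only: Complex.DeMoivre cis_mult)
  qed
  have n1: "norm (cis t) \<le> 1" for t by simp
  have e: "cis (- (t * m)) * exp (m * (cis t - 1)) = exp (m * (cis t - 1 - \<i> * t))" for t
    by (simp add: cis_conv_exp exp_add[symmetric] algebra_simps)
  show c0: "centred_char mu (TP mu s2) t = exp (m * (cis t - 1 - \<i> * t))" for t
    unfolding centred_char_def TP integral_map_pmf shift pow
    by (simp add: poisson_generating_function(1)[OF m0 n1] e)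
  have i0: "integrable (measure_pmf (poisson_pmf m)) (\<lambda>k. cis t ^ k)" for t
    by (rule measure_pmf.integrable_const_bound[of _ 1]) (auto simp: norm_power)
  have i1: "integrable (measure_pmf (poisson_pmf m)) (\<lambda>k. of_nat k * cis t ^ k)" for t
  proof (rule Bochner_Integration.integrable_bound[OF poisson_generating_function(3)[OF m0 n1[of 0]]])
    show "AE k in measure_pmf (poisson_pmf m). norm (of_nat k * cis t ^ k) \<le> norm (real k)"
      by (simp add: norm_mult norm_power)
  qed simp
  show "centred_char1 mu (TP mu s2) t = m * (cis t - 1) * exp (m * (cis t - 1 - \<i> * t))" for t
  proof -
    have "centred_char1 mu (TP mu s2) t = measure_pmf.expectation (poisson_pmf m)
         (\<lambda>k. cis (- (t * m)) * (of_nat k * cis t ^ k - m * cis t ^ k))"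
      unfolding centred_char1_def TP integral_map_pmf shift pow by (simp add: algebra_simps)
    also have "\<dots> = cis (- (t * m)) * (m * cis t * exp (m * (cis t - 1)) - m * exp (m * (cis t - 1)))"
      using i0 i1 by (simp add: poisson_generating_function(1,2)[OF m0 n1])
    also have "\<dots> = m * (cis t - 1) * (cis (- (t * m)) * exp (m * (cis t - 1)))"
      by (simp only: left_diff_distrib right_diff_distrib mult_ac mult_1_left mult_1_right)
    finally show ?thesis unfolding e .
  qed
  show "integrable (measure_pmf (TP mu s2)) real_of_int"
    unfolding TP using poisson_generating_function(3)[OF m0 n1[of 0]] by simp
qed

lemma one_minus_cos_ge_full:
  assumes "\<bar>t\<bar> \<le> pi"
  shows "t\<^sup>2 / 12 \<le> 1 - cos t"
proof -
  have "(t / 2)\<^sup>2 / 3 \<le> 1 - cos (t / 2)" using assms by (intro one_minus_cos_ge) auto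
  moreover have "cos \<bar>t\<bar> \<le> cos (\<bar>t\<bar> / 2)" using assms by (intro cos_monotone_0_pi_le) auto
  then have "cos t \<le> cos (t / 2)" by (auto simp: abs_if split: if_splits)
  ultimately show ?thesis by (simp add: power_divide)
qed

text \<open>Here \<open>\<phi>\<close> solves \<open>\<phi>' = - v x \<phi> + R\<close> with \<open>\<phi> 0 = 0\<close>; the integrating factor
  \<open>exp (v x\<^sup>2 / 2)\<close> turns the bound on \<open>R\<close> into a bound on \<open>\<phi>\<close>.\<close>
lemma gaussian_ode_bound:
  fixes \<phi> \<phi>1 :: "real \<Rightarrow> complex" and v c D n t T :: real
  assumes deriv: "\<And>x. (\<phi> has_vector_derivative (\<i> * \<phi>1 x)) (at x)" and zero: "\<phi> 0 = 0"
    and err: "\<And>x. \<bar>x\<bar> \<le> T \<Longrightarrow> norm (\<phi>1 x - \<i> * x * v * \<phi> x) \<le> D * (\<bar>x\<bar> + n * x\<^sup>2) * exp (- (c * n * x\<^sup>2))"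
    and D: "0 \<le> D" and n: "0 \<le> n" and c: "2 * c * n \<le> v" and t: "\<bar>t\<bar> \<le> T"
  shows "norm (\<phi> t) \<le> D * (t\<^sup>2 + n * \<bar>t\<bar> ^ 3) * exp (- (c * n * t\<^sup>2))"
proof -
  define E where "E x = exp (v * x\<^sup>2 / 2)" for x :: real
  define R where "R x = \<phi>1 x - \<i> * x * v * \<phi> x" for x :: real
  \<comment> \<open>A bound for the derivative of \<open>E x *\<^sub>R \<phi> x\<close> on the whole
    interval: the estimate increases with the modulus of \<open>x\<close>, since
    \<open>v / 2 - c * n\<close> is nonnegative, so it is evaluated at \<open>t\<close>.\<close>
  define B where "B = D * (\<bar>t\<bar> + n * t\<^sup>2) * exp ((v / 2 - c * n) * t\<^sup>2)"
  have "norm (E t *\<^sub>R \<phi> t - E 0 *\<^sub>R \<phi> 0) \<le> B * norm (t - 0)"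
  proof (rule differentiable_bound[where S = "{- \<bar>t\<bar>..\<bar>t\<bar>}" and f = "\<lambda>x. E x *\<^sub>R \<phi> x" and
        f' = "\<lambda>x h. h *\<^sub>R (E x *\<^sub>R (\<i> * R x))"])
    fix x assume x: "x \<in> {- \<bar>t\<bar>..\<bar>t\<bar>}"
    have "(E has_real_derivative (v * x * E x)) (at x)"
      unfolding E_def by (auto intro!: derivative_eq_intros)
    then have "((\<lambda>x. E x *\<^sub>R \<phi> x) has_vector_derivative (E x *\<^sub>R (\<i> * \<phi>1 x) + (v * x * E x) *\<^sub>R \<phi> x)) (at x)"
      by (intro has_vector_derivative_scaleR deriv)
    moreover have "E x *\<^sub>R (\<i> * \<phi>1 x) + (v * x * E x) *\<^sub>R \<phi> x = E x *\<^sub>R (\<i> * R x)"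
      by (simp add: scaleR_conv_of_real R_def algebra_simps)
    ultimately show "((\<lambda>x. E x *\<^sub>R \<phi> x) has_derivative (\<lambda>h. h *\<^sub>R (E x *\<^sub>R (\<i> * R x)))) (at x within {- \<bar>t\<bar>..\<bar>t\<bar>})"
      by (simp add: has_vector_derivative_def has_derivative_at_withinI)
    have xt: "\<bar>x\<bar> \<le> \<bar>t\<bar>" using x by auto
    then have x2: "x\<^sup>2 \<le> t\<^sup>2" by (simp add: abs_le_square_iff)
    have "norm (E x *\<^sub>R (\<i> * R x)) = E x * norm (R x)" by (simp add: norm_mult E_def)
    also have "\<dots> \<le> E x * (D * (\<bar>x\<bar> + n * x\<^sup>2) * exp (- (c * n * x\<^sup>2)))"
      unfolding R_def using xt t by (intro mult_left_mono err) (auto simp: E_def)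
    also have "\<dots> = D * (\<bar>x\<bar> + n * x\<^sup>2) * exp ((v / 2 - c * n) * x\<^sup>2)"
      by (simp add: E_def exp_add[symmetric] algebra_simps)
    also have "\<dots> \<le> B"
      unfolding B_def using xt x2 D n c by (intro mult_mono add_mono mult_left_mono) (auto intro!: mult_left_mono)
    finally have "norm (E x *\<^sub>R (\<i> * R x)) \<le> B" .
    then show "onorm (\<lambda>h. h *\<^sub>R (E x *\<^sub>R (\<i> * R x))) \<le> B"
      by (intro onorm_le) (metis abs_ge_zero mult.commute mult_left_mono norm_scaleR real_norm_def)
  qed auto
  then have "E t * norm (\<phi> t) \<le> B * \<bar>t\<bar>" using zero by (simp add: E_def)
  then have "norm (\<phi> t) \<le> B * \<bar>t\<bar> / E t" by (simp add: E_def field_simps)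
  also have "\<dots> = D * (\<bar>t\<bar> * \<bar>t\<bar> + n * (t\<^sup>2 * \<bar>t\<bar>)) * (exp ((v / 2 - c * n) * t\<^sup>2) / E t)"
    by (simp add: B_def algebra_simps)
  also have "exp ((v / 2 - c * n) * t\<^sup>2) / E t = exp (- (c * n * t\<^sup>2))"
    by (simp add: E_def exp_diff[symmetric] algebra_simps)
  also have "\<bar>t\<bar> * \<bar>t\<bar> + n * (t\<^sup>2 * \<bar>t\<bar>) = t\<^sup>2 + n * \<bar>t\<bar> ^ 3"
    by (simp add: power2_eq_square power3_eq_cube)
  finally show ?thesis .
qed

section \<open>The graph model\<close>

text \<open>Turns expectations over \<open>ER\<close> into finite sums: a configuration that is
  false outside \<open>I\<close> is the indicator of its support.\<close>

lemma expectation_bernoulli_product: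
  fixes h :: "('i \<Rightarrow> bool) \<Rightarrow> 'b::{banach, second_countable_topology}"
  assumes I: "finite I" and p: "0 \<le> p" "p \<le> 1"
  shows "measure_pmf.expectation (Pi_pmf I False (\<lambda>_. bernoulli_pmf p)) h = bern_mean p I (\<lambda>S. h (\<lambda>x. x \<in> S))"
proof -
  let ?P = "Pi_pmf I False (\<lambda>_. bernoulli_pmf p)"
  have inj: "inj_on (\<lambda>S x. x \<in> S) (Pow I)" by (auto simp: inj_on_def fun_eq_iff)
  have "measure_pmf.expectation ?P h = (\<Sum>a\<in>(\<lambda>S x. x \<in> S) ` Pow I. pmf ?P a *\<^sub>R h a)"
  proof (rule integral_measure_pmf)
    fix a assume "a \<in> set_pmf ?P"
    then have "\<forall>x. x \<notin> I \<longrightarrow> a x = False"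
      using set_Pi_pmf_subset'[OF I, of False "\<lambda>_. bernoulli_pmf p"] by (auto simp: PiE_dflt_def)
    then have "a = (\<lambda>x. x \<in> {x \<in> I. a x})" by auto
    then show "a \<in> (\<lambda>S x. x \<in> S) ` Pow I" by blast
  qed (use I in simp)
  also have "\<dots> = (\<Sum>S\<in>Pow I. pmf ?P (\<lambda>x. x \<in> S) *\<^sub>R h (\<lambda>x. x \<in> S))"
    by (simp add: sum.reindex[OF inj])
  also have "\<dots> = bern_mean p I (\<lambda>S. h (\<lambda>x. x \<in> S))"
    unfolding bern_mean_def
  proof (intro sum.cong refl)
    fix S assume "S \<in> Pow I"
    then have S: "S \<subseteq> I" by simp
    have "pmf ?P (\<lambda>x. x \<in> S) = (\<Prod>x\<in>I. pmf (bernoulli_pmf p) (x \<in> S))"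
      using S by (intro pmf_Pi'[OF I]) auto
    also have "\<dots> = (\<Prod>x\<in>S. pmf (bernoulli_pmf p) (x \<in> S)) * (\<Prod>x\<in>I - S. pmf (bernoulli_pmf p) (x \<in> S))"
      using prod.subset_diff[OF S I, of "\<lambda>x. pmf (bernoulli_pmf p) (x \<in> S)"] by (simp only: mult.commute)
    also have "\<dots> = p ^ card S * (1 - p) ^ card (I - S)"
    proof -
      have "(\<Prod>x\<in>S. pmf (bernoulli_pmf p) (x \<in> S)) = (\<Prod>x\<in>S. p)"
        using p by (intro prod.cong) auto
      moreover have "(\<Prod>x\<in>I - S. pmf (bernoulli_pmf p) (x \<in> S)) = (\<Prod>x\<in>I - S. 1 - p)"
        using p by (intro prod.cong) auto
      ultimately show ?thesis by simp
    qed
    finally show "pmf ?P (\<lambda>x. x \<in> S) *\<^sub>R h (\<lambda>x. x \<in> S) =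
        (p ^ card S * (1 - p) ^ card (I - S)) *\<^sub>R h (\<lambda>x. x \<in> S)" by simp
  qed
  finally show ?thesis .
qed

abbreviation edge_index :: "nat \<Rightarrow> (nat \<times> nat) set" where
  "edge_index n \<equiv> {(i, j). i < j \<and> j < n}"

abbreviation edge :: "nat \<times> nat \<Rightarrow> nat set" where
  "edge \<equiv> \<lambda>(i, j). {i, j}"

lemma finite_edge_index: "finite (edge_index n)"
  by (rule finite_subset[of _ "{..<n} \<times> {..<n}"]) auto

lemma inj_on_edge: "inj_on edge (edge_index n)"
  by (auto simp: inj_on_def doubleton_eq_iff)

lemma edge_image: "edge ` edge_index n = clique {..<n}"
proof (intro equalityI subsetI)
  fix e assume "e \<in> clique {..<n}"
  then obtain x y where e: "e = {x, y}" "x \<noteq> y" "x \<in> {..<n}" "y \<in> {..<n}" by (rule cliqueE)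
  then have "e = edge (min x y, max x y)" "(min x y, max x y) \<in> edge_index n"
    by (auto simp: min_def max_def)
  then show "e \<in> edge ` edge_index n" by blast
qed (auto simp: doubleton_in_clique)

lemma W_eq_off_count:
  assumes S: "S \<subseteq> edge_index n"
  shows "real (W n d (\<lambda>x. x \<in> S)) = off_count d {..<n} (edge ` S)"
proof -
  have mem: "{i, j} \<in> edge ` S \<longleftrightarrow> i \<noteq> j \<and> (min i j, max i j) \<in> S" for i j
  proof
    assume "{i, j} \<in> edge ` S"
    then obtain a b where ab: "(a, b) \<in> S" "{i, j} = {a, b}" by auto
    then have "a < b" using S by auto
    then show "i \<noteq> j \<and> (min i j, max i j) \<in> S"
      using ab by (auto simp: doubleton_eq_iff min_def max_def)
  next
    assume "i \<noteq> j \<and> (min i j, max i j) \<in> S"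
    then show "{i, j} \<in> edge ` S"
      by (intro image_eqI[of _ _ "(min i j, max i j)"]) (auto simp: min_def max_def)
  qed
  have "degree n (\<lambda>x. x \<in> S) i = vdeg (edge ` S) i" for i
  proof -
    have "{j. j < n \<and> adj (\<lambda>x. x \<in> S) i j} = nbhd (edge ` S) i"
      using S by (auto simp: nbhd_def mem adj_def)
    then show ?thesis by (simp add: degree_def vdeg_def)
  qed
  then have "real (W n d (\<lambda>x. x \<in> S)) = real (card {i \<in> {..<n}. vdeg (edge ` S) i \<noteq> d})"
    by (simp add: W_def)
  also have "\<dots> = off_count d {..<n} (edge ` S)"
    by (simp add: off_count_def sum.If_cases of_bool_def Collect_conj_eq[symmetric] Int_def)
  finally show ?thesis .
qed

lemma expectation_lawW:
  fixes g :: "real \<Rightarrow> 'b::{banach, second_countable_topology}"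
  assumes "0 \<le> lam / real n" "lam / real n \<le> 1"
  shows "measure_pmf.expectation (lawW lam d n) (\<lambda>x. g (real_of_int x)) =
    bern_mean (lam / real n) (clique {..<n}) (\<lambda>S. g (off_count d {..<n} S))"
proof -
  have "measure_pmf.expectation (lawW lam d n) (\<lambda>x. g (real_of_int x)) =
     bern_mean (lam / real n) (edge_index n) (\<lambda>S. g (real (W n d (\<lambda>x. x \<in> S))))"
    unfolding lawW_def ER_def integral_map_pmf
    using expectation_bernoulli_product[OF finite_edge_index assms, of n "\<lambda>E. g (real (W n d E))"] by simp
  also have "\<dots> = bern_mean (lam / real n) (edge_index n) (\<lambda>S. g (off_count d {..<n} (edge ` S)))"
    by (intro bern_mean_cong) (simp add: W_eq_off_count)
  also have "\<dots> = bern_mean (lam / real n) (clique {..<n}) (\<lambda>S. g (off_count d {..<n} S))"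
    unfolding edge_image[symmetric] bern_mean_image[OF inj_on_edge] ..
  finally show ?thesis .
qed

lemma finite_set_lawW: "finite (set_pmf (lawW lam d n))"
proof -
  have "set_pmf (lawW lam d n) \<subseteq> int ` {..n}"
  proof -
    have "W n d E \<le> n" for E
      unfolding W_def using card_mono[of "{..<n}" "{i. i < n \<and> degree n E i \<noteq> d}"] by auto
    then show ?thesis by (auto simp: lawW_def)
  qed
  then show ?thesis using finite_subset by blast
qed

lemma has_vector_derivative_cis_mult:
  "((\<lambda>t. cis (t * m)) has_vector_derivative (\<i> * (of_real m * cis (t * m)))) (at t)"
proof -
  have "((\<lambda>z. exp (\<i> * (z * complex_of_real m))) has_field_derivative \<i> * (of_real m * exp (\<i> * (complex_of_real t * complex_of_real m)))) (at (complex_of_real t))"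
    by (auto intro!: derivative_eq_intros)
  then have "((\<lambda>t. exp (\<i> * (complex_of_real t * complex_of_real m))) has_vector_derivative \<i> * (of_real m * exp (\<i> * (complex_of_real t * complex_of_real m)))) (at t)"
    by (rule has_vector_derivative_real_field)
  then show ?thesis by (simp add: cis_conv_exp)
qed

text \<open>With \<open>k = min 1 (a / 3)\<close>, \<open>k * (1 + z)\<close> is at most
  \<open>exp (a / 3 * z)\<close>; then cube. Two of the powers will absorb the polynomial factors
  and the third produces the Cauchy kernel.\<close>

lemma cube_exp_bound:
  fixes z a :: real
  assumes "0 \<le> z" "0 < a"
  shows "(1 + z) ^ 3 * exp (- (a * z)) \<le> 1 / (min 1 (a / 3)) ^ 3"
proof -
  define k where "k = min 1 (a / 3)"
  have k: "0 < k" "k \<le> 1" "k \<le> a / 3" using assms by (auto simp: k_def)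
  have "k * (1 + z) \<le> 1 + a / 3 * z"
    using k assms mult_right_mono[OF k(3), of z] by (simp add: distrib_left)
  also have "\<dots> \<le> exp (a / 3 * z)" by (rule exp_ge_add_one_self)
  finally have "(k * (1 + z)) ^ 3 \<le> exp (a / 3 * z) ^ 3"
    using k assms by (intro power_mono) auto
  also have "\<dots> = exp (a * z)" by (simp flip: exp_of_nat_mult)
  finally have "k ^ 3 * (1 + z) ^ 3 \<le> exp (a * z)" unfolding power_mult_distrib .
  then have "k ^ 3 * (1 + z) ^ 3 * exp (- (a * z)) \<le> exp (a * z) * exp (- (a * z))"
    by (intro mult_right_mono) auto
  then have "k ^ 3 * ((1 + z) ^ 3 * exp (- (a * z))) \<le> 1"
    by (simp add: mult.assoc flip: exp_add)
  then show ?thesis using k by (simp add: k_def[symmetric] field_simps)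
qed

section \<open>Comparison of the count with the translated Poisson law\<close>

context smoothed_graph
begin

lemma lawW_moments: "muW lam d n = mu" "varW lam d n = sigma2"
proof -
  have p': "0 \<le> lam / real n" "lam / real n \<le> 1" using p by (auto simp: p_def)
  show 1: "muW lam d n = mu"
    unfolding muW_def mu_def p_def using expectation_lawW[OF p', of d "\<lambda>x. x"] by simp
  show "varW lam d n = sigma2"
    unfolding varW_def sigma2_def muW_def[symmetric] 1 p_def
    using expectation_lawW[OF p', of d "\<lambda>x. (x - mu)\<^sup>2"] by simp
qed

lemma lawW_centred_char:
  "centred_char mu (lawW lam d n) t = bern_mean p G (\<lambda>S. cis (t * (X S - mu)))"
  "centred_char1 mu (lawW lam d n) t = bern_mean p G (\<lambda>S. (X S - mu) * cis (t * (X S - mu)))"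
proof -
  have p': "0 \<le> lam / real n" "lam / real n \<le> 1" using p by (auto simp: p_def)
  show "centred_char mu (lawW lam d n) t = bern_mean p G (\<lambda>S. cis (t * (X S - mu)))"
    unfolding centred_char_def p_def using expectation_lawW[OF p', of d "\<lambda>x. cis (t * (x - mu))"] by simp
  show "centred_char1 mu (lawW lam d n) t = bern_mean p G (\<lambda>S. (X S - mu) * cis (t * (X S - mu)))"
    unfolding centred_char1_def p_def
    using expectation_lawW[OF p', of d "\<lambda>x. of_real (x - mu) * cis (t * (x - mu))"] by simp
qed

lemma lawW_centred_char_derivative:
  "(centred_char mu (lawW lam d n) has_vector_derivative (\<i> * centred_char1 mu (lawW lam d n) t)) (at t)"
proof -
  have "((\<lambda>t. bern_mean p G (\<lambda>S. cis (t * (X S - mu)))) has_vector_derivative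
      bern_mean p G (\<lambda>S. \<i> * (of_real (X S - mu) * cis (t * (X S - mu))))) (at t)"
    unfolding bern_mean_def
    by (intro has_vector_derivative_sum bounded_linear.has_vector_derivative[OF bounded_linear_scaleR_right]
        has_vector_derivative_cis_mult)
  then show ?thesis unfolding lawW_centred_char[abs_def] bern_mean_mult_left .
qed

text \<open>The factor \<open>5 * L^2 + L + 1\<close> is the error constant of the differential
  inequality, \<open>2 * (L + 1)\<close> comes from bounding polynomials and
  \<open>sigma2 \<le> L * n\<close>, and the denominator is that of \<open>cube_exp_bound\<close> at
  rate \<open>c / 12\<close>.\<close>

definition distance_const :: real where
  "distance_const = 2 * (L + 1) * (5 * L\<^sup>2 + L + 1) / (min 1 (c / 36)) ^ 3"

lemma distance_bounds:
  assumes cn: "1 \<le> c * n"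
  shows "dloc (lawW lam d n) (TP mu sigma2) \<le> distance_const / n"
    and "dTV (lawW lam d n) (TP mu sigma2) \<le> 3 * distance_const / sqrt n"
proof -
  define s where "s = sqrt n"
  \<comment> \<open>The weaker of the two decay rates: \<open>c\<close> for the count, but
    \<open>c / 12\<close> for the Poisson law, where
    \<open>1 - cos t \<ge> t^2 / 12\<close>.\<close>
  define a where "a = c / 12"
  define D where "D = 5 * L\<^sup>2 + L + 1"
  define k where "k = (min 1 (c / 36)) ^ 3"
  have s: "1 \<le> s" "s\<^sup>2 = n" using n_pos by (auto simp: s_def)
  have D: "0 \<le> D" using L_ge_1 by (simp add: D_def)
  have k: "0 < k" using c by (simp add: k_def)
  have a: "0 < a" using c by (simp add: a_def)
  have v: "c * n \<le> sigma2" "sigma2 \<le> L * n" "0 < sigma2"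
    using sigma2_ge[OF cn] sigma2_le cn by linarith+
  obtain m where m: "sigma2 \<le> m" "m < sigma2 + 1"
    and TP: "\<And>t. centred_char mu (TP mu sigma2) t = exp (m * (cis t - 1 - \<i> * t))"
      "\<And>t. centred_char1 mu (TP mu sigma2) t = m * (cis t - 1) * exp (m * (cis t - 1 - \<i> * t))"
    and TPint: "integrable (measure_pmf (TP mu sigma2)) real_of_int"
    using TP_char_fun[OF v(3), of mu] by metis
  let ?P = "lawW lam d n" and ?Q = "TP mu sigma2"
  define \<phi> where "\<phi> t = centred_char mu ?P t - centred_char mu ?Q t" for t
  define \<phi>1 where "\<phi>1 t = centred_char1 mu ?P t - centred_char1 mu ?Q t" for t
  have norm_TP: "norm (exp (m * (cis t - 1 - \<i> * t))) \<le> exp (- (a * n * t\<^sup>2))" if t: "\<bar>t\<bar> \<le> pi" for t :: real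
  proof -
    have "norm (exp (m * (cis t - 1 - \<i> * t))) = exp (m * (cos t - 1))" by simp
    also have "\<dots> \<le> exp (- (a * n * t\<^sup>2))"
    proof -
      have "c * n * (t\<^sup>2 / 12) \<le> m * (1 - cos t)"
        using one_minus_cos_ge_full[OF t] v m c by (intro mult_mono) auto
      then show ?thesis by (simp add: a_def algebra_simps)
    qed
    finally show ?thesis .
  qed
  have err: "norm (\<phi>1 t - \<i> * t * sigma2 * \<phi> t) \<le> D * (\<bar>t\<bar> + n * t\<^sup>2) * exp (- (a * n * t\<^sup>2))"
    if t: "\<bar>t\<bar> \<le> pi" for t :: real
  proof -
    let ?e = "exp (- (a * n * t\<^sup>2))" and ?\<psi> = "exp (m * (cis t - 1 - \<i> * t))"
    have 1: "norm (centred_char1 mu ?P t - \<i> * t * sigma2 * centred_char mu ?P t) \<le> 5 * L\<^sup>2 * (n * t\<^sup>2) * ?e"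
    proof -
      have "decay t \<le> ?e" using c by (simp add: decay_def a_def)
      then have "5 * L\<^sup>2 * (n * t\<^sup>2 * decay t) \<le> 5 * L\<^sup>2 * (n * t\<^sup>2 * ?e)"
        by (intro mult_left_mono) auto
      then show ?thesis using centred_cis_approx(1)[OF t] unfolding lawW_centred_char by (simp add: mult.assoc)
    qed
    have 2: "norm (centred_char1 mu ?Q t - \<i> * t * sigma2 * centred_char mu ?Q t) \<le> ((L + 1) * (n * t\<^sup>2) + \<bar>t\<bar>) * ?e"
    proof -
      \<comment> \<open>The first summand is a Taylor remainder of order \<open>n * t^2\<close>. The
        second comes from rounding; as \<open>m\<close> and \<open>sigma2\<close> differ by less
        than 1, it is at most \<open>\<bar>t\<bar>\<close>.\<close>
      have "centred_char1 mu ?Q t - \<i> * t * sigma2 * centred_char mu ?Q t =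
          (m * (cis t - 1 - \<i> * t) + \<i> * t * (m - sigma2)) * ?\<psi>"
        unfolding TP by (simp add: algebra_simps)
      moreover have "norm (m * (cis t - 1 - \<i> * t) + \<i> * t * (m - sigma2)) \<le> (L + 1) * (n * t\<^sup>2) + \<bar>t\<bar>"
      proof (rule order_trans[OF norm_triangle_ineq add_mono])
        have "norm (m * (cis t - 1 - \<i> * t)) = m * norm (cis t - 1 - \<i> * t)"
          using m v by (simp add: norm_mult)
        also have "\<dots> \<le> ((L + 1) * n) * t\<^sup>2"
        proof (intro mult_mono)
          have "1 \<le> real n" using n_pos by simp
          then show "m \<le> (L + 1) * n" using m v(2) by (simp add: algebra_simps)
          show "norm (cis t - 1 - \<i> * t) \<le> t\<^sup>2"
            using norm_cis_taylor_one_le[of t] zero_le_power2[of t] by linarith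
        qed (use m v L_ge_1 in auto)
        finally show "norm (m * (cis t - 1 - \<i> * t)) \<le> (L + 1) * (n * t\<^sup>2)" by simp
        have "norm (\<i> * t * (m - sigma2)) = \<bar>t\<bar> * \<bar>m - sigma2\<bar>"
          by (simp add: norm_mult flip: of_real_diff)
        also have "\<dots> \<le> \<bar>t\<bar> * 1" using m by (intro mult_left_mono) auto
        finally show "norm (\<i> * t * (m - sigma2)) \<le> \<bar>t\<bar>" by simp
      qed
      ultimately show ?thesis
        using norm_TP[OF t] L_ge_1 by (simp only: norm_mult) (intro mult_mono; simp)
    qed
    have eq: "\<phi>1 t - \<i> * t * sigma2 * \<phi> t = (centred_char1 mu ?P t - \<i> * t * sigma2 * centred_char mu ?P t)
        - (centred_char1 mu ?Q t - \<i> * t * sigma2 * centred_char mu ?Q t)"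
      by (simp add: \<phi>_def \<phi>1_def algebra_simps)
    have "norm (\<phi>1 t - \<i> * t * sigma2 * \<phi> t) \<le> 5 * L\<^sup>2 * (n * t\<^sup>2) * ?e + ((L + 1) * (n * t\<^sup>2) + \<bar>t\<bar>) * ?e"
      unfolding eq by (rule order_trans[OF norm_triangle_ineq4 add_mono[OF 1 2]])
    also have "\<dots> = (D * (n * t\<^sup>2) + \<bar>t\<bar>) * ?e" by (simp add: D_def algebra_simps)
    also have "\<dots> \<le> (D * (\<bar>t\<bar> + n * t\<^sup>2)) * ?e"
    proof (rule mult_right_mono)
      have "1 \<le> D" using L_ge_1 by (simp add: D_def)
      then have "1 * \<bar>t\<bar> \<le> D * \<bar>t\<bar>" by (intro mult_right_mono) auto
      then show "D * (n * t\<^sup>2) + \<bar>t\<bar> \<le> D * (\<bar>t\<bar> + n * t\<^sup>2)" by (simp add: distrib_left)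
    qed simp
    finally show ?thesis .
  qed
  have TPderiv: "(centred_char mu ?Q has_vector_derivative (\<i> * centred_char1 mu ?Q t)) (at t)" for t
  proof -
    have "((\<lambda>z. exp (m * (exp (\<i> * z) - 1 - \<i> * z))) has_field_derivative
        \<i> * (m * (exp (\<i> * t) - 1) * exp (m * (exp (\<i> * t) - 1 - \<i> * t)))) (at (complex_of_real t))"
      by (auto intro!: derivative_eq_intros simp: algebra_simps)
    then have "((\<lambda>t. exp (m * (exp (\<i> * complex_of_real t) - 1 - \<i> * complex_of_real t))) has_vector_derivative
        \<i> * (m * (exp (\<i> * t) - 1) * exp (m * (exp (\<i> * t) - 1 - \<i> * t)))) (at t)"
      by (rule has_vector_derivative_real_field)
    then show ?thesis unfolding TP[abs_def] TP by (simp add: cis_conv_exp)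
  qed
  have \<phi>deriv: "(\<phi> has_vector_derivative (\<i> * \<phi>1 x)) (at x)" for x
    unfolding \<phi>_def[abs_def] \<phi>1_def right_diff_distrib
    by (intro has_vector_derivative_diff lawW_centred_char_derivative TPderiv)
  have \<phi>0: "\<phi> 0 = 0" by (simp add: \<phi>_def centred_char_def)
  have \<phi>bound: "norm (\<phi> t) \<le> D * (t\<^sup>2 + n * \<bar>t\<bar> ^ 3) * exp (- (a * n * t\<^sup>2))" if t: "\<bar>t\<bar> \<le> pi" for t :: real
    using v c D n_pos by (intro gaussian_ode_bound[OF \<phi>deriv \<phi>0 err _ _ _ t]) (auto simp: a_def)
  have E: "(1 + s\<^sup>2 * t\<^sup>2) ^ 2 * exp (- (a * n * t\<^sup>2)) \<le> 1 / k / (1 + s\<^sup>2 * t\<^sup>2)" for t :: real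
  proof -
    have pos: "0 < 1 + s\<^sup>2 * t\<^sup>2" by (simp add: add_pos_nonneg)
    have "(1 + s\<^sup>2 * t\<^sup>2) ^ 3 * exp (- (a * (s\<^sup>2 * t\<^sup>2))) \<le> 1 / k"
      using cube_exp_bound[of "s\<^sup>2 * t\<^sup>2" a] a by (simp add: k_def a_def)
    have "(1 + s\<^sup>2 * t\<^sup>2) ^ 2 * exp (- (a * n * t\<^sup>2)) * (1 + s\<^sup>2 * t\<^sup>2) \<le> 1 / k"
    proof -
      have "a * n * t\<^sup>2 = a * (s\<^sup>2 * t\<^sup>2)" by (simp add: s(2))
      moreover have "x ^ 2 * e * x = x ^ 3 * e" for x e :: real
        by (simp add: power2_eq_square power3_eq_cube mult_ac)
      ultimately show ?thesis using \<open>(1 + s\<^sup>2 * t\<^sup>2) ^ 3 * exp (- (a * (s\<^sup>2 * t\<^sup>2))) \<le> 1 / k\<close> by presburger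
    qed
    then show ?thesis using pos by (simp only: pos_le_divide_eq)
  qed
  \<comment> \<open>In the variable \<open>y = s * \<bar>t\<bar>\<close> all polynomial factors are
    dominated by \<open>(1 + y^2)^2\<close>, which \<open>E\<close> trades for the kernel.\<close>
  have poly: "y \<le> (1 + y\<^sup>2)\<^sup>2" "y\<^sup>2 \<le> (1 + y\<^sup>2)\<^sup>2" "y ^ 3 \<le> (1 + y\<^sup>2)\<^sup>2" "y ^ 4 \<le> (1 + y\<^sup>2)\<^sup>2"
    if y: "0 \<le> y" for y :: real
  proof -
    have e: "(1 + y\<^sup>2)\<^sup>2 = 1 + 2 * y\<^sup>2 + y ^ 4" by (simp add: power2_eq_square algebra_simps flip: power_add) (simp add: power4_eq_xxxx algebra_simps)
    have "0 \<le> (1 - y)\<^sup>2" by simp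
    then have 1: "2 * y \<le> 1 + y\<^sup>2" by (simp add: power2_eq_square algebra_simps)
    have "2 * y * y\<^sup>2 \<le> (1 + y\<^sup>2) * y\<^sup>2" using 1 by (intro mult_right_mono) auto
    then have 2: "2 * y ^ 3 \<le> y\<^sup>2 + y ^ 4" by (simp add: power2_eq_square power3_eq_cube power4_eq_xxxx algebra_simps)
    have 3: "0 \<le> y\<^sup>2" "0 \<le> y ^ 3" "0 \<le> y ^ 4" using y by auto
    show "y \<le> (1 + y\<^sup>2)\<^sup>2" "y\<^sup>2 \<le> (1 + y\<^sup>2)\<^sup>2" "y ^ 3 \<le> (1 + y\<^sup>2)\<^sup>2" "y ^ 4 \<le> (1 + y\<^sup>2)\<^sup>2"
      unfolding e using y 1 2 3 by linarith+
  qed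
  have gc: "distance_const = 2 * (L + 1) * D / k" by (simp add: distance_const_def D_def k_def)
  have bound0: "norm (centred_char mu ?P t - centred_char mu ?Q t) \<le> distance_const / (s * (1 + s\<^sup>2 * t\<^sup>2))" if t: "\<bar>t\<bar> \<le> pi" for t :: real
  proof -
    define y where "y = s * \<bar>t\<bar>"
    have y: "0 \<le> y" "y\<^sup>2 = s\<^sup>2 * t\<^sup>2" using s by (auto simp: y_def power_mult_distrib)
    \<comment> \<open>Rescaling gains the factor \<open>1 / s\<close>: the cubic term is exactly
      \<open>y ^ 3 / s\<close>, and the quadratic one is at most \<open>y^2 / s\<close> because
      \<open>s \<ge> 1\<close>.\<close>
    have "t\<^sup>2 + n * \<bar>t\<bar> ^ 3 \<le> (y\<^sup>2 + y ^ 3) / s"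
    proof -
      have "s \<le> s\<^sup>2" using mult_right_mono[of 1 s s] s(1) by (simp add: power2_eq_square)
      then have "s * t\<^sup>2 \<le> s\<^sup>2 * t\<^sup>2" by (intro mult_right_mono) auto
      moreover have "s * (n * \<bar>t\<bar> ^ 3) = y ^ 3"
        by (simp add: y_def power_mult_distrib s(2)[symmetric] power2_eq_square power3_eq_cube)
      ultimately have "s * (t\<^sup>2 + n * \<bar>t\<bar> ^ 3) \<le> y\<^sup>2 + y ^ 3" by (simp add: y distrib_left)
      then show ?thesis using s by (simp add: pos_le_divide_eq mult.commute)
    qed
    also have "\<dots> \<le> (2 * (1 + s\<^sup>2 * t\<^sup>2)\<^sup>2) / s"
      using poly(2,3)[OF y(1)] s unfolding y(2)[symmetric] by (intro divide_right_mono) auto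
    finally have "norm (\<phi> t) \<le> D * ((2 * (1 + s\<^sup>2 * t\<^sup>2)\<^sup>2) / s) * exp (- (a * n * t\<^sup>2))"
      using D by (intro order_trans[OF \<phi>bound[OF t]] mult_right_mono mult_left_mono) auto
    also have "\<dots> = 2 * D / s * ((1 + s\<^sup>2 * t\<^sup>2)\<^sup>2 * exp (- (a * n * t\<^sup>2)))" by simp
    also have "\<dots> \<le> 2 * D / s * (1 / k / (1 + s\<^sup>2 * t\<^sup>2))"
      using D s by (intro mult_left_mono E) auto
    also have "\<dots> = (2 * D / k) / (s * (1 + s\<^sup>2 * t\<^sup>2))" by simp
    also have "\<dots> \<le> distance_const / (s * (1 + s\<^sup>2 * t\<^sup>2))"
    proof (intro divide_right_mono)
      have "2 * 1 * D \<le> 2 * (L + 1) * D" using L_ge_1 D by (intro mult_right_mono mult_left_mono) auto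
      then show "2 * D / k \<le> distance_const" unfolding gc using k by (intro divide_right_mono) auto
    qed (use s in auto)
    finally show ?thesis by (simp add: \<phi>_def)
  qed
  have bound1: "norm (centred_char1 mu ?P t - centred_char1 mu ?Q t) \<le> distance_const / (1 + s\<^sup>2 * t\<^sup>2)" if t: "\<bar>t\<bar> \<le> pi" for t :: real
  proof -
    define y where "y = s * \<bar>t\<bar>"
    let ?e = "exp (- (a * n * t\<^sup>2))"
    have y: "0 \<le> y" "y\<^sup>2 = s\<^sup>2 * t\<^sup>2" using s by (auto simp: y_def power_mult_distrib)
    have t1: "\<bar>t\<bar> \<le> y" using s mult_right_mono[of 1 s "\<bar>t\<bar>"] by (simp add: y_def)
    \<comment> \<open>The derivative is recovered from the differential inequality itself, with the
      bound on \<open>\<phi>\<close> inserted.\<close>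
    have "norm (\<phi>1 t) \<le> norm (\<phi>1 t - \<i> * t * sigma2 * \<phi> t) + norm (\<i> * t * sigma2 * \<phi> t)"
      using norm_triangle_ineq[of "\<phi>1 t - \<i> * t * sigma2 * \<phi> t" "\<i> * t * sigma2 * \<phi> t"] by simp
    also have "\<dots> \<le> D * (\<bar>t\<bar> + n * t\<^sup>2) * ?e + (\<bar>t\<bar> * (L * n)) * (D * (t\<^sup>2 + n * \<bar>t\<bar> ^ 3) * ?e)"
    proof (rule add_mono[OF err[OF t]])
      have "norm (\<i> * t * sigma2 * \<phi> t) = (\<bar>t\<bar> * sigma2) * norm (\<phi> t)"
        using v by (simp add: norm_mult)
      also have "\<dots> \<le> (\<bar>t\<bar> * (L * n)) * (D * (t\<^sup>2 + n * \<bar>t\<bar> ^ 3) * ?e)"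
        using v L_ge_1 by (intro mult_mono \<phi>bound[OF t] mult_left_mono) auto
      finally show "norm (\<i> * t * sigma2 * \<phi> t) \<le> (\<bar>t\<bar> * (L * n)) * (D * (t\<^sup>2 + n * \<bar>t\<bar> ^ 3) * ?e)" .
    qed
    also have "\<dots> = D * ((\<bar>t\<bar> + n * t\<^sup>2) + L * (n * \<bar>t\<bar> * (t\<^sup>2 + n * \<bar>t\<bar> ^ 3))) * ?e"
      by (simp add: algebra_simps)
    also have "\<dots> \<le> D * ((2 * (1 + y\<^sup>2)\<^sup>2) + L * (2 * (1 + y\<^sup>2)\<^sup>2)) * ?e"
    proof (intro mult_right_mono mult_left_mono add_mono)
      have "n * t\<^sup>2 = y\<^sup>2" by (simp add: y s)
      then show "\<bar>t\<bar> + n * t\<^sup>2 \<le> 2 * (1 + y\<^sup>2)\<^sup>2" using t1 poly(1,2)[OF y(1)] by linarith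
      have "n * \<bar>t\<bar> * t\<^sup>2 \<le> y ^ 3"
      proof -
        have "n * \<bar>t\<bar> * t\<^sup>2 = y\<^sup>2 * \<bar>t\<bar>" by (simp add: y s)
        also have "\<dots> \<le> y\<^sup>2 * y" using t1 by (intro mult_left_mono) auto
        finally show ?thesis by (simp add: power2_eq_square power3_eq_cube)
      qed
      moreover have "n * \<bar>t\<bar> * (n * \<bar>t\<bar> ^ 3) = y ^ 4"
        by (simp add: y_def power_mult_distrib s(2)[symmetric] power2_eq_square power3_eq_cube power4_eq_xxxx)
      ultimately show "n * \<bar>t\<bar> * (t\<^sup>2 + n * \<bar>t\<bar> ^ 3) \<le> 2 * (1 + y\<^sup>2)\<^sup>2"
        unfolding distrib_left using poly(3,4)[OF y(1)] by linarith
    qed (use D L_ge_1 in auto)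
    also have "\<dots> = 2 * (L + 1) * D * ((1 + s\<^sup>2 * t\<^sup>2)\<^sup>2 * ?e)" unfolding y(2) by (simp add: algebra_simps)
    also have "\<dots> \<le> 2 * (L + 1) * D * (1 / k / (1 + s\<^sup>2 * t\<^sup>2))"
      using D L_ge_1 by (intro mult_left_mono E) auto
    also have "\<dots> = distance_const / (1 + s\<^sup>2 * t\<^sup>2)" by (simp add: gc)
    finally show ?thesis by (simp add: \<phi>1_def)
  qed
  have cont: "continuous_on {-pi..pi} (centred_char mu R)" "continuous_on {-pi..pi} (centred_char1 mu R)" if "R \<in> {?P, ?Q}" for R
  proof -
    have "continuous_on {-pi..pi} (centred_char mu ?P)" "continuous_on {-pi..pi} (centred_char1 mu ?P)"
      unfolding lawW_centred_char[abs_def] bern_mean_def by (intro continuous_intros)+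
    moreover have "continuous_on {-pi..pi} (centred_char mu ?Q)" "continuous_on {-pi..pi} (centred_char1 mu ?Q)"
      unfolding TP[abs_def] by (intro continuous_intros)+
    ultimately show "continuous_on {-pi..pi} (centred_char mu R)" "continuous_on {-pi..pi} (centred_char1 mu R)"
      using that by auto
  qed
  have Pint: "integrable (measure_pmf ?P) real_of_int"
    by (intro integrable_measure_pmf_finite finite_set_lawW)
  have g0: "0 \<le> distance_const" unfolding gc using L_ge_1 D k by simp
  show "dloc ?P ?Q \<le> distance_const / n"
    using pmf_distance_bounds(1)[OF Pint TPint cont s(1) g0 bound0 bound1] by (simp add: s)
  show "dTV ?P ?Q \<le> 3 * distance_const / sqrt n"
    using pmf_distance_bounds(2)[OF Pint TPint cont s(1) g0 bound0 bound1] by (simp add: s_def)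
qed

end

section \<open>Passage to the asymptotic statement\<close>

lemma dTV_nonneg: "0 \<le> dTV P Q"
proof -
  have "\<bar>measure_pmf.prob P A - measure_pmf.prob Q A\<bar> \<le> 1" for A
    using measure_pmf.prob_le_1[of P A] measure_pmf.prob_le_1[of Q A]
      measure_nonneg[of "measure_pmf P" A] measure_nonneg[of "measure_pmf Q" A] by linarith
  then have "bdd_above (range (\<lambda>A. \<bar>measure_pmf.prob P A - measure_pmf.prob Q A\<bar>))"
    by (intro bdd_aboveI[of _ 1]) auto
  then show ?thesis unfolding dTV_def by (rule cSUP_upper2[of "\<lambda>A. _ A" _ "{}"]) auto
qed

lemma dloc_nonneg: "0 \<le> dloc P Q"
proof -
  have "\<bar>pmf P a - pmf Q a\<bar> \<le> 1" for a
    using pmf_le_1[of P a] pmf_le_1[of Q a] pmf_nonneg[of P a] pmf_nonneg[of Q a] by linarith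
  then have "bdd_above (range (\<lambda>a. \<bar>pmf P a - pmf Q a\<bar>))"
    by (intro bdd_aboveI[of _ 1]) auto
  then show ?thesis unfolding dloc_def by (rule cSUP_upper2[of _ _ 0]) auto
qed

theorem mainTheorem3:
  fixes lam :: real and d :: nat
  assumes "lam > 0"
  shows "(\<lambda>n. dTV (lawW lam d n) (TP (muW lam d n) (varW lam d n)))
           \<in> O(\<lambda>n. 1 / sqrt (varW lam d n)) \<and>
         (\<lambda>n. dloc (lawW lam d n) (TP (muW lam d n) (varW lam d n)))
           \<in> O(\<lambda>n. ln (sqrt (varW lam d n)) powr (5/2) / varW lam d n)"
proof -
  obtain c C N where c: "0 < c" "0 \<le> C" "smooth_bound lam d c C N"
    using smoothing[OF assms] by blast
  \<comment> \<open>Locale constants exported without \<open>n\<close>, so they can serve in the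
    Landau bounds.\<close>
  define gap where "gap = smoothed_graph.distance_const lam c C"
  define M where "M = smoothed_graph.L lam C"
  \<comment> \<open>The entry \<open>9 / c\<close> makes the variance at least 9; its root is then
    at least 3, hence above \<open>exp 1\<close>, and the logarithm is at least 1.\<close>
  define N' where "N' = max (max N 1) (nat \<lceil>max lam (9 / c)\<rceil>)"
  have bounds: "0 \<le> gap \<and> 9 \<le> varW lam d n \<and> varW lam d n \<le> M * n \<and> 1 \<le> M \<and> 1 \<le> n \<and>
      dloc (lawW lam d n) (TP (muW lam d n) (varW lam d n)) \<le> gap / n \<and>
      dTV (lawW lam d n) (TP (muW lam d n) (varW lam d n)) \<le> 3 * gap / sqrt n"
    if n: "N' \<le> n" for n
  proof -
    have n': "N \<le> n" "1 \<le> n" "lam \<le> n" "9 / c \<le> n" using n by (auto simp: N'_def)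
    interpret smoothed_graph lam c C d N n
      by unfold_locales (use assms c n' in auto)
    have cn: "9 \<le> c * n" using n'(4) c(1) by (simp add: field_simps)
    then have cn1: "1 \<le> c * n" by linarith
    note b = distance_bounds[OF cn1]
    have "0 \<le> distance_const / n" using b(1) dloc_nonneg order_trans by blast
    then have "0 \<le> distance_const" using n'(2) by (simp add: zero_le_divide_iff)
    then show ?thesis
      using b sigma2_ge[OF cn1] sigma2_le L_ge_1 cn n'(2)
      unfolding lawW_moments gap_def M_def by simp
  qed
  have M: "0 \<le> M" using bounds[of N'] by simp
  show ?thesis
  proof (intro conjI bigoI eventually_sequentiallyI)
    fix n assume n: "N' \<le> n"
    let ?v = "varW lam d n"
    note b = bounds[OF n]
    have "3 * gap / sqrt n \<le> 3 * gap * sqrt M * (1 / sqrt ?v)"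
    proof -
      have "sqrt ?v \<le> sqrt M * sqrt n" using b by (simp flip: real_sqrt_mult)
      then have "1 / sqrt n \<le> sqrt M * (1 / sqrt ?v)" using b by (simp add: field_simps)
      then have "3 * gap * (1 / sqrt n) \<le> 3 * gap * (sqrt M * (1 / sqrt ?v))"
        using b by (intro mult_left_mono) auto
      then show ?thesis by simp
    qed
    then show "norm (dTV (lawW lam d n) (TP (muW lam d n) ?v)) \<le> (3 * gap * sqrt M) * norm (1 / sqrt ?v)"
      using b dTV_nonneg[of "lawW lam d n" "TP (muW lam d n) ?v"] by simp
  next
    fix n assume n: "N' \<le> n"
    let ?v = "varW lam d n"
    note b = bounds[OF n]
    have "gap / n \<le> gap * M * (1 / ?v)"
    proof -
      have "1 / n \<le> M * (1 / ?v)" using b by (simp add: field_simps)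
      then have "gap * (1 / n) \<le> gap * (M * (1 / ?v))" using b by (intro mult_left_mono) auto
      then show ?thesis by simp
    qed
    \<comment> \<open>The local distance is already of order \<open>1 / ?v\<close>; the logarithmic
      factor is at least 1 and only enlarges the bound.\<close>
    also have "\<dots> \<le> gap * M * (ln (sqrt ?v) powr (5/2) / ?v)"
    proof (intro mult_left_mono divide_right_mono)
      have "3 \<le> sqrt ?v" using b by (intro real_le_rsqrt) simp
      then have "exp 1 \<le> sqrt ?v" using exp_le by linarith
      then have "1 \<le> ln (sqrt ?v)" using b by (simp add: ln_ge_iff)
      then show "1 \<le> ln (sqrt ?v) powr (5/2)" by (intro ge_one_powr_ge_zero) auto
    qed (use b M in auto)
    finally show "norm (dloc (lawW lam d n) (TP (muW lam d n) ?v)) \<le>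
        (gap * M) * norm (ln (sqrt ?v) powr (5/2) / ?v)"
      using b dloc_nonneg[of "lawW lam d n" "TP (muW lam d n) ?v"] by simp
  qed
qed

end
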